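(* Let $\alpha=[a_1,a_2,\dots]\in(0,1)$ be an irrational of bounded type and set $\overline a=(a_n)_{n\in\mathbb N}$. For each $\epsilon>0$ there are $\rho>0$ and $\lambda_0>0$ such that $$\dim_H\left(L_\lambda\cap\Lambda^{\text{surv}}_\lambda(\overline a,O_\rho)\right)\ge 1-\epsilon\qquad\text{for all }\lambda\in[0,\lambda_0].$$ (Here $\rho$ and $\lambda_0$ are small enough that the set $\Lambda^{\text{surv}}_\lambda(\overline a,O_\rho)$ is defined for all $\lambda\in[0,\lambda_0]$.)
   Context: $\alpha=[a_1,a_2,\dots]$ denotes the continued fraction expansion $\alpha=\cfrac{1}{a_1+\cfrac{1}{a_2+\cdots}}$, $a_k\in\mathbb N=\{1,2,\dots\}$; $\alpha$ is of bounded type if only finitely many different values occur among the $a_k$. $\dim_H$ is Hausdorff dimension. Trace maps: let $G,H:\mathbb R^3\to\mathbb R^3$, $G(x_1,x_2,x_3)=(2x_1x_3-x_2,\,x_1,\,x_3)$, $H(x_1,x_2,x_3)=(x_1,x_3,x_2)$, and for $a\in\mathbb N$ let $T_a=G^a\circ H$. For $\lambda\ge 0$ let $$S_\lambda=\left\{(x_1,x_2,x_3)\in\mathbb R^3: x_1^2+x_2^2+x_3^2-2x_1x_2x_3=1+\tfrac{\lambda^2}{4}\right\},$$ which is invariant under every $T_a$; write $T_{\lambda,a}$ for the restriction of $T_a$ to $S_\lambda$. Let $$L_\lambda=\left\{\left(\tfrac{E-\lambda}{2},\tfrac E2,1\right):E\in\mathbb R\right\}\subset S_\lambda .$$ Let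 $P_1=(1,1,1)$, $P_2=(-1,-1,1)$, $P_3=(1,-1,-1)$, $P_4=(-1,1,-1)$, and for $\rho>0$ let $O_\rho=\bigcup_{i=1}^4B_\rho(P_i)$ (open balls in $\mathbb R^3$). For small $\rho>0$ and for $\lambda\ge0$ small enough depending on $\rho$, the set $S_\lambda\setminus O_\rho$ consists of five disjoint connected components, exactly one of which is bounded; this bounded component is denoted $\mathbb S_{\lambda,O_\rho}$. For such $\rho,\lambda$, $$\Lambda^{\text{surv}}_\lambda(\overline a,O_\rho)=\left\{\boldsymbol x\in\mathbb S_{\lambda,O_\rho}: T_{\lambda,a_n}\circ\cdots\circ T_{\lambda,a_1}(\boldsymbol x)\in\mathbb S_{\lambda,O_\rho}\ \text{for all } n\in\mathbb N\right\}.$$ *)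

theory Defs
  imports "HOL-Analysis.Analysis"
begin

text \<open>Continued fractions. Sequences of partial quotients are indexed from \<open>1\<close>; the value
  \<open>a 0\<close> is never used. \<open>cfrac_conv a k n\<close> is the finite continued fraction
  \<open>1/(a k + 1/(a (k+1) + \<dots> + 1/a (k+n-1)))\<close> with \<open>n\<close> partial quotients.\<close>

fun cfrac_conv :: "(nat \<Rightarrow> nat) \<Rightarrow> nat \<Rightarrow> nat \<Rightarrow> real" where
  "cfrac_conv a k 0 = 0"
| "cfrac_conv a k (Suc n) = 1 / (real (a k) + cfrac_conv a (Suc k) n)"

definition has_cfrac :: "real \<Rightarrow> (nat \<Rightarrow> nat) \<Rightarrow> bool" where
  "has_cfrac \<alpha> a \<longleftrightarrow> (\<forall>k\<ge>1. a k \<ge> 1) \<and> (\<lambda>n. cfrac_conv a 1 n) \<longlonglongrightarrow> \<alpha>"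

definition bounded_type :: "(nat \<Rightarrow> nat) \<Rightarrow> bool" where
  "bounded_type a \<longleftrightarrow> finite (a ` {1..})"


text \<open>Hausdorff measure and dimension. Covers are restricted to bounded sets because
  \<^const>\<open>diameter\<close> is unspecified on unbounded ones. The dimension only uses exponents
  \<open>s > 0\<close>, so the value of \<open>0 powr 0\<close> is irrelevant.\<close>

definition hausdorff_content :: "real \<Rightarrow> real \<Rightarrow> 'a::metric_space set \<Rightarrow> ennreal" where
  "hausdorff_content \<delta> s A =
     (INF U \<in> {U :: nat \<Rightarrow> 'a set. A \<subseteq> (\<Union>i. U i) \<and> (\<forall>i. bounded (U i) \<and> diameter (U i) \<le> \<delta>)}.
        \<Sum>i. ennreal (diameter (U i) powr s))"

definition hausdorff_measure :: "real \<Rightarrow> 'a::metric_space set \<Rightarrow> ennreal" where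
  "hausdorff_measure s A = (SUP \<delta> \<in> {0<..}. hausdorff_content \<delta> s A)"

definition hausdorff_dim :: "'a::metric_space set \<Rightarrow> ereal" where
  "hausdorff_dim A = (INF s \<in> {s. 0 < s \<and> hausdorff_measure s A = 0}. ereal s)"


definition G_map :: "real^3 \<Rightarrow> real^3" where
  "G_map x = vector [2 * x$1 * x$3 - x$2, x$1, x$3]"

definition H_map :: "real^3 \<Rightarrow> real^3" where
  "H_map x = vector [x$1, x$3, x$2]"

definition trace_map :: "nat \<Rightarrow> real^3 \<Rightarrow> real^3" where
  "trace_map a = (G_map ^^ a) \<circ> H_map"

text \<open>\<open>trace_iter a n = trace_map (a n) \<circ> \<dots> \<circ> trace_map (a 1)\<close>\<close>

fun trace_iter :: "(nat \<Rightarrow> nat) \<Rightarrow> nat \<Rightarrow> real^3 \<Rightarrow> real^3" where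
  "trace_iter a 0 = id"
| "trace_iter a (Suc n) = trace_map (a (Suc n)) \<circ> trace_iter a n"

definition S_surf :: "real \<Rightarrow> (real^3) set" where
  "S_surf l = {x. (x$1)\<^sup>2 + (x$2)\<^sup>2 + (x$3)\<^sup>2 - 2 * x$1 * x$2 * x$3 = 1 + l\<^sup>2 / 4}"

definition L_line :: "real \<Rightarrow> (real^3) set" where
  "L_line l = {vector [(E - l) / 2, E / 2, 1] | E. True}"

definition O_nbhd :: "real \<Rightarrow> (real^3) set" where
  "O_nbhd \<rho> = (\<Union>P \<in> {vector [1, 1, 1], vector [-1, -1, 1], vector [1, -1, -1], vector [-1, 1, -1]}.
     ball P \<rho>)"

text \<open>The condition on \<open>\<rho>\<close> and \<open>\<lambda>\<close> under which the bounded component and the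
  surviving set below are defined.\<close>

definition admissible :: "real \<Rightarrow> real \<Rightarrow> bool" where
  "admissible \<rho> l \<longleftrightarrow> card (components (S_surf l - O_nbhd \<rho>)) = 5 \<and>
     (\<exists>!C. C \<in> components (S_surf l - O_nbhd \<rho>) \<and> bounded C)"

definition S_bdd :: "real \<Rightarrow> real \<Rightarrow> (real^3) set" where
  "S_bdd \<rho> l = (THE C. C \<in> components (S_surf l - O_nbhd \<rho>) \<and> bounded C)"

definition surv :: "(nat \<Rightarrow> nat) \<Rightarrow> real \<Rightarrow> real \<Rightarrow> (real^3) set" where
  "surv a \<rho> l = {x \<in> S_bdd \<rho> l. \<forall>n\<ge>1. trace_iter a n x \<in> S_bdd \<rho> l}"


text \<open>Since the surfaces are invariant, iterating on \<open>\<real>\<^sup>3\<close> agrees with iterating the restrictions.\<close>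

lemma trace_map_S_surf: "x \<in> S_surf l \<Longrightarrow> trace_map a x \<in> S_surf l"
proof -
  assume x: "x \<in> S_surf l"
  have G: "G_map y \<in> S_surf l" if "y \<in> S_surf l" for y
    using that by (simp add: S_surf_def G_map_def vector_3 power2_eq_square algebra_simps)
  have "(G_map ^^ a) y \<in> S_surf l" if "y \<in> S_surf l" for y
    using that by (induction a) (auto intro: G)
  moreover have "H_map x \<in> S_surf l"
    using x by (simp add: S_surf_def H_map_def vector_3 algebra_simps)
  ultimately show ?thesis
    by (simp add: trace_map_def)
qed

lemma L_line_subset: "L_line l \<subseteq> S_surf l"
  by (auto simp: L_line_def S_surf_def vector_3 power2_eq_square field_simps)

end

theory Submission
  imports Defs
begin

text \<open>For \<open>l = 0\<close> the bounded part of the surface is the image of the torus under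
\<open>(\<theta>, \<phi>) \<mapsto> (cos (\<theta> + \<phi>), cos \<theta>, cos \<phi>)\<close>, the map \<open>trace_map a\<close> acts there as the
hyperbolic linear map \<open>(\<theta>, \<phi>) \<mapsto> (a \<theta> + \<phi>, \<theta>)\<close>, the line is the circle \<open>\<phi> = 0\<close>, and the four
punctures are the images of the points with both angles in \<open>\<pi> \<int>\<close>. Along the line the angle
\<open>\<theta>\<^sub>n\<close> at time \<open>n\<close> is therefore expanded exponentially, and the starting points whose angle
\<open>\<theta>\<^sub>n\<close> keeps distance \<open>\<kappa>\<close> from \<open>\<pi> \<int>\<close> at all times form a Cantor set whose dimension tends to \<open>1\<close>
as \<open>\<kappa>\<close> tends to \<open>0\<close>. Each puncture has second coordinate \<open>\<plusminus>1\<close>, so these orbits, which satisfy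
\<open>\<bar>x\<^sub>2\<bar> \<le> cos \<kappa>\<close> at all times, never come near one. It is enough to find this smaller set for
all small \<open>l\<close>.

The restriction to it is what makes small positive \<open>l\<close> as easy as \<open>l = 0\<close>. While \<open>\<theta>\<close> keeps
distance \<open>\<kappa>\<close> from \<open>\<pi> \<int>\<close>, every point of the surface that occurs can be written as
\<open>(A cos (\<psi> + \<theta>), cos \<theta>, A cos \<psi>)\<close> with amplitude \<open>A = sqrt (1 + l\<^sup>2 / (4 sin\<^sup>2 \<theta>))\<close>; the trace map is a
Chebyshev recursion, so it only advances the phase of a cosine of amplitude \<open>A\<close>, and one returns
to the normal form by solving \<open>cos \<theta>' = A cos (a \<theta> + \<psi>)\<close> and \<open>A' cos \<psi>' = cos \<theta>\<close> for angles close to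
\<open>a \<theta> + \<psi>\<close> and \<open>\<theta>\<close> (\<open>trace_map_polar\<close>). Both the values and the increments of the new angles
differ from those of the linear map by an error that is small with \<open>l\<close>
(\<open>angle_step_value\<close>, \<open>angle_step_increment\<close>).

The Cantor set is a tree of intervals. An interval on which \<open>\<theta>\<^sub>n\<close> covers exactly a short length
\<open>ell\<close> is followed for a bounded number \<open>N\<close> of steps, until the linear model has expanded it by
about \<open>2\<^sup>e\<close>. It is cut beforehand into \<open>parts\<close> pieces of equal \<open>\<theta>\<^sub>n\<close>-length. In the linear
model the image of the whole interval has length at most \<open>1 < \<pi>\<close> at each of these times, hence
meets at most one point of \<open>\<pi> \<int>\<close>, and because \<open>\<kappa>\<close> is tiny compared with the pieces this spoils
at most two pieces per time. As \<open>N\<close> is only logarithmic in the number of pieces, half of them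
survive (\<open>stage_children\<close>), and errors of the true dynamics against the model stay small over
\<open>N\<close> steps. A stage thus multiplies the number of intervals by \<open>kids = 2^(e-3)\<close> and stretches
\<open>\<theta>\<close> by at most \<open>stretch = 4 (B + 1) 2^e\<close>, where \<open>B\<close> bounds the partial quotients. Since
an interval of level \<open>k\<close> then has length at least \<open>ell / stretch^k\<close>, no distortion estimate is
needed, and the dimension is at least \<open>ln kids / ln stretch\<close>, which tends to \<open>1\<close> as
\<open>e\<close> grows. All constants lost in a stage are harmless for the same reason.

To pass from the tree to Hausdorff dimension, the unit interval is mapped to the limit points by
expanding in base \<open>kids\<close>; this map has a Hoelder continuous inverse
(\<open>interval_tree_holder\<close>), so a cheap cover of the limit set would yield a cover of \<open>[0, 1)\<close> of small
total length (\<open>hausdorff_dim_ge_if_holder_inverse\<close>).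

The bounded component is identified through the product \<open>x\<^sub>1 x\<^sub>2 x\<^sub>3\<close>. On the surface it equals
\<open>1\<close> only close to the punctures, so it separates the centre, where it is below \<open>1\<close>, from the
outside, where the signs of the coordinates separate four further pieces. Slices by coordinate
planes are conics, and moving along them shows that each of the five pieces is connected
(\<open>components_small_hole\<close>).\<close>

section \<open>Hausdorff dimension from an inverse Hoelder parametrisation\<close>

text \<open>The sets of parameters that correspond to the members of a cover have diameters at most
\<open>C\<close> times the \<open>s\<close>-th powers of the diameters of the members, and they cover an interval of length
\<open>1\<close>. For an exponent \<open>t < s\<close> and diameters at most \<open>1\<close> the sum of the \<open>t\<close>-th powers is therefore
bounded below, so the \<open>t\<close>-dimensional measure is positive.\<close>

lemma hausdorff_dim_ge_if_holder_inverse: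
  fixes X :: "real \<Rightarrow> 'a::metric_space"
  assumes s: "0 < s" and C: "0 < C"
    and sub: "\<And>y. y \<in> {0..<1} \<Longrightarrow> X y \<in> A"
    and hol: "\<And>y y'. y \<in> {0..<1} \<Longrightarrow> y' \<in> {0..<1} \<Longrightarrow> \<bar>y - y'\<bar> \<le> C * dist (X y) (X y') powr s"
  shows "ereal s \<le> hausdorff_dim A"
  unfolding hausdorff_dim_def
proof (rule INF_greatest, clarify)
  fix t :: real assume t: "0 < t" and m0: "hausdorff_measure t A = 0"
  show "ereal s \<le> ereal t"
  proof (rule ccontr)
    assume "\<not> ereal s \<le> ereal t"
    hence ts: "t < s" by simp
    have "hausdorff_content 1 t A \<le> hausdorff_measure t A"
      unfolding hausdorff_measure_def by (rule SUP_upper) simp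
    hence "hausdorff_content 1 t A < ennreal (1 / (2 * C))"
      using m0 C by simp
    then obtain U :: "nat \<Rightarrow> 'a set" where cov: "A \<subseteq> (\<Union>i. U i)"
      and bd: "\<And>i. bounded (U i)" and d1: "\<And>i. diameter (U i) \<le> 1"
      and sm: "(\<Sum>i. ennreal (diameter (U i) powr t)) < ennreal (1 / (2 * C))"
      unfolding hausdorff_content_def INF_less_iff by blast
    define r where "r i = C * diameter (U i) powr s" for i
    have r0: "0 \<le> r i" for i using C by (simp add: r_def)
    define Y where "Y i = {y \<in> {0..<1}. X y \<in> U i}" for i
    have "\<exists>c. Y i \<subseteq> {c - r i .. c + r i}" for i
    proof (cases "Y i = {}")
      case False
      then obtain c where c: "c \<in> Y i" by auto
      have "Y i \<subseteq> {c - r i .. c + r i}"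
      proof
        fix y assume y: "y \<in> Y i"
        have "dist (X y) (X c) \<le> diameter (U i)"
          using y c bd by (intro diameter_bounded_bound) (auto simp: Y_def)
        hence "dist (X y) (X c) powr s \<le> diameter (U i) powr s"
          using s by (intro powr_mono2) auto
        hence "\<bar>y - c\<bar> \<le> r i"
          using hol[of y c] y c C unfolding r_def Y_def
          by (smt (verit, best) mem_Collect_eq mult_left_mono)
        thus "y \<in> {c - r i .. c + r i}" by auto
      qed
      thus ?thesis by blast
    qed auto
    then obtain c where c: "\<And>i. Y i \<subseteq> {c i - r i .. c i + r i}" by metis
    have "{0..<1} \<subseteq> (\<Union>i. {c i - r i .. c i + r i})"
    proof
      fix y :: real assume y: "y \<in> {0..<1}"
      then obtain i where "X y \<in> U i" using sub cov by blast
      thus "y \<in> (\<Union>i. {c i - r i .. c i + r i})" using y c[of i] unfolding Y_def by blast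
    qed
    hence "emeasure lborel {0..<1::real} \<le> emeasure lborel (\<Union>i. {c i - r i .. c i + r i})"
      by (intro emeasure_mono) auto
    also have "\<dots> \<le> (\<Sum>i. emeasure lborel {c i - r i .. c i + r i})"
      by (intro emeasure_subadditive_countably) auto
    also have "\<dots> \<le> (\<Sum>i. ennreal (2 * C) * ennreal (diameter (U i) powr t))"
    proof (intro suminf_le)
      fix i
      \<comment> \<open>Diameters at most \<open>1\<close> make the larger exponent the smaller power; diameter \<open>0\<close> is a separate case, as \<open>0 powr x = 0\<close>.\<close>
      have "diameter (U i) powr s \<le> diameter (U i) powr t"
        using ts t d1[of i] diameter_ge_0[OF bd[of i]]
        by (cases "diameter (U i) = 0") (auto intro!: powr_mono')
      hence "2 * r i \<le> 2 * C * diameter (U i) powr t" using C by (simp add: r_def)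
      thus "emeasure lborel {c i - r i .. c i + r i} \<le> ennreal (2 * C) * ennreal (diameter (U i) powr t)"
        using r0[of i] C by (simp add: ennreal_mult[symmetric] ennreal_leI)
    qed auto
    also have "\<dots> = ennreal (2 * C) * (\<Sum>i. ennreal (diameter (U i) powr t))" by simp
    also have "\<dots> < ennreal (2 * C) * ennreal (1 / (2 * C))"
      using sm C by (intro ennreal_mult_strict_left_mono) auto
    also have "\<dots> = 1" using C by (simp add: ennreal_mult[symmetric] flip: ennreal_1)
    finally show False by simp
  qed
qed

section \<open>Trees of intervals\<close>

text \<open>Dropping the last digit of an expansion in base \<open>m\<close>; it makes the nodes that are
assigned to a parameter on successive levels descend from one another.\<close>

lemma floor_power_Suc_div:
  fixes y :: real and m k :: nat
  assumes "0 \<le> y" "m > 0"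
  shows "nat \<lfloor>y * real m ^ Suc k\<rfloor> div m = nat \<lfloor>y * real m ^ k\<rfloor>"
proof -
  have "\<lfloor>(y * real m ^ Suc k) / real_of_int (int m)\<rfloor> = \<lfloor>y * real m ^ Suc k\<rfloor> div int m"
    by (rule floor_divide_real_eq_div) simp
  moreover have "(y * real m ^ Suc k) / real_of_int (int m) = y * real m ^ k"
    using assms by simp
  ultimately have "\<lfloor>y * real m ^ k\<rfloor> = \<lfloor>y * real m ^ Suc k\<rfloor> div int m" by simp
  thus ?thesis using assms by (simp add: nat_div_distrib)
qed

text \<open>The limit point \<open>X y\<close> follows the base-\<open>m\<close> digits of \<open>y\<close> down the tree. Two parameters
at distance more than \<open>2 / m^k\<close> have a complete interval of level \<open>k\<close> between their nodes, so their
limit points are at least \<open>c / K^k\<close> apart; comparing the two scales gives the Hoelder exponent.\<close>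

lemma interval_tree_holder:
  fixes P :: "nat \<Rightarrow> real \<Rightarrow> real \<Rightarrow> bool" and m :: nat and K c s :: real
  assumes m: "2 \<le> m" and K: "1 \<le> K" and c: "0 < c" and s: "0 < s" and Ks: "K powr s \<le> real m"
    and root: "P 0 u0 v0"
    and len: "\<And>k u v. P k u v \<Longrightarrow> c / K ^ k \<le> v - u"
    and children: "\<And>k u v. P k u v \<Longrightarrow> \<exists>f g. (\<forall>i<m. P (Suc k) (f i) (g i) \<and> u \<le> f i \<and> g i \<le> v)
          \<and> (\<forall>i j. i < j \<longrightarrow> j < m \<longrightarrow> g i \<le> f j)"
  shows "\<exists>X C. 0 < C \<and> (\<forall>y\<in>{0..<1}. \<forall>k. \<exists>u v. P k u v \<and> X y \<in> {u..v}) \<and> (\<forall>y\<in>{0..<1}. X y \<in> {u0..v0}) \<and>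
     (\<forall>y\<in>{0..<1}. \<forall>y'\<in>{0..<1}. \<bar>y - y'\<bar> \<le> C * \<bar>X y - X y'\<bar> powr s)"
proof -
  have "\<exists>F. \<forall>k u v. P k u v \<longrightarrow> (\<forall>i<m. P (Suc k) (fst (F k (u, v) i)) (snd (F k (u, v) i))
            \<and> u \<le> fst (F k (u, v) i) \<and> snd (F k (u, v) i) \<le> v)
          \<and> (\<forall>i j. i < j \<longrightarrow> j < m \<longrightarrow> snd (F k (u, v) i) \<le> fst (F k (u, v) j))"
  proof -
    have "\<exists>h. P k u v \<longrightarrow> (\<forall>i<m. P (Suc k) (fst (h i)) (snd (h i))
            \<and> u \<le> fst (h i) \<and> snd (h i) \<le> v)
          \<and> (\<forall>i j. i < j \<longrightarrow> j < m \<longrightarrow> snd (h i) \<le> (fst (h j) :: real))" for k u v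
    proof (cases "P k u v")
      case True
      from children[OF this] obtain f g where
        "(\<forall>i<m. P (Suc k) (f i) (g i) \<and> u \<le> f i \<and> g i \<le> v) \<and> (\<forall>i j. i < j \<longrightarrow> j < m \<longrightarrow> g i \<le> f j)"
        by blast
      thus ?thesis by (intro exI[of _ "\<lambda>i. (f i, g i)"]) simp
    qed simp
    then obtain h where h: "\<And>k u v. P k u v \<longrightarrow> (\<forall>i<m. P (Suc k) (fst (h k u v i)) (snd (h k u v i))
            \<and> u \<le> fst (h k u v i) \<and> snd (h k u v i) \<le> v)
          \<and> (\<forall>i j. i < j \<longrightarrow> j < m \<longrightarrow> snd (h k u v i) \<le> (fst (h k u v j) :: real))" by metis
    show ?thesis by (rule exI[of _ "\<lambda>k p. h k (fst p) (snd p)"]) (use h in simp)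
  qed
  then obtain F where F0: "\<And>k u v. P k u v \<longrightarrow> (\<forall>i<m. P (Suc k) (fst (F k (u, v) i)) (snd (F k (u, v) i))
            \<and> u \<le> fst (F k (u, v) i) \<and> snd (F k (u, v) i) \<le> v)
          \<and> (\<forall>i j. i < j \<longrightarrow> j < m \<longrightarrow> snd (F k (u, v) i) \<le> fst (F k (u, v) j))"
    by blast
  have F: "P (Suc k) (fst (F k p i)) (snd (F k p i)) \<and> fst p \<le> fst (F k p i) \<and> snd (F k p i) \<le> snd p"
    if "P k (fst p) (snd p)" "i < m" for k p i
    using F0[of k "fst p" "snd p"] that by simp
  have Ford: "snd (F k p i) \<le> fst (F k p j)" if "P k (fst p) (snd p)" "i < j" "j < m" for k p i j
    using F0[of k "fst p" "snd p"] that by simp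
  define J where "J = rec_nat (\<lambda>i::nat. (u0, v0)) (\<lambda>k Jk i. F k (Jk (i div m)) (i mod m))"
  have J0: "J 0 i = (u0, v0)" for i by (simp add: J_def)
  have JS: "J (Suc k) i = F k (J k (i div m)) (i mod m)" for k i by (simp add: J_def)
  have mpos: "0 < m" using m by simp
  have JP: "P k (fst (J k i)) (snd (J k i))" for k i
    by (induction k arbitrary: i) (use F mpos root in \<open>auto simp: J0 JS\<close>)
  have Jsub: "fst (J k (i div m)) \<le> fst (J (Suc k) i)" "snd (J (Suc k) i) \<le> snd (J k (i div m))" for k i
    using F[OF JP, of "i mod m" k "i div m"] mpos by (auto simp: JS)
  have Jord: "snd (J k i) \<le> fst (J k j)" if "i < j" "j < m ^ k" for k i j
    using that
  proof (induction k arbitrary: i j)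
    case (Suc k)
    have jm: "j div m < m ^ k" using Suc.prems by (simp add: less_mult_imp_div_less mult.commute)
    show ?case
    proof (cases "i div m = j div m")
      case True
      hence "i mod m < j mod m" using Suc.prems(1)
        by (metis div_mult_mod_eq nat_add_left_cancel_less)
      thus ?thesis using Ford[OF JP, of "i mod m" "j mod m" k "j div m"] True mpos by (auto simp: JS)
    next
      case False
      hence "i div m < j div m" using Suc.prems(1) by (meson div_le_mono le_neq_implies_less less_imp_le_nat)
      from Suc.IH[OF this jm] show ?thesis using Jsub(2)[of k i] Jsub(1)[of k j] by linarith
    qed
  qed simp
  have Jlen: "c / K ^ k \<le> snd (J k i) - fst (J k i)" for k i using len[OF JP] .
  define idx where "idx k y = nat \<lfloor>y * real m ^ k\<rfloor>" for k :: nat and y :: real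
  have idx_div: "idx (Suc k) y div m = idx k y" if "0 \<le> y" for k y
    unfolding idx_def using floor_power_Suc_div[OF that mpos] .
  have idx_less: "idx k y < m ^ k" if "y \<in> {0..<1}" for k y
  proof -
    have "y * real m ^ k < real m ^ k" using that mpos by simp
    hence "\<lfloor>y * real m ^ k\<rfloor> < int (m ^ k)" by (simp add: floor_less_iff)
    thus ?thesis using mpos unfolding idx_def by (metis nat_less_iff not_less of_nat_0_less_iff nat_int zero_less_power zless_nat_conj)
  qed
  have step: "fst (J k (idx k y)) \<le> fst (J (Suc k) (idx (Suc k) y))"
    "snd (J (Suc k) (idx (Suc k) y)) \<le> snd (J k (idx k y))" if "0 \<le> y" for k y
    using Jsub[of k "idx (Suc k) y"] idx_div[OF that] by simp_all
  have low: "fst (J k (idx k y)) \<le> fst (J (k + n) (idx (k + n) y))" if "0 \<le> y" for k n y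
    by (induction n) (use step(1)[OF that] in \<open>auto intro: order_trans\<close>)
  have upp: "snd (J (k + n) (idx (k + n) y)) \<le> snd (J k (idx k y))" if "0 \<le> y" for k n y
    by (induction n) (use step(2)[OF that] in \<open>auto intro: order_trans\<close>)
  have lu: "fst (J j (idx j y)) \<le> snd (J k (idx k y))" if "0 \<le> y" for j k y
  proof -
    have "fst (J (j+k) (idx (j+k) y)) \<le> snd (J (j+k) (idx (j+k) y))"
    proof -
      have "0 < c / K ^ (j + k)" using c K by simp
      thus ?thesis using Jlen[of "j+k" "idx (j+k) y"] by linarith
    qed
    thus ?thesis using low[OF that, of j k] upp[OF that, of k j] by (simp add: add.commute)
  qed
  define X where "X y = (SUP k. fst (J k (idx k y)))" for y
  have bdd: "bdd_above (range (\<lambda>k. fst (J k (idx k y))))" if "0 \<le> y" for y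
    using lu[OF that] by (intro bdd_aboveI[of _ "snd (J 0 (idx 0 y))"]) auto
  have X: "fst (J k (idx k y)) \<le> X y" "X y \<le> snd (J k (idx k y))" if "0 \<le> y" for k y
    unfolding X_def using bdd[OF that] lu[OF that] by (auto intro!: cSUP_upper cSUP_least)
  define C where "C = 2 * real m * c powr (- s)"
  have Cpos: "0 < C" using c mpos by (simp add: C_def)
  have main: "y' - y \<le> C * \<bar>X y - X y'\<bar> powr s" if y: "y \<in> {0..<1}" and y': "y' \<in> {0..<1}" and yy: "y < y'" for y y'
  proof -
    obtain k0 where "2 / (y' - y) < real m ^ k0"
      using real_arch_pow[of "real m" "2 / (y' - y)"] m by auto
    hence k0: "2 / real m ^ k0 < y' - y" using yy mpos by (simp add: field_simps)
    \<comment> \<open>The first level on which a whole interval separates the two nodes; one level earlier the parameters are still close.\<close>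
    define k where "k = (LEAST k. 2 / real m ^ k < y' - y)"
    have k: "2 / real m ^ k < y' - y" unfolding k_def by (rule LeastI[where P = "\<lambda>k. 2 / real m ^ k < y' - y", OF k0])
    have "k \<noteq> 0"
    proof
      assume "k = 0"
      hence "2 < y' - y" using k by simp
      thus False using y y' by simp
    qed
    then obtain j where j: "k = Suc j" by (cases k) auto
    have "\<not> 2 / real m ^ j < y' - y"
      using not_less_Least[of j "\<lambda>k. 2 / real m ^ k < y' - y"] j k_def by simp
    hence up: "y' - y \<le> 2 * real m / real m ^ k" using mpos j by simp
    have mk: "0 < real m ^ k" using mpos by simp
    have "2 < (y' - y) * real m ^ k" using k mk by (simp add: field_simps)
    hence "real_of_int \<lfloor>y * real m ^ k\<rfloor> + 1 < real_of_int \<lfloor>y' * real m ^ k\<rfloor>"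
      by (simp add: left_diff_distrib) linarith
    moreover have "0 \<le> \<lfloor>y * real m ^ k\<rfloor>" using y by simp
    ultimately have id: "Suc (idx k y) < idx k y'" unfolding idx_def by linarith
    have "c / K ^ k \<le> snd (J k (Suc (idx k y))) - fst (J k (Suc (idx k y)))" by (rule Jlen)
    also have "\<dots> \<le> fst (J k (idx k y')) - snd (J k (idx k y))"
      using Jord[OF id idx_less[OF y']] Jord[of "idx k y" "Suc (idx k y)" k] id idx_less[OF y', of k]
      by linarith
    also have "\<dots> \<le> X y' - X y" using X(2)[of y k] X(1)[of y' k] y y' by simp
    finally have d: "c / K ^ k \<le> \<bar>X y - X y'\<bar>" by linarith
    have Kk: "0 < K ^ k" using K by simp
    have "(c / K ^ k) powr s \<le> \<bar>X y - X y'\<bar> powr s"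
      using d c Kk s by (intro powr_mono2) auto
    moreover have "(c / K ^ k) powr s = c powr s / (K powr s) ^ k"
      using c K by (simp add: powr_divide powr_power powr_powr powr_realpow[symmetric] mult.commute)
    moreover have "c powr s / real m ^ k \<le> c powr s / (K powr s) ^ k"
      using Ks K by (intro divide_left_mono power_mono) (auto simp: mpos)
    ultimately have "c powr s / real m ^ k \<le> \<bar>X y - X y'\<bar> powr s" by linarith
    hence "C * (c powr s / real m ^ k) \<le> C * \<bar>X y - X y'\<bar> powr s"
      using Cpos by (intro mult_left_mono) auto
    moreover have "C * (c powr s / real m ^ k) = 2 * real m / real m ^ k"
      using c by (simp add: C_def powr_minus)
    ultimately show ?thesis using up by linarith
  qed
  have hol: "\<bar>y - y'\<bar> \<le> C * \<bar>X y - X y'\<bar> powr s" if y: "y \<in> {0..<1}" and y': "y' \<in> {0..<1}" for y y'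
    using main[OF y y'] main[OF y' y] Cpos
    by (cases y y' rule: linorder_cases) (auto simp: abs_minus_commute)
  have root_in: "X y \<in> {u0..v0}" if "y \<in> {0..<1}" for y
    using X[of y 0] that by (simp add: J0)
  show ?thesis
    using Cpos hol root_in X JP by (intro exI[of _ X] exI[of _ C]) fastforce
qed

section \<open>The components of the punctured surface\<close>

definition punctured :: "real \<Rightarrow> real \<Rightarrow> (real^3) set" where
  "punctured l \<rho> = S_surf l - O_nbhd \<rho>"

abbreviation pt :: "real \<Rightarrow> real \<Rightarrow> real \<Rightarrow> real^3" where
  "pt x y z \<equiv> vector [x, y, z]"

lemma pt_collapse: "pt (v$1) (v$2) (v$3) = v"
  by (simp add: vec_eq_iff forall_3)

lemma continuous_on_pt [continuous_intros]:
  fixes f g h :: "'a::topological_space \<Rightarrow> real"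
  assumes "continuous_on S f" "continuous_on S g" "continuous_on S h"
  shows "continuous_on S (\<lambda>x. pt (f x) (g x) (h x))"
proof -
  have "(\<lambda>x. pt (f x) (g x) (h x)) = (\<lambda>x. \<chi> i. if i = 1 then f x else if i = 2 then g x else h x)"
    by (auto simp: vec_eq_iff forall_3)
  moreover have "continuous_on S (\<lambda>x. if i = 1 then f x else if i = 2 then g x else h x)" for i :: 3
    using assms by (cases "i = 1"; cases "i = 2") auto
  ultimately show ?thesis by (simp only: continuous_on_vec_lambda)
qed

lemma dist_pt: "dist (pt x y z) (pt x' y' z') = sqrt ((x - x')\<^sup>2 + (y - y')\<^sup>2 + (z - z')\<^sup>2)"
  by (simp add: dist_norm norm_vec_def L2_set_def sum_3)

lemma punctured_iff:
  assumes "0 < \<rho>"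
  shows "pt x y z \<in> punctured l \<rho> \<longleftrightarrow> x\<^sup>2 + y\<^sup>2 + z\<^sup>2 - 2 * x * y * z = 1 + l\<^sup>2 / 4 \<and>
    \<rho>\<^sup>2 \<le> (x - 1)\<^sup>2 + (y - 1)\<^sup>2 + (z - 1)\<^sup>2 \<and> \<rho>\<^sup>2 \<le> (x + 1)\<^sup>2 + (y + 1)\<^sup>2 + (z - 1)\<^sup>2 \<and>
    \<rho>\<^sup>2 \<le> (x - 1)\<^sup>2 + (y + 1)\<^sup>2 + (z + 1)\<^sup>2 \<and> \<rho>\<^sup>2 \<le> (x + 1)\<^sup>2 + (y - 1)\<^sup>2 + (z + 1)\<^sup>2"
proof -
  have sq: "\<not> sqrt q < \<rho> \<longleftrightarrow> \<rho>\<^sup>2 \<le> q" if "0 \<le> q" for q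
    using assms that by (metis linorder_not_less real_less_rsqrt real_sqrt_less_mono real_sqrt_unique less_eq_real_def not_le)
  have "pt x y z \<notin> O_nbhd \<rho> \<longleftrightarrow>
    \<rho>\<^sup>2 \<le> (1 - x)\<^sup>2 + (1 - y)\<^sup>2 + (1 - z)\<^sup>2 \<and> \<rho>\<^sup>2 \<le> (-1 - x)\<^sup>2 + (-1 - y)\<^sup>2 + (1 - z)\<^sup>2 \<and>
    \<rho>\<^sup>2 \<le> (1 - x)\<^sup>2 + (-1 - y)\<^sup>2 + (-1 - z)\<^sup>2 \<and> \<rho>\<^sup>2 \<le> (-1 - x)\<^sup>2 + (1 - y)\<^sup>2 + (-1 - z)\<^sup>2"
    unfolding O_nbhd_def by (simp add: dist_pt sq)
  thus ?thesis
    unfolding punctured_def S_surf_def by (auto simp: power2_eq_square algebra_simps)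
qed

lemma connected_component_symmetry:
  assumes "continuous_on UNIV g" "g ` R \<subseteq> R" "connected_component R x y"
  shows "connected_component R (g x) (g y)"
proof -
  obtain T where T: "connected T" "T \<subseteq> R" "x \<in> T" "y \<in> T"
    using assms(3) unfolding connected_component_def by blast
  have "connected (g ` T)" using T assms(1) by (meson connected_continuous_image continuous_on_subset subset_UNIV)
  thus ?thesis using T assms(2) unfolding connected_component_def by (intro exI[of _ "g ` T"]) auto
qed

text \<open>A connected subset of \<open>R\<close> cannot leave one of the disjoint open sets, so a piece that
is connected through \<open>R\<close> is a whole component.\<close>

lemma components_eq_open_pieces:
  fixes R :: "'a::topological_space set" and U :: "'i \<Rightarrow> 'a set"
  assumes op: "\<And>i. i \<in> I \<Longrightarrow> open (U i)" and dj: "disjoint_family_on U I"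
    and cov: "R \<subseteq> (\<Union>i\<in>I. U i)"
    and ne: "\<And>i. i \<in> I \<Longrightarrow> R \<inter> U i \<noteq> {}"
    and conn: "\<And>i x y. i \<in> I \<Longrightarrow> x \<in> R \<inter> U i \<Longrightarrow> y \<in> R \<inter> U i \<Longrightarrow> connected_component R x y"
  shows "components R = (\<lambda>i. R \<inter> U i) ` I" and "inj_on (\<lambda>i. R \<inter> U i) I"
proof -
  have eq: "connected_component_set R x = R \<inter> U i" if i: "i \<in> I" and x: "x \<in> R \<inter> U i" for x i
  proof
    show "R \<inter> U i \<subseteq> connected_component_set R x" using conn[OF i x] by auto
    have "connected (connected_component_set R x)" by simp
    moreover have "connected_component_set R x \<subseteq> U i \<union> (\<Union>j\<in>I - {i}. U j)"
      using cov connected_component_subset[of R x] by blast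
    moreover have "U i \<inter> (\<Union>j\<in>I - {i}. U j) \<inter> connected_component_set R x = {}"
      using dj i unfolding disjoint_family_on_def by blast
    moreover have "open (U i)" "open (\<Union>j\<in>I - {i}. U j)" using op i by auto
    ultimately have "U i \<inter> connected_component_set R x = {} \<or> (\<Union>j\<in>I - {i}. U j) \<inter> connected_component_set R x = {}"
      using connectedD by metis
    moreover have "x \<in> U i \<inter> connected_component_set R x" using x by auto
    ultimately have "(\<Union>j\<in>I - {i}. U j) \<inter> connected_component_set R x = {}" by blast
    thus "connected_component_set R x \<subseteq> R \<inter> U i"
      using cov connected_component_subset[of R x] by blast
  qed
  show "components R = (\<lambda>i. R \<inter> U i) ` I"
  proof
    show "components R \<subseteq> (\<lambda>i. R \<inter> U i) ` I"
    proof
      fix C assume "C \<in> components R"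
      then obtain x where x: "x \<in> R" "C = connected_component_set R x" by (auto simp: components_def)
      then obtain i where "i \<in> I" "x \<in> U i" using cov by auto
      thus "C \<in> (\<lambda>i. R \<inter> U i) ` I" using eq[of i x] x by auto
    qed
    show "(\<lambda>i. R \<inter> U i) ` I \<subseteq> components R"
    proof
      fix C assume "C \<in> (\<lambda>i. R \<inter> U i) ` I"
      then obtain i where i: "i \<in> I" "C = R \<inter> U i" by auto
      then obtain x where x: "x \<in> R \<inter> U i" using ne by blast
      show "C \<in> components R" using eq[OF i(1) x] x i unfolding components_def by auto
    qed
  qed
  show "inj_on (\<lambda>i. R \<inter> U i) I"
    using ne dj unfolding inj_on_def disjoint_family_on_def by blast
qed

text \<open>The inequality of arithmetic and geometric means. It controls the distance to a
puncture, because on the surface this distance is a function of the product and the sum of the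
absolute values of the coordinates.\<close>

lemma three_le_sum_if_one_le_prod:
  fixes x y z :: real
  assumes "0 < x" "0 < y" "0 < z" "1 \<le> x * y * z"
  shows "3 \<le> x + y + z"
proof (rule ccontr)
  assume "\<not> 3 \<le> x + y + z"
  hence s: "x + y + z < 3" by simp
  have "27 * (x * y * z) \<le> (x + y + z) ^ 3"
  proof -
    have "(x + y + z)^3 - 27 * (x*y*z) = (x + y + z) * ((x-y)^2 + (y-z)^2 + (z-x)^2) / 2
        + 3 * (x * (y - z)^2 + y * (z - x)^2 + z * (x - y)^2)"
      by (simp add: power2_eq_square power3_eq_cube field_simps)
    moreover have "0 \<le> \<dots>" using assms by (intro add_nonneg_nonneg divide_nonneg_nonneg mult_nonneg_nonneg) auto
    ultimately show ?thesis by linarith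
  qed
  moreover have "(x + y + z) ^ 3 < 3 ^ 3"
    using s assms by (intro power_strict_mono) auto
  ultimately show False using assms by simp
qed

definition flip12 :: "real^3 \<Rightarrow> real^3" where "flip12 v = pt (- v$1) (- v$2) (v$3)"
definition flip23 :: "real^3 \<Rightarrow> real^3" where "flip23 v = pt (v$1) (- v$2) (- v$3)"
definition swap12 :: "real^3 \<Rightarrow> real^3" where "swap12 v = pt (v$2) (v$1) (v$3)"
definition cyc :: "real^3 \<Rightarrow> real^3" where "cyc v = pt (v$2) (v$3) (v$1)"

text \<open>In the coordinates \<open>w = x\<^sub>1 + x\<^sub>2\<close> and \<open>v = x\<^sub>1 - x\<^sub>2\<close> the slice of the surface at height \<open>z\<close> is a
conic in principal axes, an ellipse for \<open>\<bar>z\<bar> < 1\<close> and a hyperbola for \<open>\<bar>z\<bar> > 1\<close>.\<close>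

lemma slice_identity:
  fixes w v z :: real
  shows "((w + v) / 2)\<^sup>2 + ((w - v) / 2)\<^sup>2 + z\<^sup>2 - 2 * ((w + v) / 2) * ((w - v) / 2) * z
     = ((1 - z) * w\<^sup>2 + (1 + z) * v\<^sup>2) / 2 + z\<^sup>2"
  by (simp add: power2_eq_square field_simps)

text \<open>The change of the squared distance to the puncture \<open>(1, 1, 1)\<close> along a slice. Its sign tells in
which direction a point can be moved within the slice without entering the hole.\<close>

lemma slice_distance:
  fixes w v w0 v0 z :: real
  assumes "(1 - z) * w\<^sup>2 + (1 + z) * v\<^sup>2 = (1 - z) * w0\<^sup>2 + (1 + z) * v0\<^sup>2" "0 < 1 + z"
  shows "((w + v) / 2 - 1)\<^sup>2 + ((w - v) / 2 - 1)\<^sup>2 - (((w0 + v0) / 2 - 1)\<^sup>2 + ((w0 - v0) / 2 - 1)\<^sup>2)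
     = (w - w0) * (z * (w + w0) / (1 + z) - 2)"
proof -
  have "v\<^sup>2 - v0\<^sup>2 = (1 - z) * (w0\<^sup>2 - w\<^sup>2) / (1 + z)"
    using assms by (simp add: field_simps)
  moreover have "((w + v) / 2 - 1)\<^sup>2 + ((w - v) / 2 - 1)\<^sup>2 - (((w0 + v0) / 2 - 1)\<^sup>2 + ((w0 - v0) / 2 - 1)\<^sup>2)
     = (w\<^sup>2 - w0\<^sup>2) / 2 + (v\<^sup>2 - v0\<^sup>2) / 2 - 2 * (w - w0)"
    by (simp add: power2_eq_square field_simps)
  moreover have "(w\<^sup>2 - w0\<^sup>2) / 2 + (1 - z) * (w0\<^sup>2 - w\<^sup>2) / (1 + z) / 2 - 2 * (w - w0) = (w - w0) * (z * (w + w0) / (1 + z) - 2)"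
    using assms(2) by (simp add: power2_eq_square field_simps)
  ultimately show ?thesis by simp
qed

lemma third_positive:
  fixes x y z :: real
  assumes "1 < x * y * z" "0 < x" "0 < y"
  shows "0 < z"
proof -
  have "0 < x * y * z" "0 < x * y" using assms by auto
  thus ?thesis by (simp add: zero_less_mult_iff)
qed

text \<open>The radius of the holes is fixed, and the coupling is so small that the necks of the surface
at the punctures, whose width is comparable to \<open>l\<close>, disappear inside the holes.\<close>

locale small_hole =
  fixes l \<rho> :: real
  assumes \<rho>: "0 < \<rho>" "\<rho> < 1" and l_small: "l\<^sup>2 / 4 \<le> (\<rho>\<^sup>2 / 28)\<^sup>2"
begin

definition "h = l\<^sup>2 / 4"
definition "r = \<rho>\<^sup>2 / 28"

lemma h_le_r_square: "h \<le> r\<^sup>2" using l_small by (simp add: h_def r_def)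

text \<open>Outside the holes some coordinate has absolute value at distance at least \<open>r\<close> from \<open>1\<close>, a fact
shown separately for the centre and the outside; \<open>h\<close> is the excess of the level of the surface over the level
\<open>1\<close>. The margin \<open>r\<close> is quadratic in \<open>\<rho>\<close> because on the surface the squared distance to a puncture is
bounded by a multiple of the deviation of the coordinates, up to the small term \<open>h\<close>.\<close>

lemma hole_bounds: "0 \<le> h" "0 < r" "r < 1/28" "h \<le> r" "h < 1" "\<rho>\<^sup>2 = 28 * r" "\<rho>\<^sup>2 < 1"
proof -
  show "0 \<le> h" "0 < r" using \<rho> by (auto simp: h_def r_def)
  show *: "\<rho>\<^sup>2 < 1" using \<rho> by (simp add: power_less_one_iff abs_square_less_1)
  show r1: "r < 1/28" using * by (simp add: r_def)
  show "\<rho>\<^sup>2 = 28 * r" by (simp add: r_def)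
  have "r\<^sup>2 \<le> r" using \<open>0 < r\<close> r1 by (simp add: power2_eq_square mult_left_le_one_le)
  thus "h \<le> r" using h_le_r_square by simp
  thus "h < 1" using r1 by simp
qed

lemmas mem_punctured = punctured_iff[OF \<rho>(1), of _ _ _ l, folded h_def]

abbreviation "R \<equiv> punctured l \<rho>"

lemma mem_R: "v \<in> R \<longleftrightarrow> pt (v$1) (v$2) (v$3) \<in> R"
  by (simp only: pt_collapse)

text \<open>Permutations of the coordinates and changes of an even number of signs preserve the invariant
and permute the punctures. They reduce each connectedness argument to one octant and one order of the
coordinates.\<close>

lemma symmetries_R:
  "v \<in> R \<Longrightarrow> flip12 v \<in> R" "v \<in> R \<Longrightarrow> flip23 v \<in> R" "v \<in> R \<Longrightarrow> swap12 v \<in> R" "v \<in> R \<Longrightarrow> cyc v \<in> R"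
  unfolding flip12_def flip23_def swap12_def cyc_def mem_R[of v] mem_punctured
  by (auto simp: power2_eq_square algebra_simps)

lemma symmetries_comp [simp]:
  "flip12 v $ 1 = - v$1" "flip12 v $ 2 = - v$2" "flip12 v $ 3 = v$3"
  "flip23 v $ 1 = v$1" "flip23 v $ 2 = - v$2" "flip23 v $ 3 = - v$3"
  "swap12 v $ 1 = v$2" "swap12 v $ 2 = v$1" "swap12 v $ 3 = v$3"
  "cyc v $ 1 = v$2" "cyc v $ 2 = v$3" "cyc v $ 3 = v$1"
  by (simp_all add: flip12_def flip23_def swap12_def cyc_def)

lemma symmetries_inv [simp]:
  "flip12 (flip12 v) = v" "flip23 (flip23 v) = v" "swap12 (swap12 v) = v" "cyc (cyc (cyc v)) = v"
  by (simp_all add: vec_eq_iff forall_3)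

lemma symmetries_continuous:
  "continuous_on UNIV flip12" "continuous_on UNIV flip23" "continuous_on UNIV swap12" "continuous_on UNIV cyc"
  unfolding flip12_def[abs_def] flip23_def[abs_def] swap12_def[abs_def] cyc_def[abs_def]
  by (intro continuous_intros continuous_on_component)+

lemma symmetries_conn:
  assumes "connected_component R v w"
  shows "connected_component R (flip12 v) (flip12 w)" "connected_component R (flip23 v) (flip23 w)"
    "connected_component R (swap12 v) (swap12 w)" "connected_component R (cyc v) (cyc w)"
proof -
  have "flip12 ` R \<subseteq> R" "flip23 ` R \<subseteq> R" "swap12 ` R \<subseteq> R" "cyc ` R \<subseteq> R"
    using symmetries_R by blast+
  thus "connected_component R (flip12 v) (flip12 w)" "connected_component R (flip23 v) (flip23 w)"
    "connected_component R (swap12 v) (swap12 w)" "connected_component R (cyc v) (cyc w)"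
    using connected_component_symmetry[OF _ _ assms] symmetries_continuous by blast+
qed

definition circle3 :: "(real^3) set" where "circle3 = {v. v$3 = 0 \<and> (v$1)\<^sup>2 + (v$2)\<^sup>2 = 1 + h}"

lemma circle3_subset: "circle3 \<subseteq> R"
proof
  fix v assume v: "v \<in> circle3"
  have "1 \<le> a\<^sup>2 + b\<^sup>2 + (1::real)" for a b by simp
  with v hole_bounds(7) show "v \<in> R" unfolding mem_R[of v] mem_punctured
    by (simp add: circle3_def) (smt (verit, best) zero_le_power2)
qed

lemma circle3_connected: "connected circle3"
proof -
  have "circle3 = (\<lambda>t. pt (sqrt (1 + h) * cos t) (sqrt (1 + h) * sin t) 0) ` UNIV"
  proof (intro equalityI subsetI)
    fix v assume "v \<in> circle3"
    hence v: "v$3 = 0" "(v$1)\<^sup>2 + (v$2)\<^sup>2 = 1 + h" by (auto simp: circle3_def)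
    have s: "sqrt (1 + h) > 0" "(sqrt (1 + h))\<^sup>2 = 1 + h" using hole_bounds(1) by auto
    have "(v$1 / sqrt (1 + h))\<^sup>2 + (v$2 / sqrt (1 + h))\<^sup>2 = 1"
      using v(2) s hole_bounds(1) by (simp add: power_divide add_divide_distrib[symmetric])
    then obtain t where "v$1 / sqrt (1 + h) = cos t" "v$2 / sqrt (1 + h) = sin t"
      using sincos_total_2pi by metis
    hence "v = pt (sqrt (1 + h) * cos t) (sqrt (1 + h) * sin t) 0"
      using v(1) s(1) by (simp add: vec_eq_iff forall_3 field_simps)
    thus "v \<in> range (\<lambda>t. pt (sqrt (1 + h) * cos t) (sqrt (1 + h) * sin t) 0)" by blast
  next
    fix v assume "v \<in> range (\<lambda>t. pt (sqrt (1 + h) * cos t) (sqrt (1 + h) * sin t) 0)"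
    thus "v \<in> circle3" using hole_bounds(1)
      by (auto simp: circle3_def power_mult_distrib simp flip: distrib_left)
  qed
  thus ?thesis
    by (auto intro!: connected_continuous_image continuous_intros)
qed

definition to_circle :: "real^3 \<Rightarrow> bool" where
  "to_circle v \<longleftrightarrow> (\<exists>w\<in>circle3. connected_component R v w)"

lemma to_circle_symmetry:
  "to_circle (flip12 v) \<Longrightarrow> to_circle v" "to_circle (flip23 v) \<Longrightarrow> to_circle v" "to_circle (swap12 v) \<Longrightarrow> to_circle v"
proof -
  have *: "flip12 w \<in> circle3" "flip23 w \<in> circle3" "swap12 w \<in> circle3" if "w \<in> circle3" for w
    using that by (auto simp: circle3_def)
  show "to_circle (flip12 v) \<Longrightarrow> to_circle v" "to_circle (flip23 v) \<Longrightarrow> to_circle v" "to_circle (swap12 v) \<Longrightarrow> to_circle v"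
    unfolding to_circle_def using * symmetries_conn symmetries_inv by metis+
qed

text \<open>The three punctures other than \<open>(1, 1, 1)\<close> are out of reach in this region, so only one distance
has to be watched.\<close>

lemma far_if_sum_nonneg:
  fixes x y z :: real
  assumes "0 \<le> x + y" "0 \<le> z"
  shows "\<rho>\<^sup>2 \<le> (x + 1)\<^sup>2 + (y + 1)\<^sup>2 + (z - 1)\<^sup>2" "\<rho>\<^sup>2 \<le> (x - 1)\<^sup>2 + (y + 1)\<^sup>2 + (z + 1)\<^sup>2"
    "\<rho>\<^sup>2 \<le> (x + 1)\<^sup>2 + (y - 1)\<^sup>2 + (z + 1)\<^sup>2"
proof -
  have "(x + 1)\<^sup>2 + (y + 1)\<^sup>2 = ((x + y + 2)\<^sup>2 + (x - y)\<^sup>2) / 2" by (simp add: power2_eq_square field_simps)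
  moreover have "4 \<le> (x + y + 2)\<^sup>2" using power_mono[of 2 "x + y + 2" 2] assms by simp
  ultimately have "1 \<le> (x + 1)\<^sup>2 + (y + 1)\<^sup>2" using zero_le_power2[of "x - y"] by argo
  thus "\<rho>\<^sup>2 \<le> (x + 1)\<^sup>2 + (y + 1)\<^sup>2 + (z - 1)\<^sup>2" using hole_bounds(7) zero_le_power2[of "z - 1"] by linarith
  have "1\<^sup>2 \<le> (z + 1)\<^sup>2" using assms by (intro power_mono) auto
  thus "\<rho>\<^sup>2 \<le> (x - 1)\<^sup>2 + (y + 1)\<^sup>2 + (z + 1)\<^sup>2" "\<rho>\<^sup>2 \<le> (x + 1)\<^sup>2 + (y - 1)\<^sup>2 + (z + 1)\<^sup>2"
    using hole_bounds(7) zero_le_power2[of "x - 1"] zero_le_power2[of "x + 1"] zero_le_power2[of "y - 1"] zero_le_power2[of "y + 1"]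
    unfolding one_power2 by linarith+
qed

text \<open>On an ellipse at height \<open>0 \<le> z \<le> 1 - r\<close> all points satisfy \<open>w \<le> 2\<close>, and there decreasing \<open>w\<close> to
\<open>0\<close> moves away from the puncture \<open>(1, 1, 1)\<close>. The end points with \<open>w = 0\<close> form a curve that leads
down to the circle at height \<open>0\<close> far from all punctures.\<close>

lemma to_circle_basic:
  assumes v: "pt x y z \<in> R" and z: "0 \<le> z" "z \<le> 1 - r" and xy: "0 \<le> x + y" "y \<le> x"
  shows "to_circle (pt x y z)"
proof -
  define w0 where "w0 = x + y"
  define v0 where "v0 = x - y"
  have wv: "x = (w0 + v0) / 2" "y = (w0 - v0) / 2" by (auto simp: w0_def v0_def)
  have w00: "0 \<le> w0" "0 \<le> v0" using xy by (auto simp: w0_def v0_def)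
  note R0 = v[unfolded mem_punctured]
  have e0: "(1 - z) * w0\<^sup>2 + (1 + z) * v0\<^sup>2 = 2 * (1 - z\<^sup>2 + h)"
  proof -
    have "x\<^sup>2 + y\<^sup>2 + z\<^sup>2 - 2 * x * y * z = ((1 - z) * w0\<^sup>2 + (1 + z) * v0\<^sup>2) / 2 + z\<^sup>2"
      using slice_identity[of w0 v0 z] unfolding wv[symmetric] .
    thus ?thesis using R0 by argo
  qed
  have z1: "z < 1" using z hole_bounds(2) by simp
  have w0_le: "w0 \<le> 2"
  proof -
    have "r\<^sup>2 \<le> (1 - z)\<^sup>2" using z hole_bounds(2) by (intro power_mono) auto
    hence h1: "h \<le> (1 - z)\<^sup>2" using h_le_r_square by simp
    have "(1 - z) * w0\<^sup>2 \<le> 2 * (1 - z\<^sup>2 + h)" using e0 z by (smt (verit) mult_nonneg_nonneg zero_le_power2)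
    also have "\<dots> \<le> (1 - z) * 2\<^sup>2" using h1 by (simp add: power2_eq_square algebra_simps)
    finally have "w0\<^sup>2 \<le> 2\<^sup>2" using z1 mult_le_cancel_left_pos[of "1 - z" "w0\<^sup>2" "2\<^sup>2"] by linarith
    thus ?thesis by (rule power2_le_imp_le) simp
  qed
  define q where "q w = sqrt ((2 * (1 - z\<^sup>2 + h) - (1 - z) * w\<^sup>2) / (1 + z))" for w
  define \<gamma> where "\<gamma> w = pt ((w + q w) / 2) ((w - q w) / 2) z" for w
  have q: "(1 - z) * w\<^sup>2 + (1 + z) * (q w)\<^sup>2 = 2 * (1 - z\<^sup>2 + h)" if "w \<in> {0..w0}" for w
  proof -
    have "w\<^sup>2 \<le> w0\<^sup>2" using that by (intro power_mono) auto
    hence "(1 - z) * w\<^sup>2 \<le> (1 - z) * w0\<^sup>2" using z1 by (intro mult_left_mono) auto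
    moreover have "0 \<le> (1 + z) * v0\<^sup>2" using z by simp
    ultimately have "0 \<le> 2 * (1 - z\<^sup>2 + h) - (1 - z) * w\<^sup>2" using e0 by linarith
    thus ?thesis using z by (simp add: q_def)
  qed
  have \<gamma>R: "\<gamma> w \<in> R" if w: "w \<in> {0..w0}" for w
  proof -
    have "((w + q w) / 2 - 1)\<^sup>2 + ((w - q w) / 2 - 1)\<^sup>2 - ((x - 1)\<^sup>2 + (y - 1)\<^sup>2)
      = (w - w0) * (z * (w + w0) / (1 + z) - 2)"
      unfolding wv by (rule slice_distance) (use q[OF w] e0 z in auto)
    moreover have "0 \<le> (w - w0) * (z * (w + w0) / (1 + z) - 2)"
    proof (rule mult_nonpos_nonpos)
      have "z * (w + w0) \<le> z * 4" using w w0_le z by (intro mult_left_mono) auto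
      also have "\<dots> \<le> 2 * (1 + z)" using z1 by simp
      finally show "z * (w + w0) / (1 + z) - 2 \<le> 0" using z by (simp add: field_simps)
    qed (use w in auto)
    ultimately have "\<rho>\<^sup>2 \<le> ((w + q w) / 2 - 1)\<^sup>2 + ((w - q w) / 2 - 1)\<^sup>2 + (z - 1)\<^sup>2"
      using R0 by linarith
    moreover have "0 \<le> (w + q w) / 2 + (w - q w) / 2" using w by (simp add: field_simps)
    ultimately show ?thesis
      unfolding \<gamma>_def mem_punctured slice_identity q[OF w]
      using far_if_sum_nonneg[of "(w + q w) / 2" "(w - q w) / 2" z] z(1) by (simp add: field_simps)
  qed
  have "connected (\<gamma> ` {0..w0})" unfolding \<gamma>_def q_def
    using z by (intro connected_continuous_image continuous_intros) auto
  moreover have "\<gamma> w0 = pt x y z"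
  proof -
    have "(1 + z) * (q w0)\<^sup>2 = (1 + z) * v0\<^sup>2" 
    proof -
      have "w0 \<in> {0..w0}" using w00 by simp
      from q[OF this] e0 show ?thesis by linarith
    qed
    hence "(q w0)\<^sup>2 = v0\<^sup>2" using z by simp
    moreover have "0 \<le> q w0" using q_def z(1) e0 w00
      by (smt (verit) divide_nonneg_pos mult_nonneg_nonneg real_sqrt_ge_zero zero_le_power2)
    ultimately have "q w0 = v0" using w00 by (simp add: power2_eq_iff_nonneg)
    thus ?thesis by (simp add: \<gamma>_def wv)
  qed
  moreover have "\<gamma> w0 \<in> \<gamma> ` {0..w0}" "\<gamma> 0 \<in> \<gamma> ` {0..w0}" using w00 by auto
  ultimately have c1: "connected_component R (pt x y z) (\<gamma> 0)"
    unfolding connected_component_def using \<gamma>R by (intro exI[of _ "\<gamma> ` {0..w0}"]) auto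
  define p where "p c = sqrt (2 * (1 - c\<^sup>2 + h) / (1 + c)) / 2" for c
  define \<beta> where "\<beta> c = pt (p c) (- p c) c" for c
  have p: "4 * (1 + c) * (p c)\<^sup>2 = 2 * (1 - c\<^sup>2 + h)" if "c \<in> {0..z}" for c
  proof -
    have "c\<^sup>2 \<le> 1\<^sup>2" using that z1 by (intro power_mono) auto
    hence "0 \<le> 2 * (1 - c\<^sup>2 + h)" using hole_bounds(1) by simp
    hence "(p c)\<^sup>2 = 2 * (1 - c\<^sup>2 + h) / (1 + c) / 4" using that by (simp add: p_def power_divide)
    thus ?thesis using that by (simp add: field_simps)
  qed
  have \<beta>R: "\<beta> c \<in> R" if c: "c \<in> {0..z}" for c
  proof -
    have "(p c)\<^sup>2 + (- p c)\<^sup>2 + c\<^sup>2 - 2 * (p c) * (- p c) * c = 1 + h"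
      using p[OF c] by (simp add: power2_eq_square algebra_simps)
    moreover have "\<rho>\<^sup>2 \<le> (p c - 1)\<^sup>2 + (- p c - 1)\<^sup>2 + (c - 1)\<^sup>2"
    proof -
      have "(p c - 1)\<^sup>2 + (- p c - 1)\<^sup>2 = 2 * (p c)\<^sup>2 + 2" by (simp add: power2_eq_square algebra_simps)
      thus ?thesis using hole_bounds(7) by (smt (verit) zero_le_power2)
    qed
    ultimately show ?thesis
      unfolding \<beta>_def mem_punctured using far_if_sum_nonneg[of "p c" "- p c" c] c by simp
  qed
  have "connected (\<beta> ` {0..z})" unfolding \<beta>_def p_def
    using z by (intro connected_continuous_image continuous_intros) auto
  moreover have "\<beta> z = \<gamma> 0" by (simp add: \<beta>_def \<gamma>_def p_def q_def)
  moreover have "\<beta> z \<in> \<beta> ` {0..z}" "\<beta> 0 \<in> \<beta> ` {0..z}" using z by auto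
  ultimately have c2: "connected_component R (\<gamma> 0) (\<beta> 0)"
    unfolding connected_component_def using \<beta>R by (intro exI[of _ "\<beta> ` {0..z}"]) auto
  have "\<beta> 0 \<in> circle3"
    using p[of 0] z by (simp add: \<beta>_def circle3_def)
  thus ?thesis using connected_component_trans[OF c1 c2] unfolding to_circle_def by blast
qed

text \<open>By the symmetries it is enough to move points with \<open>x\<^sub>3 \<ge> 0\<close>, \<open>x\<^sub>1 + x\<^sub>2 \<ge> 0\<close> and \<open>x\<^sub>2 \<le> x\<^sub>1\<close>.\<close>

lemma to_circle:
  assumes v: "v \<in> R" and z: "\<bar>v$3\<bar> \<le> 1 - r"
  shows "to_circle v"
proof -
  have A: "to_circle v" if "v \<in> R" "0 \<le> v$3" "v$3 \<le> 1 - r" "0 \<le> v$1 + v$2" "v$2 \<le> v$1" for v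
    using to_circle_basic[of "v$1" "v$2" "v$3"] that mem_R by (simp add: pt_collapse)
  have B: "to_circle v" if v: "v \<in> R" "0 \<le> v$3" "v$3 \<le> 1 - r" "0 \<le> v$1 + v$2" for v
  proof (cases "v$2 \<le> v$1")
    case False
    have "to_circle (swap12 v)" by (rule A) (use v False symmetries_R(3) in auto)
    thus ?thesis by (rule to_circle_symmetry)
  qed (use A v in blast)
  have C: "to_circle v" if v: "v \<in> R" "0 \<le> v$3" "v$3 \<le> 1 - r" for v
  proof (cases "0 \<le> v$1 + v$2")
    case False
    have "to_circle (flip12 v)" by (rule B) (use v False symmetries_R(1) in auto)
    thus ?thesis by (rule to_circle_symmetry)
  qed (use B v in blast)
  show ?thesis
  proof (cases "0 \<le> v$3")
    case False
    have "to_circle (flip23 v)" by (rule C) (use v z False symmetries_R(2) in auto)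
    thus ?thesis by (rule to_circle_symmetry)
  qed (use C v z in simp)
qed

text \<open>If all coordinates were close to \<open>1\<close> in absolute value, a positive product below \<open>1\<close> would put
the point into the hole of the puncture with the same signs, and a product that is not positive would make the
invariant much larger than \<open>1\<close>.\<close>

lemma small_coordinate_if_centre:
  assumes v: "v \<in> R" and p: "v$1 * v$2 * v$3 < 1"
  shows "\<exists>k. \<bar>v$k\<bar> \<le> 1 - r"
proof (rule ccontr)
  assume "\<not> ?thesis"
  hence big: "1 - r < \<bar>v$k\<bar>" for k by (simp add: not_le)
  define x y z where "x = v$1" and "y = v$2" and "z = v$3"
  have b: "1 - r < \<bar>x\<bar>" "1 - r < \<bar>y\<bar>" "1 - r < \<bar>z\<bar>" using big by (auto simp: x_def y_def z_def)
  note R = v[unfolded mem_R[of v] mem_punctured, folded x_def y_def z_def]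
  note p = p[folded x_def y_def z_def]
  show False
  proof (cases "x * y * z > 0")
    case True
    have e: "(x - s)\<^sup>2 + (y - t)\<^sup>2 + (z - u)\<^sup>2 = 1 + h + 2 * (x*y*z) + s\<^sup>2 + t\<^sup>2 + u\<^sup>2 - 2 * (s * x + t * y + u * z)" for s t u
      using R by (simp add: power2_eq_square algebra_simps)
    have lt: "1 + h + 2 * (x*y*z) + 3 - 2 * (\<bar>x\<bar> + \<bar>y\<bar> + \<bar>z\<bar>) < \<rho>\<^sup>2"
    proof -
      \<comment> \<open>On the surface the squared distance to a puncture with the same signs depends on product and absolute sum only.\<close>
      have "3 - 3 * r < \<bar>x\<bar> + \<bar>y\<bar> + \<bar>z\<bar>" using b by linarith
      thus ?thesis using p hole_bounds(2,4,6) by argo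
    qed
    from True consider "x > 0" "y > 0" "z > 0" | "x < 0" "y < 0" "z > 0" | "x > 0" "y < 0" "z < 0" | "x < 0" "y > 0" "z < 0"
      by (auto simp: zero_less_mult_iff mult_less_0_iff)
    thus False
    proof cases
      case 1 thus False using e[of 1 1 1] R lt by simp
    next
      case 2 thus False using e[of "-1" "-1" 1] R lt by simp
    next
      case 3 thus False using e[of 1 "-1" "-1"] R lt by simp
    next
      case 4 thus False using e[of "-1" 1 "-1"] R lt by simp
    qed
  next
    case False
    have sq: "9/10 < a\<^sup>2" if "1 - r < \<bar>a\<bar>" for a
    proof -
      have "27/28 < \<bar>a\<bar>" using that hole_bounds(3) by simp
      hence "(27/28)\<^sup>2 < \<bar>a\<bar>\<^sup>2" by (intro power_strict_mono) auto
      thus ?thesis by (simp add: power2_eq_square)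
    qed
    show False using sq[OF b(1)] sq[OF b(2)] sq[OF b(3)] R False hole_bounds(5) by (simp add: mult.assoc)
  qed
qed

text \<open>Every central point reaches one of the three coordinate circles, and these meet in the points
where only one coordinate does not vanish.\<close>

lemma centre_connected:
  assumes v: "v \<in> R" "v$1 * v$2 * v$3 < 1" and w: "w \<in> R" "w$1 * w$2 * w$3 < 1"
  shows "connected_component R v w"
proof -
  define Z where "Z = circle3 \<union> cyc ` circle3 \<union> cyc ` cyc ` circle3"
  have cont: "connected (cyc ` A)" if "connected A" for A
    using connected_continuous_image[OF _ that] symmetries_continuous(4) continuous_on_subset by blast
  have mem: "pt (sqrt (1 + h)) 0 0 \<in> circle3" "pt 0 (sqrt (1 + h)) 0 \<in> circle3"
    using hole_bounds(1) by (auto simp: circle3_def)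
  have "pt (sqrt (1 + h)) 0 0 = cyc (pt 0 (sqrt (1 + h)) 0)" "pt 0 (sqrt (1 + h)) 0 = cyc (cyc (pt (sqrt (1 + h)) 0 0))"
    by (simp_all add: vec_eq_iff forall_3)
  hence mem': "pt (sqrt (1 + h)) 0 0 \<in> cyc ` circle3" "pt 0 (sqrt (1 + h)) 0 \<in> cyc ` cyc ` circle3"
    using mem by blast+
  have "circle3 \<inter> cyc ` circle3 \<noteq> {}" using mem(1) mem'(1) by blast
  hence U: "connected (circle3 \<union> cyc ` circle3)"
    by (rule connected_Un[OF circle3_connected cont[OF circle3_connected]])
  have "(circle3 \<union> cyc ` circle3) \<inter> cyc ` cyc ` circle3 \<noteq> {}" using mem(2) mem'(2) by blast
  hence Z: "connected Z" unfolding Z_def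
    by (rule connected_Un[OF U cont[OF cont[OF circle3_connected]]])
  have ZR: "Z \<subseteq> R" unfolding Z_def using circle3_subset symmetries_R(4) by blast
  have reach: "\<exists>z\<in>Z. connected_component R u z" if u: "u \<in> R" "u$1 * u$2 * u$3 < 1" for u
  proof -
    obtain k where "\<bar>u$k\<bar> \<le> 1 - r" using small_coordinate_if_centre[OF u] by blast
    moreover have "k = 1 \<or> k = 2 \<or> k = 3" by (rule exhaust_3)
    ultimately consider "\<bar>u$1\<bar> \<le> 1 - r" | "\<bar>u$2\<bar> \<le> 1 - r" | "\<bar>u$3\<bar> \<le> 1 - r" by auto
    thus ?thesis
    proof cases
      case 1
      hence "to_circle (cyc u)" using u symmetries_R(4) by (intro to_circle) auto
      then obtain w where w: "w \<in> circle3" "connected_component R (cyc u) w" unfolding to_circle_def by blast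
      have "connected_component R u (cyc (cyc w))"
        using symmetries_conn(4)[OF symmetries_conn(4)[OF w(2)]] by simp
      thus ?thesis using w(1) unfolding Z_def by blast
    next
      case 2
      hence "to_circle (cyc (cyc u))" using u symmetries_R(4) by (intro to_circle) auto
      then obtain w where w: "w \<in> circle3" "connected_component R (cyc (cyc u)) w" unfolding to_circle_def by blast
      have "connected_component R u (cyc w)"
        using symmetries_conn(4)[OF w(2)] by simp
      thus ?thesis using w(1) unfolding Z_def by blast
    next
      case 3
      hence "to_circle u" using u by (intro to_circle) auto
      thus ?thesis unfolding to_circle_def Z_def by blast
    qed
  qed
  obtain z1 z2 where z: "z1 \<in> Z" "connected_component R v z1" "z2 \<in> Z" "connected_component R w z2"
    using reach v w by meson
  have "connected_component R z1 z2" unfolding connected_component_def using Z ZR z by blast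
  thus ?thesis using z connected_component_trans connected_component_sym by metis
qed

definition slice :: "3 \<Rightarrow> real \<Rightarrow> (real^3) set" where
  "slice k c = {v \<in> S_surf l. 0 < v$1 \<and> 0 < v$2 \<and> 0 < v$3 \<and> v$k = c}"

lemma mem_slice:
  "pt x y z \<in> slice k c \<longleftrightarrow> x\<^sup>2 + y\<^sup>2 + z\<^sup>2 - 2 * x * y * z = 1 + h \<and> 0 < x \<and> 0 < y \<and> 0 < z \<and> pt x y z $ k = c"
  by (simp add: slice_def S_surf_def h_def)

lemma mem_surf: "pt x y z \<in> S_surf l \<longleftrightarrow> x\<^sup>2 + y\<^sup>2 + z\<^sup>2 - 2 * x * y * z = 1 + h"
  by (simp add: S_surf_def h_def)

lemma slice_subset:
  assumes c: "2 \<le> c"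
  shows "slice k c \<subseteq> R"
proof
  fix v assume "v \<in> slice k c"
  hence v: "(v$1)\<^sup>2 + (v$2)\<^sup>2 + (v$3)\<^sup>2 - 2 * v$1 * v$2 * v$3 = 1 + h" "0 < v$1" "0 < v$2" "0 < v$3" "v$k = c"
    by (auto simp: slice_def S_surf_def h_def)
  have "1\<^sup>2 \<le> (v$k - 1)\<^sup>2" using v c by (intro power_mono) auto
  hence "1 \<le> (v$1 - 1)\<^sup>2 + (v$2 - 1)\<^sup>2 + (v$3 - 1)\<^sup>2"
    using member_le_sum[of k UNIV "\<lambda>k. (v$k - 1)\<^sup>2"] by (simp add: sum_3)
  hence "\<rho>\<^sup>2 \<le> (v$1 - 1)\<^sup>2 + (v$2 - 1)\<^sup>2 + (v$3 - 1)\<^sup>2" using hole_bounds(7) by linarith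
  thus "v \<in> R" unfolding mem_R[of v] mem_punctured using v far_if_sum_nonneg[of "v$1" "v$2" "v$3"] by auto
qed

lemma slice3_connected:
  assumes c: "2 \<le> c"
  shows "connected (slice 3 c)"
proof -
  define w where "w v = sqrt ((2 * (c\<^sup>2 - 1 - h) + (1 + c) * v\<^sup>2) / (c - 1))" for v
  have "2\<^sup>2 \<le> c\<^sup>2" using c by (intro power_mono) auto
  hence c2: "4 \<le> c\<^sup>2" by simp
  have w: "(c - 1) * (w v)\<^sup>2 = 2 * (c\<^sup>2 - 1 - h) + (1 + c) * v\<^sup>2" "0 < w v" for v
  proof -
    have "0 \<le> (1 + c) * v\<^sup>2" using c by simp
    hence *: "0 < 2 * (c\<^sup>2 - 1 - h) + (1 + c) * v\<^sup>2" using c2 hole_bounds(5) by argo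
    thus "0 < w v" using c by (simp add: w_def)
    show "(c - 1) * (w v)\<^sup>2 = 2 * (c\<^sup>2 - 1 - h) + (1 + c) * v\<^sup>2" using * c by (simp add: w_def)
  qed
  have "slice 3 c = (\<lambda>v. pt ((w v + v) / 2) ((w v - v) / 2) c) ` UNIV"
  proof (intro equalityI subsetI)
    fix u assume "u \<in> slice 3 c"
    hence "pt (u$1) (u$2) (u$3) \<in> slice 3 c" by (simp add: pt_collapse)
    note u = this[unfolded mem_slice, simplified]
    define a b where "a = u$1 + u$2" and "b = u$1 - u$2"
    have ab: "u$1 = (a + b) / 2" "u$2 = (a - b) / 2" by (auto simp: a_def b_def)
    have "1 + h = ((1 - c) * a\<^sup>2 + (1 + c) * b\<^sup>2) / 2 + c\<^sup>2"
    proof -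
      have "(u$1)\<^sup>2 + (u$2)\<^sup>2 + c\<^sup>2 - 2 * u$1 * u$2 * c = ((1 - c) * a\<^sup>2 + (1 + c) * b\<^sup>2) / 2 + c\<^sup>2"
        using slice_identity[of a b c] unfolding ab[symmetric] .
      moreover have "(u$1)\<^sup>2 + (u$2)\<^sup>2 + c\<^sup>2 - 2 * u$1 * u$2 * c = 1 + h" using u by auto
      ultimately show ?thesis by linarith
    qed
    hence "(c - 1) * a\<^sup>2 = 2 * (c\<^sup>2 - 1 - h) + (1 + c) * b\<^sup>2" by (simp add: field_simps)
    hence "(c - 1) * a\<^sup>2 = (c - 1) * (w b)\<^sup>2" using w(1)[of b] by simp
    hence "a\<^sup>2 = (w b)\<^sup>2" using c by simp
    hence "a = w b" using w(2)[of b] u by (simp add: a_def power2_eq_iff_nonneg)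
    hence "u = pt ((w b + b) / 2) ((w b - b) / 2) c" using ab u by (simp add: vec_eq_iff forall_3)
    thus "u \<in> range (\<lambda>v. pt ((w v + v) / 2) ((w v - v) / 2) c)" by blast
  next
    fix u assume "u \<in> range (\<lambda>v. pt ((w v + v) / 2) ((w v - v) / 2) c)"
    then obtain v where u: "u = pt ((w v + v) / 2) ((w v - v) / 2) c" by blast
    have e: "((1 - c) * (w v)\<^sup>2 + (1 + c) * v\<^sup>2) / 2 + c\<^sup>2 = 1 + h"
      using w(1)[of v] by (simp add: field_simps)
    have "(c - 1) * v\<^sup>2 < (c - 1) * (w v)\<^sup>2"
    proof -
      have "(c - 1) * (w v)\<^sup>2 - (c - 1) * v\<^sup>2 = 2 * (c\<^sup>2 - 1 - h) + 2 * v\<^sup>2"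
        unfolding w(1) by (simp add: algebra_simps)
      moreover have "0 \<le> v\<^sup>2" by simp
      ultimately show ?thesis using c2 hole_bounds(5) by argo
    qed
    hence "v\<^sup>2 < (w v)\<^sup>2" using c by simp
    hence "\<bar>v\<bar> < w v" using w(2)[of v] by (metis abs_of_pos abs_square_less_1 power2_abs power2_less_imp_less less_imp_le)
    thus "u \<in> slice 3 c" unfolding u mem_slice slice_identity e using c by auto
  qed
  thus ?thesis using c unfolding w_def
    by (auto intro!: connected_continuous_image continuous_intros)
qed

text \<open>A slice by \<open>x\<^sub>k = c\<close> with \<open>c \<ge> 2\<close> lies outside all holes, and its part in the positive octant is
one branch of a hyperbola.\<close>

lemma slice_conn:
  assumes c: "2 \<le> c" and ab: "a \<in> slice k c" "b \<in> slice k c"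
  shows "connected_component R a b"
proof -
  have base: "connected_component R a b" if "a \<in> slice 3 c" "b \<in> slice 3 c" for a b
    unfolding connected_component_def using slice3_connected[OF c] slice_subset[OF c] that by blast
  have c1: "a \<in> slice 1 c \<Longrightarrow> cyc a \<in> slice 3 c" and c2: "a \<in> slice 2 c \<Longrightarrow> cyc (cyc a) \<in> slice 3 c" for a
    by (auto simp: slice_def S_surf_def algebra_simps)
  consider "k = 1" | "k = 2" | "k = 3" using exhaust_3 by blast
  thus ?thesis
  proof cases
    case 1
    have "connected_component R (cyc a) (cyc b)" using base c1 ab 1 by blast
    from symmetries_conn(4)[OF symmetries_conn(4)[OF this]] show ?thesis by simp
  next
    case 2
    have "connected_component R (cyc (cyc a)) (cyc (cyc b))" using base c2 ab 2 by blast
    from symmetries_conn(4)[OF this] show ?thesis by simp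
  next
    case 3
    thus ?thesis using base ab by blast
  qed
qed

text \<open>The third coordinate solves the quadratic equation of the surface for two given coordinates.\<close>

lemma slices_meet:
  fixes c d :: real
  assumes "2 \<le> c" "2 \<le> d"
  defines "q \<equiv> c * d + sqrt ((c\<^sup>2 - 1) * (d\<^sup>2 - 1) + h)"
  shows "pt c d q \<in> S_surf l" "pt c q d \<in> S_surf l" "pt q c d \<in> S_surf l" "0 < q"
proof -
  have "1 \<le> c\<^sup>2" "1 \<le> d\<^sup>2" using assms by (auto simp: abs_square_le_1[symmetric] intro: one_le_power)
  hence "0 \<le> (c\<^sup>2 - 1) * (d\<^sup>2 - 1) + h" using hole_bounds(1) by simp
  hence "(q - c * d)\<^sup>2 = (c\<^sup>2 - 1) * (d\<^sup>2 - 1) + h" and "0 \<le> q - c * d" by (auto simp: q_def)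
  thus "pt c d q \<in> S_surf l" "pt c q d \<in> S_surf l" "pt q c d \<in> S_surf l"
    unfolding mem_surf by (auto simp: power2_eq_square algebra_simps)
  have "0 < c * d" using assms by simp
  thus "0 < q" using \<open>0 \<le> q - c * d\<close> by simp
qed

text \<open>A point that lies on slices in two directions, used as a common meeting point of all
slices: a slice in one direction meets a slice through this point in another direction.\<close>

definition hub :: "real^3" where "hub = pt 2 (2 * 2 + sqrt ((2\<^sup>2 - 1) * (2\<^sup>2 - 1) + h)) 2"

lemma hub_mem: "hub \<in> slice 1 2" "hub \<in> slice 3 2"
  using slices_meet[of 2 2] by (auto simp: hub_def slice_def)

lemma slice_conn_hub:
  assumes a: "a \<in> slice k c" and c: "2 \<le> c"
  shows "connected_component R a hub"
proof -
  define q where "q = c * 2 + sqrt ((c\<^sup>2 - 1) * (2\<^sup>2 - 1) + h)"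
  define q' where "q' = 2 * c + sqrt ((2\<^sup>2 - 1) * (c\<^sup>2 - 1) + h)"
  note m = slices_meet[of c 2, folded q_def, simplified] slices_meet[of 2 c, folded q'_def, simplified]
  have c0: "0 < c" using c by simp
  consider "k = 1" | "k = 2" | "k = 3" using exhaust_3 by blast
  thus ?thesis
  proof cases
    case 1
    have "pt c q 2 \<in> slice 1 c" "pt c q 2 \<in> slice 3 2" using m c c0 by (auto simp: slice_def)
    thus ?thesis
      using connected_component_trans[OF slice_conn[OF c, of a 1 "pt c q 2"] slice_conn[of 2 "pt c q 2" 3 hub]]
        hub_mem a 1 by simp
  next
    case 2
    have "pt 2 c q' \<in> slice 2 c" "pt 2 c q' \<in> slice 1 2" using m c c0 by (auto simp: slice_def)
    thus ?thesis
      using connected_component_trans[OF slice_conn[OF c, of a 2 "pt 2 c q'"] slice_conn[of 2 "pt 2 c q'" 1 hub]]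
        hub_mem a 2 by simp
  next
    case 3
    have "pt 2 q' c \<in> slice 3 c" "pt 2 q' c \<in> slice 1 2" using m c c0 by (auto simp: slice_def)
    thus ?thesis
      using connected_component_trans[OF slice_conn[OF c, of a 3 "pt 2 q' c"] slice_conn[of 2 "pt 2 q' c" 1 hub]]
        hub_mem a 3 by simp
  qed
qed

text \<open>Otherwise the product would exceed \<open>1\<close> only slightly, while the sum is at least \<open>3\<close>, which puts
the point into the hole at \<open>(1, 1, 1)\<close>.\<close>

lemma large_coordinate_if_outer:
  assumes v: "v \<in> R" and p: "1 < v$1 * v$2 * v$3" and pos: "0 < v$1" "0 < v$2" "0 < v$3"
  shows "\<exists>k. 1 + r \<le> v$k"
proof (rule ccontr)
  assume "\<not> ?thesis"
  hence b: "v$1 < 1 + r" "v$2 < 1 + r" "v$3 < 1 + r" by (auto simp: not_le)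
  note R = v[unfolded mem_R[of v] mem_punctured]
  have "v$1 * v$2 * v$3 \<le> (1 + r) * (1 + r) * (1 + r)"
    using b pos by (intro mult_mono) auto
  also have "\<dots> \<le> 1 + 7 * r"
  proof -
    have rr: "r * r \<le> r" using hole_bounds(2,3) mult_left_le_one_le[of r r] by linarith
    moreover have "r * r * r \<le> r"
    proof -
      have "r * (r * r) \<le> 1 * r" using hole_bounds(2,3) rr by (intro mult_mono) auto
      thus ?thesis by (simp add: mult.assoc)
    qed
    moreover have "(1 + r) * (1 + r) * (1 + r) = 1 + 3 * r + 3 * (r * r) + r * r * r"
      by (simp add: algebra_simps)
    ultimately show ?thesis by argo
  qed
  finally have p7: "v$1 * v$2 * v$3 \<le> 1 + 7 * r" .
  have s3: "3 \<le> v$1 + v$2 + v$3" using three_le_sum_if_one_le_prod pos p by simp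
  have "(v$1 - 1)\<^sup>2 + (v$2 - 1)\<^sup>2 + (v$3 - 1)\<^sup>2 = 4 + h + 2 * (v$1 * v$2 * v$3) - 2 * (v$1 + v$2 + v$3)"
    using R by (simp add: power2_eq_square algebra_simps)
  also have "\<dots> < \<rho>\<^sup>2" using p7 s3 hole_bounds(2,4,6) by argo
  finally show False using R by simp
qed

text \<open>On the hyperbola at height \<open>z \<ge> 1 + r\<close> one has \<open>w \<ge> 2\<close>, where increasing \<open>w\<close> moves away from
the puncture. Increasing \<open>w\<close> by \<open>4\<close> makes the larger of the other two coordinates at least \<open>2\<close>, so that the
slices of the previous lemmas take over.\<close>

lemma outer_to_hub_basic:
  assumes v: "pt x y z \<in> R" and z: "1 + r \<le> z" and pos: "0 < x" "0 < y" and xy: "y \<le> x"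
  shows "connected_component R (pt x y z) hub"
proof -
  define w0 where "w0 = x + y"
  define v0 where "v0 = x - y"
  have wv: "x = (w0 + v0) / 2" "y = (w0 - v0) / 2" by (auto simp: w0_def v0_def)
  have w00: "0 < w0" "0 \<le> v0" using xy pos by (auto simp: w0_def v0_def)
  note R0 = v[unfolded mem_punctured]
  have z1: "1 < z" using z hole_bounds(2) by simp
  have e0: "(1 - z) * w0\<^sup>2 + (1 + z) * v0\<^sup>2 = 2 * (1 - z\<^sup>2 + h)"
  proof -
    have "x\<^sup>2 + y\<^sup>2 + z\<^sup>2 - 2 * x * y * z = ((1 - z) * w0\<^sup>2 + (1 + z) * v0\<^sup>2) / 2 + z\<^sup>2"
      using slice_identity[of w0 v0 z] unfolding wv[symmetric] .
    thus ?thesis using R0 by argo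
  qed
  have "r\<^sup>2 \<le> (z - 1)\<^sup>2" using z hole_bounds(2) by (intro power_mono) auto
  hence h1: "h \<le> (z - 1)\<^sup>2" using h_le_r_square by simp
  have w0_ge: "2 \<le> w0"
  proof -
    have "(z - 1) * 2\<^sup>2 \<le> 2 * (z\<^sup>2 - 1 - h)" using h1 by (simp add: power2_eq_square algebra_simps)
    also have "\<dots> \<le> (z - 1) * w0\<^sup>2"
    proof -
      have "0 \<le> (1 + z) * v0\<^sup>2" using z1 by simp
      moreover have "(z - 1) * w0\<^sup>2 = - ((1 - z) * w0\<^sup>2)" by (simp add: algebra_simps)
      ultimately show ?thesis using e0 by argo
    qed
    finally have "2\<^sup>2 \<le> w0\<^sup>2" using z1 mult_le_cancel_left_pos[of "z - 1" "2\<^sup>2" "w0\<^sup>2"] by linarith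
    thus ?thesis by (rule power2_le_imp_le) (use w00 in simp)
  qed
  define q where "q w = sqrt ((2 * (1 - z\<^sup>2 + h) + (z - 1) * w\<^sup>2) / (1 + z))" for w
  define \<gamma> where "\<gamma> w = pt ((w + q w) / 2) ((w - q w) / 2) z" for w
  have neg: "(z - 1) * w\<^sup>2 = - ((1 - z) * w\<^sup>2)" for w :: real by (simp add: algebra_simps)
  have q: "(1 - z) * w\<^sup>2 + (1 + z) * (q w)\<^sup>2 = 2 * (1 - z\<^sup>2 + h)" "0 \<le> q w" if "w0 \<le> w" for w
  proof -
    have "w0\<^sup>2 \<le> w\<^sup>2" using that w00 by (intro power_mono) auto
    hence "(z - 1) * w0\<^sup>2 \<le> (z - 1) * w\<^sup>2" using z1 by (intro mult_left_mono) auto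
    moreover have "0 \<le> (1 + z) * v0\<^sup>2" using z1 by simp
    ultimately have *: "0 \<le> 2 * (1 - z\<^sup>2 + h) + (z - 1) * w\<^sup>2"
      using e0 neg[of w0] by argo
    thus "0 \<le> q w" using z1 by (simp add: q_def)
    have "(1 + z) * (q w)\<^sup>2 = 2 * (1 - z\<^sup>2 + h) + (z - 1) * w\<^sup>2" using * z1 by (simp add: q_def)
    thus "(1 - z) * w\<^sup>2 + (1 + z) * (q w)\<^sup>2 = 2 * (1 - z\<^sup>2 + h)" using neg[of w] by argo
  qed
  have \<gamma>S: "((w + q w) / 2)\<^sup>2 + ((w - q w) / 2)\<^sup>2 + z\<^sup>2 - 2 * ((w + q w) / 2) * ((w - q w) / 2) * z = 1 + h" if w: "w0 \<le> w" for w
    unfolding slice_identity q(1)[OF w] by (simp add: field_simps)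
  have \<gamma>R: "\<gamma> w \<in> R" if w: "w0 \<le> w" for w
  proof -
    have "((w + q w) / 2 - 1)\<^sup>2 + ((w - q w) / 2 - 1)\<^sup>2 - ((x - 1)\<^sup>2 + (y - 1)\<^sup>2)
      = (w - w0) * (z * (w + w0) / (1 + z) - 2)"
      unfolding wv by (rule slice_distance) (use q[OF w] e0 z1 in auto)
    moreover have "0 \<le> (w - w0) * (z * (w + w0) / (1 + z) - 2)"
    proof (rule mult_nonneg_nonneg)
      have "2 * (1 + z) \<le> z * 4" using z1 by simp
      also have "\<dots> \<le> z * (w + w0)" using w w0_ge z1 by (intro mult_left_mono) auto
      finally show "0 \<le> z * (w + w0) / (1 + z) - 2" using z1 by (simp add: field_simps)
    qed (use w in auto)
    ultimately have "\<rho>\<^sup>2 \<le> ((w + q w) / 2 - 1)\<^sup>2 + ((w - q w) / 2 - 1)\<^sup>2 + (z - 1)\<^sup>2"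
      using R0 by linarith
    moreover have "0 \<le> (w + q w) / 2 + (w - q w) / 2" using w w00 by (simp add: field_simps)
    ultimately show ?thesis
      unfolding \<gamma>_def mem_punctured using \<gamma>S[OF w]
        far_if_sum_nonneg[of "(w + q w) / 2" "(w - q w) / 2" z] z1 by auto
  qed
  \<comment> \<open>Then the larger of the two coordinates is at least \<open>w1 / 2 \<ge> 2\<close>.\<close>
  define w1 where "w1 = w0 + 4"
  have "connected (\<gamma> ` {w0..w1})" unfolding \<gamma>_def q_def
    using z1 by (intro connected_continuous_image continuous_intros) auto
  moreover have "\<gamma> w0 = pt x y z"
  proof -
    have "(1 + z) * (q w0)\<^sup>2 = (1 + z) * v0\<^sup>2" using q(1)[OF order_refl] e0 by linarith
    hence "(q w0)\<^sup>2 = v0\<^sup>2" using z1 by simp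
    hence "q w0 = v0" using w00 q(2)[of w0] by (simp add: power2_eq_iff_nonneg)
    thus ?thesis by (simp add: \<gamma>_def wv)
  qed
  moreover have "\<gamma> w0 \<in> \<gamma> ` {w0..w1}" "\<gamma> w1 \<in> \<gamma> ` {w0..w1}" by (auto simp: w1_def)
  ultimately have c1: "connected_component R (pt x y z) (\<gamma> w1)"
    unfolding connected_component_def using \<gamma>R by (intro exI[of _ "\<gamma> ` {w0..w1}"]) auto
  have w01: "w0 \<le> w1" by (simp add: w1_def)
  have "(z - 1) * (q w1)\<^sup>2 < (z - 1) * w1\<^sup>2"
  proof -
    have "(z - 1) * w1\<^sup>2 - (z - 1) * (q w1)\<^sup>2 = 2 * (q w1)\<^sup>2 + 2 * (z\<^sup>2 - 1 - h)"
    proof -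
      have "(z - 1) * (q w1)\<^sup>2 = (1 + z) * (q w1)\<^sup>2 - 2 * (q w1)\<^sup>2" by (simp add: algebra_simps)
      thus ?thesis using q(1)[OF w01] neg[of w1] by argo
    qed
    moreover have "(z - 1)\<^sup>2 < z\<^sup>2 - 1" using z1 by (simp add: power2_eq_square algebra_simps)
    ultimately show ?thesis using h1 zero_le_power2[of "q w1"] by argo
  qed
  hence "(q w1)\<^sup>2 < w1\<^sup>2" using z1 by simp
  hence qw: "q w1 < w1" by (rule power2_less_imp_less) (use w00 in \<open>simp add: w1_def\<close>)
  have "\<gamma> w1 \<in> slice 1 ((w1 + q w1) / 2)"
    unfolding \<gamma>_def mem_slice using \<gamma>S[OF w01] qw q(2)[OF w01] z1 by auto
  moreover have "2 \<le> (w1 + q w1) / 2" using w00 q(2)[OF w01] by (simp add: w1_def)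
  ultimately have "connected_component R (\<gamma> w1) hub" using slice_conn_hub by blast
  thus ?thesis using c1 connected_component_trans by blast
qed

lemma outer_to_hub:
  assumes v: "v \<in> R" and p: "1 < v$1 * v$2 * v$3" and pos: "0 < v$1" "0 < v$2"
  shows "connected_component R v hub"
proof -
  have pos3: "0 < v$3" using third_positive p pos by blast
  have hub2: "connected_component R w hub" if "w \<in> S_surf l" "0 < w$1" "0 < w$2" "0 < w$3" "w$k = 2" for w k
    using slice_conn_hub[of w k 2] that by (simp add: slice_def)
  have hub: "hub \<in> S_surf l" "0 < hub$1" "0 < hub$2" "0 < hub$3" "hub$1 = 2" "hub$3 = 2"
    using hub_mem by (auto simp: slice_def)
  have perm: "swap12 w \<in> S_surf l" "cyc w \<in> S_surf l" if "w \<in> S_surf l" for w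
    using that by (auto simp: S_surf_def algebra_simps)
  have A: "connected_component R v hub"
    if v: "v \<in> R" "0 < v$1" "0 < v$2" "1 + r \<le> v$3" for v
  proof (cases "v$2 \<le> v$1")
    case True
    thus ?thesis using outer_to_hub_basic[of "v$1" "v$2" "v$3"] v mem_R by (simp add: pt_collapse)
  next
    case False
    have "pt (v$2) (v$1) (v$3) \<in> R" using symmetries_R(3)[OF v(1)] by (simp add: swap12_def)
    from outer_to_hub_basic[OF this] have "connected_component R (swap12 v) hub"
      using v False by (simp add: swap12_def)
    hence "connected_component R v (swap12 hub)" using symmetries_conn(3) by fastforce
    moreover have "connected_component R (swap12 hub) hub"
      by (rule hub2[where k = 3]) (use hub perm in auto)
    ultimately show ?thesis using connected_component_trans by blast
  qed
  obtain k where "1 + r \<le> v$k" using large_coordinate_if_outer[OF v p pos pos3] by blast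
  moreover have "k = 1 \<or> k = 2 \<or> k = 3" by (rule exhaust_3)
  ultimately consider "1 + r \<le> v$1" | "1 + r \<le> v$2" | "1 + r \<le> v$3" by auto
  thus ?thesis
  proof cases
    case 1
    have "connected_component R (cyc v) hub"
      by (rule A) (use 1 v pos pos3 symmetries_R(4) in auto)
    from symmetries_conn(4)[OF symmetries_conn(4)[OF this]]
    have "connected_component R v (cyc (cyc hub))" by simp
    moreover have "connected_component R (cyc (cyc hub)) hub"
      by (rule hub2[where k = 1]) (use hub perm in auto)
    ultimately show ?thesis using connected_component_trans by blast
  next
    case 2
    have "connected_component R (cyc (cyc v)) hub"
      by (rule A) (use 2 v pos pos3 symmetries_R(4) in auto)
    from symmetries_conn(4)[OF this]
    have "connected_component R v (cyc hub)" by simp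
    moreover have "connected_component R (cyc hub) hub"
      by (rule hub2[where k = 3]) (use hub perm in auto)
    ultimately show ?thesis using connected_component_trans by blast
  next
    case 3
    thus ?thesis using A v pos by blast
  qed
qed

text \<open>If the product is \<open>1\<close>, the sum of the absolute values is at least \<open>3\<close>, and the squared distance
to the puncture with the same signs is at most \<open>h\<close>.\<close>

lemma product_neq_1:
  assumes v: "v \<in> R"
  shows "v$1 * v$2 * v$3 \<noteq> 1"
proof
  assume p: "v$1 * v$2 * v$3 = 1"
  have pos: False if v: "v \<in> R" "v$1 * v$2 * v$3 = 1" "0 < v$1" "0 < v$2" "0 < v$3" for v
  proof -
    have "3 \<le> v$1 + v$2 + v$3" using three_le_sum_if_one_le_prod that by simp
    moreover have "(v$1 - 1)\<^sup>2 + (v$2 - 1)\<^sup>2 + (v$3 - 1)\<^sup>2 = 4 + h + 2 * (v$1 * v$2 * v$3) - 2 * (v$1 + v$2 + v$3)"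
      using v(1)[unfolded mem_R[of v] mem_punctured] by (simp add: power2_eq_square algebra_simps)
    moreover have "\<rho>\<^sup>2 \<le> (v$1 - 1)\<^sup>2 + (v$2 - 1)\<^sup>2 + (v$3 - 1)\<^sup>2" using v(1)[unfolded mem_R[of v] mem_punctured] by simp
    ultimately show False using v(2) hole_bounds(2,4,6) by argo
  qed
  have "0 < v$1 * v$2 * v$3" using p by simp
  then consider "0 < v$1" "0 < v$2" "0 < v$3" | "v$1 < 0" "v$2 < 0" "0 < v$3"
    | "0 < v$1" "v$2 < 0" "v$3 < 0" | "v$1 < 0" "0 < v$2" "v$3 < 0"
    by (auto simp: zero_less_mult_iff mult_less_0_iff)
  thus False
  proof cases
    case 1 thus False using pos v p by blast
  next
    case 2 thus False using pos[of "flip12 v"] symmetries_R v p by simp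
  next
    case 3 thus False using pos[of "flip23 v"] symmetries_R v p by simp
  next
    case 4 thus False using pos[of "flip12 (flip23 v)"] symmetries_R v p by simp
  qed
qed

text \<open>Piece \<open>0\<close> is the centre. The signs of the first two coordinates determine that of the third when the
product is positive, so they distinguish the four outer pieces.\<close>

definition piece :: "nat \<Rightarrow> (real^3) set" where
  "piece i = (if i = 0 then {v. v$1 * v$2 * v$3 < 1}
     else {v. 1 < v$1 * v$2 * v$3 \<and> 0 < (if i \<in> {1, 3} then 1 else -1) * v$1 \<and> 0 < (if i \<in> {1, 4} then 1 else -1) * v$2})"

lemma piece_simps:
  "v \<in> piece 0 \<longleftrightarrow> v$1 * v$2 * v$3 < 1"
  "v \<in> piece 1 \<longleftrightarrow> 1 < v$1 * v$2 * v$3 \<and> 0 < v$1 \<and> 0 < v$2"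
  "v \<in> piece 2 \<longleftrightarrow> 1 < v$1 * v$2 * v$3 \<and> v$1 < 0 \<and> v$2 < 0"
  "v \<in> piece 3 \<longleftrightarrow> 1 < v$1 * v$2 * v$3 \<and> 0 < v$1 \<and> v$2 < 0"
  "v \<in> piece 4 \<longleftrightarrow> 1 < v$1 * v$2 * v$3 \<and> v$1 < 0 \<and> 0 < v$2"
  by (auto simp: piece_def)

lemma index_cases: "i \<in> {..<5::nat} \<longleftrightarrow> i = 0 \<or> i = 1 \<or> i = 2 \<or> i = 3 \<or> i = 4"
  by auto

text \<open>The sign change that maps the outer piece \<open>i\<close> to the one in the positive octant; it is its own
inverse.\<close>

definition to_first :: "nat \<Rightarrow> real^3 \<Rightarrow> real^3" where
  "to_first i v = (if i = 2 then flip12 v else if i = 3 then flip23 v else if i = 4 then flip12 (flip23 v) else v)"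

lemma to_first:
  assumes "i \<in> {1, 2, 3, 4}"
  shows "v \<in> piece i \<longleftrightarrow> to_first i v \<in> piece 1" "v \<in> R \<longleftrightarrow> to_first i v \<in> R"
    "connected_component R (to_first i v) (to_first i w) \<Longrightarrow> connected_component R v w"
    "to_first i (to_first i v) = v" "\<bar>to_first i v $ 1\<bar> = \<bar>v$1\<bar>"
proof -
  have comm: "flip12 (flip23 (flip12 (flip23 v))) = v" for v by (simp add: vec_eq_iff forall_3)
  show inv: "to_first i (to_first i v) = v" for v using assms comm by (auto simp: to_first_def)
  show "v \<in> piece i \<longleftrightarrow> to_first i v \<in> piece 1"
    using assms by (auto simp: piece_simps[simplified] to_first_def)
  have "to_first i v \<in> R" if "v \<in> R" for v using that symmetries_R by (simp add: to_first_def)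
  thus "v \<in> R \<longleftrightarrow> to_first i v \<in> R" using inv by metis
  have "connected_component R (to_first i v) (to_first i w)" if "connected_component R v w" for v w
    using that symmetries_conn by (simp add: to_first_def)
  thus "connected_component R (to_first i v) (to_first i w) \<Longrightarrow> connected_component R v w" using inv by metis
  show "\<bar>to_first i v $ 1\<bar> = \<bar>v$1\<bar>" by (simp add: to_first_def)
qed

lemma piece_unbounded:
  assumes i: "i \<in> {1, 2, 3, 4}"
  shows "R \<inter> piece i \<noteq> {}" "\<not> bounded (R \<inter> piece i)"
proof -
  have ex: "\<exists>v \<in> R \<inter> piece i. norm v \<ge> c" if c: "2 \<le> c" for c
  proof -
    define q where "q = c * 2 + sqrt ((c\<^sup>2 - 1) * (2\<^sup>2 - 1) + h)"
    note m = slices_meet[of c 2, folded q_def]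
    define v where "v = pt c 2 q"
    have "1 \<le> c\<^sup>2" using c by (simp add: one_le_power)
    hence q4: "4 \<le> q" using c hole_bounds(1) by (simp add: q_def add_increasing2)
    have "v \<in> slice 1 c" using m c by (simp add: v_def slice_def)
    hence vR: "v \<in> R" using slice_subset[OF c] by blast
    have "4 * 4 \<le> c * 2 * q" using c q4 by (intro mult_mono) auto
    hence "v \<in> piece 1" using c by (simp add: v_def piece_simps[simplified])
    hence "to_first i v \<in> R \<inter> piece i" using vR to_first[OF i] by simp
    moreover have "c \<le> norm (to_first i v)"
      using component_le_norm_cart[of "to_first i v" 1] to_first(5)[OF i, of v] c by (simp add: v_def)
    ultimately show ?thesis by blast
  qed
  show "R \<inter> piece i \<noteq> {}" using ex[of 2] by blast
  show "\<not> bounded (R \<inter> piece i)"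
  proof
    assume "bounded (R \<inter> piece i)"
    then obtain B where B: "\<And>v. v \<in> R \<inter> piece i \<Longrightarrow> norm v \<le> B" by (auto simp: bounded_iff)
    obtain v where "v \<in> R \<inter> piece i" "max 2 (B + 1) \<le> norm v" using ex[of "max 2 (B + 1)"] by auto
    thus False using B by fastforce
  qed
qed

lemma components_small_hole:
  "components R = (\<lambda>i. R \<inter> piece i) ` {..<5}" "inj_on (\<lambda>i. R \<inter> piece i) {..<5}"
proof -
  have op: "open (piece i)" for i
  proof -
    have "open {v::real^3. v$1 * v$2 * v$3 < 1}" "open {v::real^3. 1 < v$1 * v$2 * v$3 \<and> 0 < s * v$1 \<and> 0 < t * v$2}" for s t
      by (intro open_Collect_conj open_Collect_less continuous_intros)+
    thus ?thesis unfolding piece_def by (cases "i = 0") simp_all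
  qed
  have dj: "disjoint_family_on piece {..<5}"
  proof -
    define label :: "real^3 \<Rightarrow> nat" where "label v = (if v$1 * v$2 * v$3 < 1 then 0
        else if 0 < v$1 then (if 0 < v$2 then 1 else 3) else (if 0 < v$2 then 4 else 2))" for v
    have label: "i = label v" if i: "i \<in> {..<5}" and v: "v \<in> piece i" for i v
    proof -
      consider "i = 0" | "i = 1" | "i = 2" | "i = 3" | "i = 4" using i unfolding index_cases by blast
      thus ?thesis using v by cases (simp_all add: piece_def label_def)
    qed
    have "piece i \<inter> piece j = {}" if "i \<in> {..<5}" "j \<in> {..<5}" "i \<noteq> j" for i j
      using label[OF that(1)] label[OF that(2)] that(3) by blast
    thus ?thesis unfolding disjoint_family_on_def by blast
  qed
  have cov: "R \<subseteq> (\<Union>i\<in>{..<5}. piece i)"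
  proof
    fix v assume v: "v \<in> R"
    show "v \<in> (\<Union>i\<in>{..<5}. piece i)"
    proof (cases "v$1 * v$2 * v$3 < 1")
      case True
      thus ?thesis by (intro UN_I[of 0]) (simp_all add: piece_def)
    next
      case False
      hence p: "1 < v$1 * v$2 * v$3" using product_neq_1[OF v] by linarith
      hence n: "v$1 \<noteq> 0" "v$2 \<noteq> 0" by auto
      consider "0 < v$1" "0 < v$2" | "v$1 < 0" "v$2 < 0" | "0 < v$1" "v$2 < 0" | "v$1 < 0" "0 < v$2"
        using n by linarith
      thus ?thesis
      proof cases
        case 1
        thus ?thesis using p by (intro UN_I[of 1]) (simp_all add: piece_def)
      next
        case 2
        thus ?thesis using p by (intro UN_I[of 2]) (simp_all add: piece_def)
      next
        case 3
        thus ?thesis using p by (intro UN_I[of 3]) (simp_all add: piece_def)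
      next
        case 4
        thus ?thesis using p by (intro UN_I[of 4]) (simp_all add: piece_def)
      qed
    qed
  qed
  have ne: "R \<inter> piece i \<noteq> {}" if "i \<in> {..<5}" for i
  proof (cases "i = 0")
    case True
    have "pt (sqrt (1 + h)) 0 0 \<in> circle3" using hole_bounds(1) by (auto simp: circle3_def)
    hence "pt (sqrt (1 + h)) 0 0 \<in> R \<inter> piece 0" using circle3_subset by (auto simp: piece_simps)
    thus ?thesis using True by blast
  next
    case False
    hence "i \<in> {1, 2, 3, 4}" using that by auto
    thus ?thesis by (rule piece_unbounded)
  qed
  have conn: "connected_component R x y" if i: "i \<in> {..<5}" and x: "x \<in> R \<inter> piece i" and y: "y \<in> R \<inter> piece i" for i x y
  proof (cases "i = 0")
    case True
    have "x \<in> R" "x$1 * x$2 * x$3 < 1" "y \<in> R" "y$1 * y$2 * y$3 < 1"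
      using x y True by (auto simp: piece_simps)
    thus ?thesis by (rule centre_connected)
  next
    case False
    hence i: "i \<in> {1, 2, 3, 4}" using i by auto
    have "connected_component R u hub" if u: "u \<in> R \<inter> piece 1" for u
      by (rule outer_to_hub) (use u in \<open>auto simp: piece_simps[simplified]\<close>)
    hence "connected_component R (to_first i x) hub" "connected_component R (to_first i y) hub"
      using to_first(1,2)[OF i] x y by blast+
    hence "connected_component R (to_first i x) (to_first i y)"
      by (meson connected_component_trans connected_component_sym)
    thus ?thesis by (rule to_first(3)[OF i])
  qed
  show "components R = (\<lambda>i. R \<inter> piece i) ` {..<5}" "inj_on (\<lambda>i. R \<inter> piece i) {..<5}"
    by (rule components_eq_open_pieces[of "{..<5}" piece R, OF _ dj cov]; (rule op | erule ne | (erule conn, assumption, assumption)))+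
qed

lemma admissible_small_hole:
  "admissible \<rho> l" and S_bdd_small_hole: "S_bdd \<rho> l = {v \<in> punctured l \<rho>. v$1 * v$2 * v$3 < 1}"
proof -
  have eqR: "S_surf l - O_nbhd \<rho> = R" by (simp add: punctured_def)
  have card: "card (components R) = 5"
    by (simp add: components_small_hole(1) card_image[OF components_small_hole(2)])
  have bd: "bounded (R \<inter> piece 0)"
  proof -
    have "norm v \<le> 2" if "v \<in> R \<inter> piece 0" for v
    proof -
      have "(v$1)\<^sup>2 + (v$2)\<^sup>2 + (v$3)\<^sup>2 - 2 * (v$1 * v$2 * v$3) = 1 + h" "v$1 * v$2 * v$3 < 1"
        using that mem_R[of v] by (auto simp: mem_punctured piece_simps algebra_simps)
      hence "(v$1)\<^sup>2 + (v$2)\<^sup>2 + (v$3)\<^sup>2 \<le> 2\<^sup>2" using hole_bounds(5) by simp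
      hence "sqrt ((v$1)\<^sup>2 + (v$2)\<^sup>2 + (v$3)\<^sup>2) \<le> 2" by (intro real_le_lsqrt) auto
      thus ?thesis by (simp add: norm_vec_def L2_set_def sum_3)
    qed
    thus ?thesis by (auto simp: bounded_iff)
  qed
  have iff: "C \<in> components R \<and> bounded C \<longleftrightarrow> C = R \<inter> piece 0" for C
  proof
    assume C: "C \<in> components R \<and> bounded C"
    then obtain i where i: "i \<in> {..<5}" "C = R \<inter> piece i" by (auto simp: components_small_hole(1))
    have "i = 0"
    proof (rule ccontr)
      assume "i \<noteq> 0"
      hence "i \<in> {1, 2, 3, 4}" using i by auto
      thus False using piece_unbounded(2) C i by blast
    qed
    thus "C = R \<inter> piece 0" using i by simp
  next
    assume "C = R \<inter> piece 0"
    thus "C \<in> components R \<and> bounded C" using bd by (auto simp: components_small_hole(1))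
  qed
  show "admissible \<rho> l" unfolding admissible_def eqR iff card by simp
  show "S_bdd \<rho> l = {v \<in> punctured l \<rho>. v$1 * v$2 * v$3 < 1}"
    unfolding S_bdd_def eqR iff by (auto simp: piece_simps)
qed

end

section \<open>Angle coordinates on the coupled surface\<close>

abbreviation cell :: "real \<Rightarrow> int" where "cell x \<equiv> \<lfloor>x / pi\<rfloor>"

text \<open>Distance at least \<open>\<kappa>\<close> from \<open>\<pi> \<int>\<close>. The cell \<open>\<lfloor>x / \<pi>\<rfloor>\<close> is made explicit because increments are
only compared within one cell, where the cosine is injective.\<close>

definition away :: "real \<Rightarrow> real \<Rightarrow> bool" where
  "away \<kappa> x \<longleftrightarrow> pi * cell x + \<kappa> \<le> x \<and> x \<le> pi * cell x + pi - \<kappa>"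

text \<open>The angle in the cell of \<open>x\<close> whose cosine is \<open>s cos x\<close>; for \<open>s = 1\<close> it is \<open>x\<close> itself.\<close>

definition bend :: "real \<Rightarrow> real \<Rightarrow> real" where
  "bend s x = pi * cell x + arccos (s * cos (x - pi * cell x))"

definition ampl :: "real \<Rightarrow> real \<Rightarrow> real" where
  "ampl l \<theta> = sqrt (1 + l\<^sup>2 / 4 / (sin \<theta>)\<^sup>2)"

text \<open>The trace map in the coordinates \<open>(\<theta>, \<psi>)\<close> of \<open>polar\<close>. For \<open>l = 0\<close> it is the linear map
\<open>(\<theta>, \<psi>) \<mapsto> (a \<theta> + \<psi>, \<theta>)\<close>.\<close>

definition angle_step :: "real \<Rightarrow> nat \<Rightarrow> real \<times> real \<Rightarrow> real \<times> real" where
  "angle_step l a z = (let \<theta>' = bend (ampl l (fst z)) (real a * fst z + snd z)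
                       in (\<theta>', bend (1 / ampl l \<theta>') (fst z)))"

lemma cell_unique: "cell x = m" if "pi * m \<le> x" "x < pi * m + pi" for m :: int
  using that by (intro floor_unique) (auto simp: field_simps)

lemma cell_bounds: "pi * cell x \<le> x" "x < pi * cell x + pi"
proof -
  have "pi * cell x \<le> pi * (x / pi)" by (rule mult_left_mono) auto
  thus "pi * cell x \<le> x" by simp
  have "pi * (x / pi) < pi * (real_of_int (cell x) + 1)" by (rule mult_strict_left_mono) auto
  thus "x < pi * cell x + pi" by (simp add: distrib_left)
qed

lemma cos_cell: "cos (pi * of_int m + y) = cos (pi * of_int m) * cos y"
  and sin_cell: "sin (pi * of_int m + y) = cos (pi * of_int m) * sin y" for m :: int and y :: real
  by (simp_all add: cos_add sin_add sin_npi_int)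

lemma cos_pi_int_square: "cos (pi * of_int m) * cos (pi * of_int m) = (1::real)" for m :: int
  by (simp add: cos_npi_int)

lemma away_abs_sin:
  assumes "away \<kappa> x" "0 < \<kappa>" "\<kappa> \<le> pi / 2"
  shows "sin \<kappa> \<le> \<bar>sin x\<bar>" "\<bar>cos x\<bar> \<le> cos \<kappa>"
proof -
  define y where "y = x - pi * cell x"
  have y: "\<kappa> \<le> y" "y \<le> pi - \<kappa>" using assms(1) by (auto simp: away_def y_def)
  have x: "x = pi * cell x + y" by (simp add: y_def)
  have "\<bar>sin x\<bar> = \<bar>sin y\<bar>" by (subst x, subst sin_cell) (simp add: abs_mult cos_npi_int)
  moreover have "sin \<kappa> \<le> sin y"
  proof (cases "y \<le> pi / 2")
    case True thus ?thesis using y assms by (intro sin_monotone_2pi_le) auto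
  next
    case False
    have "sin \<kappa> \<le> sin (pi - y)" using y assms False by (intro sin_monotone_2pi_le) auto
    thus ?thesis by simp
  qed
  ultimately show s: "sin \<kappa> \<le> \<bar>sin x\<bar>" by linarith
  have "0 \<le> sin \<kappa>" using assms by (intro sin_ge_zero) auto
  hence "(sin \<kappa>)\<^sup>2 \<le> \<bar>sin x\<bar>\<^sup>2" using s by (intro power_mono) auto
  hence "(cos x)\<^sup>2 \<le> (cos \<kappa>)\<^sup>2" by (simp add: cos_squared_eq)
  moreover have "0 \<le> cos \<kappa>" using assms by (intro cos_ge_zero) auto
  ultimately show "\<bar>cos x\<bar> \<le> cos \<kappa>" by (metis abs_le_square_iff abs_of_nonneg)
qed

text \<open>Away from the critical points of the cosine a scale factor close to \<open>1\<close> keeps \<open>s cos x\<close> away from \<open>\<plusminus>1\<close>, where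
\<open>arccos\<close> is not differentiable.\<close>

lemma scaled_cos_bounds:
  fixes s x \<kappa> :: real
  assumes \<kappa>: "0 < \<kappa>" "\<kappa> \<le> pi / 2" and x: "\<kappa> \<le> x" "x \<le> pi - \<kappa>" and s: "\<bar>s - 1\<bar> \<le> (sin \<kappa>)\<^sup>2 / 6"
  shows "sin \<kappa> / 2 \<le> sqrt (1 - (s * cos x)\<^sup>2)" "- 1 < s * cos x" "s * cos x < 1" "sin \<kappa> \<le> sin x" "0 < sin \<kappa>"
    "\<bar>s\<^sup>2 - 1\<bar> \<le> 3 * \<bar>s - 1\<bar>" "1 / 2 \<le> s"
proof -
  show q0: "0 < sin \<kappa>" using \<kappa> by (intro sin_gt_zero) auto
  show sx: "sin \<kappa> \<le> sin x"
  proof (cases "x \<le> pi / 2")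
    case True thus ?thesis using x \<kappa> by (intro sin_monotone_2pi_le) auto
  next
    case False
    have "sin \<kappa> \<le> sin (pi - x)" using x \<kappa> False by (intro sin_monotone_2pi_le) auto
    thus ?thesis by simp
  qed
  have q1: "(sin \<kappa>)\<^sup>2 \<le> 1" by (simp add: abs_square_le_1)
  have s1: "\<bar>s - 1\<bar> \<le> 1 / 6" using s q1 by linarith
  thus "1 / 2 \<le> s" by linarith
  have "\<bar>s\<^sup>2 - 1\<bar> = \<bar>s - 1\<bar> * \<bar>s + 1\<bar>" by (simp add: power2_eq_square abs_mult[symmetric] algebra_simps)
  also have "\<dots> \<le> \<bar>s - 1\<bar> * 3" using s1 by (intro mult_left_mono) linarith+
  finally show s2: "\<bar>s\<^sup>2 - 1\<bar> \<le> 3 * \<bar>s - 1\<bar>" by simp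
  have "(s * cos x)\<^sup>2 = (cos x)\<^sup>2 + (s\<^sup>2 - 1) * (cos x)\<^sup>2" by (simp add: power_mult_distrib algebra_simps)
  also have "\<dots> \<le> (cos x)\<^sup>2 + ((sin \<kappa>)\<^sup>2 / 2) * 1"
    using s s2 abs_cos_le_one[of x] q1 by (intro add_left_mono mult_mono) (auto simp: abs_square_le_1)
  also have "\<dots> = 1 - (sin x)\<^sup>2 + (sin \<kappa>)\<^sup>2 / 2" by (simp add: cos_squared_eq)
  also have "\<dots> \<le> 1 - (sin \<kappa>)\<^sup>2 / 2" using power_mono[OF sx, of 2] q0 by simp
  finally have c: "(s * cos x)\<^sup>2 \<le> 1 - (sin \<kappa>)\<^sup>2 / 2" .
  moreover have "(sin \<kappa> / 2)\<^sup>2 = (sin \<kappa>)\<^sup>2 / 4" by (simp add: power_divide)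
  ultimately have "(sin \<kappa> / 2)\<^sup>2 \<le> 1 - (s * cos x)\<^sup>2" using zero_le_power2[of "sin \<kappa>"] by argo
  thus "sin \<kappa> / 2 \<le> sqrt (1 - (s * cos x)\<^sup>2)" using real_le_rsqrt by blast
  have "0 < (sin \<kappa>)\<^sup>2" using q0 by simp
  hence "(s * cos x)\<^sup>2 < 1" using c by linarith
  hence "\<bar>s * cos x\<bar> < 1" by (simp add: abs_square_less_1)
  thus "- 1 < s * cos x" "s * cos x < 1" by auto
qed

text \<open>The derivative in \<open>x\<close> is \<open>s sin x / D\<close> with \<open>D\<^sup>2 = 1 - s\<^sup>2 cos\<^sup>2 x\<close>, and
\<open>(s sin x)\<^sup>2 - D\<^sup>2 = s\<^sup>2 - 1\<close>, so it differs from \<open>1\<close> by a multiple of \<open>s - 1\<close>.\<close>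

lemma arccos_scaled_diff_arg:
  fixes s x y \<kappa> :: real
  assumes \<kappa>: "0 < \<kappa>" "\<kappa> \<le> pi / 2" and x: "\<kappa> \<le> x" "x \<le> pi - \<kappa>" and y: "\<kappa> \<le> y" "y \<le> pi - \<kappa>"
    and s: "\<bar>s - 1\<bar> \<le> (sin \<kappa>)\<^sup>2 / 6"
  shows "\<bar>arccos (s * cos x) - arccos (s * cos y) - (x - y)\<bar> \<le> 12 * \<bar>s - 1\<bar> / (sin \<kappa>)\<^sup>2 * \<bar>x - y\<bar>"
proof -
  have "norm ((arccos (s * cos x) - x) - (arccos (s * cos y) - y)) \<le> 12 * \<bar>s - 1\<bar> / (sin \<kappa>)\<^sup>2 * norm (x - y)"
  proof (rule field_differentiable_bound[where S = "{\<kappa>..pi - \<kappa>}" and f' = "\<lambda>x. s * sin x / sqrt (1 - (s * cos x)\<^sup>2) - 1"])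
    fix z assume z: "z \<in> {\<kappa>..pi - \<kappa>}"
    hence z': "\<kappa> \<le> z" "z \<le> pi - \<kappa>" by auto
    note b = scaled_cos_bounds[OF \<kappa> z' s]
    show "((\<lambda>x. arccos (s * cos x) - x) has_field_derivative s * sin z / sqrt (1 - (s * cos z)\<^sup>2) - 1) (at z within {\<kappa>..pi - \<kappa>})"
      using b(2,3) by (auto intro!: derivative_eq_intros simp: field_simps)
    define D where "D = sqrt (1 - (s * cos z)\<^sup>2)"
    have D: "sin \<kappa> / 2 \<le> D" using b(1) by (simp add: D_def)
    have "0 < D" using D b(5) by linarith
    hence "D\<^sup>2 = 1 - (s * cos z)\<^sup>2" unfolding D_def by (metis less_imp_le real_sqrt_gt_0_iff real_sqrt_pow2)
    hence "(s * sin z)\<^sup>2 - D\<^sup>2 = s\<^sup>2 * ((sin z)\<^sup>2 + (cos z)\<^sup>2) - 1"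
      by (simp only: power_mult_distrib distrib_left)
    hence "(s * sin z)\<^sup>2 - D\<^sup>2 = s\<^sup>2 - 1" by simp
    hence e: "\<bar>s * sin z - D\<bar> * (s * sin z + D) = \<bar>s\<^sup>2 - 1\<bar>"
    proof -
      have "0 < s * sin z + D" using b(4,5,7) \<open>0 < D\<close> by (simp add: add_nonneg_pos)
      hence "\<bar>s * sin z - D\<bar> * (s * sin z + D) = \<bar>(s * sin z - D) * (s * sin z + D)\<bar>" by (simp add: abs_mult)
      also have "(s * sin z - D) * (s * sin z + D) = (s * sin z)\<^sup>2 - D\<^sup>2" by (simp add: power2_eq_square algebra_simps)
      finally show ?thesis using \<open>(s * sin z)\<^sup>2 - D\<^sup>2 = s\<^sup>2 - 1\<close> by simp
    qed
    have "1 / 2 * sin \<kappa> \<le> s * sin z" using b(4,5,7) by (intro mult_mono) auto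
    hence "sin \<kappa> / 2 \<le> s * sin z + D" using \<open>0 < D\<close> by simp
    hence "\<bar>s * sin z - D\<bar> * (sin \<kappa> / 2) \<le> \<bar>s\<^sup>2 - 1\<bar>" unfolding e[symmetric] by (intro mult_left_mono) auto
    hence "\<bar>s * sin z - D\<bar> \<le> 6 * \<bar>s - 1\<bar> / sin \<kappa>" using b(5,6) by (simp add: field_simps)
    hence "\<bar>s * sin z - D\<bar> / D \<le> (6 * \<bar>s - 1\<bar> / sin \<kappa>) / (sin \<kappa> / 2)"
      using D b(5) by (intro frac_le) auto
    moreover have "s * sin z / D - 1 = (s * sin z - D) / D" using \<open>0 < D\<close> by (simp add: diff_divide_distrib)
    ultimately show "norm (s * sin z / sqrt (1 - (s * cos z)\<^sup>2) - 1) \<le> 12 * \<bar>s - 1\<bar> / (sin \<kappa>)\<^sup>2"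
      unfolding D_def[symmetric] using \<open>0 < D\<close> by (simp add: power2_eq_square)
  qed (use x y in auto)
  thus ?thesis by (simp add: algebra_simps)
qed

lemma arccos_scaled_diff_scale:
  fixes s s' x \<kappa> :: real
  assumes \<kappa>: "0 < \<kappa>" "\<kappa> \<le> pi / 2" and x: "\<kappa> \<le> x" "x \<le> pi - \<kappa>"
    and s: "\<bar>s - 1\<bar> \<le> (sin \<kappa>)\<^sup>2 / 6" and s': "\<bar>s' - 1\<bar> \<le> (sin \<kappa>)\<^sup>2 / 6"
  shows "\<bar>arccos (s * cos x) - arccos (s' * cos x)\<bar> \<le> 2 / sin \<kappa> * \<bar>s - s'\<bar>"
proof -
  have "norm (arccos (s * cos x) - arccos (s' * cos x)) \<le> 2 / sin \<kappa> * norm (s - s')"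
  proof (rule field_differentiable_bound[where S = "cball 1 ((sin \<kappa>)\<^sup>2 / 6)" and f' = "\<lambda>s. - (cos x / sqrt (1 - (s * cos x)\<^sup>2))"])
    fix z :: real assume "z \<in> cball 1 ((sin \<kappa>)\<^sup>2 / 6)"
    hence z: "\<bar>z - 1\<bar> \<le> (sin \<kappa>)\<^sup>2 / 6" by (auto simp: dist_real_def abs_minus_commute)
    note b = scaled_cos_bounds[OF \<kappa> x z]
    show "((\<lambda>s. arccos (s * cos x)) has_field_derivative - (cos x / sqrt (1 - (z * cos x)\<^sup>2))) (at z within cball 1 ((sin \<kappa>)\<^sup>2 / 6))"
      using b(2,3) by (auto intro!: derivative_eq_intros simp: field_simps)
    have "\<bar>cos x\<bar> / sqrt (1 - (z * cos x)\<^sup>2) \<le> 1 / (sin \<kappa> / 2)"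
      using b(1,5) by (intro frac_le) auto
    moreover have "0 < sqrt (1 - (z * cos x)\<^sup>2)" using b(1,5) by linarith
    ultimately show "norm (- (cos x / sqrt (1 - (z * cos x)\<^sup>2))) \<le> 2 / sin \<kappa>" by simp
  qed (use s s' in \<open>auto simp: dist_real_def abs_minus_commute\<close>)
  thus ?thesis by simp
qed

lemma bend_props:
  assumes \<kappa>: "0 < \<kappa>" "\<kappa> \<le> pi / 2" and x: "away \<kappa> x" and s: "\<bar>s - 1\<bar> \<le> (sin \<kappa>)\<^sup>2 / 6"
  shows "cos (bend s x) = s * cos x" "cell (bend s x) = cell x" "\<bar>bend s x - x\<bar> \<le> 2 / sin \<kappa> * \<bar>s - 1\<bar>"
    "0 < sin (bend s x) * sin x"
proof -
  define y where "y = x - pi * cell x"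
  have y: "\<kappa> \<le> y" "y \<le> pi - \<kappa>" using x by (auto simp: away_def y_def)
  have xy: "x = pi * cell x + y" by (simp add: y_def)
  note b = scaled_cos_bounds[OF \<kappa> y s]
  have bs: "bend s x = pi * cell x + arccos (s * cos y)" by (simp add: bend_def y_def)
  have "cos (bend s x) = cos (pi * cell x) * (s * cos y)"
    unfolding bs cos_cell using b(2,3) by simp
  also have "\<dots> = s * cos x" using cos_cell[of "cell x" y, folded xy] by simp
  finally show "cos (bend s x) = s * cos x" .
  have a: "0 < arccos (s * cos y)" "arccos (s * cos y) < pi" using b(2,3) arccos_lt_bounded by auto
  show c: "cell (bend s x) = cell x" by (rule cell_unique) (use a in \<open>auto simp: bs\<close>)
  have "\<bar>arccos (s * cos y) - arccos (1 * cos y)\<bar> \<le> 2 / sin \<kappa> * \<bar>s - 1\<bar>"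
    by (rule arccos_scaled_diff_scale[OF \<kappa> y s]) simp
  moreover have "arccos (1 * cos y) = y" using y \<kappa> by (simp add: arccos_cos)
  ultimately show "\<bar>bend s x - x\<bar> \<le> 2 / sin \<kappa> * \<bar>s - 1\<bar>" unfolding bs y_def by (simp add: algebra_simps)
  have "sin (bend s x) * sin x = (cos (pi * cell x) * cos (pi * cell x)) * (sin (arccos (s * cos y)) * sin y)"
    using sin_cell[of "cell x" y, folded xy] unfolding bs sin_cell by simp
  also have "\<dots> = sin (arccos (s * cos y)) * sin y" by (simp add: cos_pi_int_square)
  also have "\<dots> > 0" using a y \<kappa> by (intro mult_pos_pos sin_gt_zero) linarith+
  finally show "0 < sin (bend s x) * sin x" .
qed

lemma bend_diff:
  assumes \<kappa>: "0 < \<kappa>" "\<kappa> \<le> pi / 2" and x: "away \<kappa> x" and y: "away \<kappa> y" and xy: "cell x = cell y"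
    and s: "\<bar>s - 1\<bar> \<le> (sin \<kappa>)\<^sup>2 / 6" and s': "\<bar>s' - 1\<bar> \<le> (sin \<kappa>)\<^sup>2 / 6"
  shows "\<bar>bend s x - bend s' y - (x - y)\<bar> \<le> 12 * \<bar>s - 1\<bar> / (sin \<kappa>)\<^sup>2 * \<bar>x - y\<bar> + 2 / sin \<kappa> * \<bar>s - s'\<bar>"
proof -
  define x0 y0 where "x0 = x - pi * cell x" and "y0 = y - pi * cell x"
  have x0: "\<kappa> \<le> x0" "x0 \<le> pi - \<kappa>" and y0: "\<kappa> \<le> y0" "y0 \<le> pi - \<kappa>"
    using x y xy by (auto simp: away_def x0_def y0_def)
  have e: "bend s x - bend s' y - (x - y) =
     (arccos (s * cos x0) - arccos (s * cos y0) - (x0 - y0)) + (arccos (s * cos y0) - arccos (s' * cos y0))"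
    by (simp add: bend_def x0_def y0_def xy)
  have xy0: "x - y = x0 - y0" by (simp add: x0_def y0_def)
  show ?thesis
    unfolding e unfolding xy0
    by (rule order_trans[OF abs_triangle_ineq add_mono[OF arccos_scaled_diff_arg[OF \<kappa> x0 y0 s] arccos_scaled_diff_scale[OF \<kappa> y0 s s']]])
qed

lemma ampl_bounds:
  assumes q: "0 < q" "q \<le> \<bar>sin x\<bar>"
  shows "1 \<le> ampl l x" "ampl l x - 1 \<le> l\<^sup>2 / 4 / q\<^sup>2" "(ampl l x)\<^sup>2 = 1 + l\<^sup>2 / 4 / (sin x)\<^sup>2"
proof -
  have sq: "q\<^sup>2 \<le> (sin x)\<^sup>2" using power_mono[OF q(2), of 2] q(1) by simp
  have p: "0 \<le> l\<^sup>2 / 4 / (sin x)\<^sup>2" by simp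
  show a1: "1 \<le> ampl l x" using p by (simp add: ampl_def)
  show a2: "(ampl l x)\<^sup>2 = 1 + l\<^sup>2 / 4 / (sin x)\<^sup>2" using p unfolding ampl_def by (intro real_sqrt_pow2) linarith
  have "(ampl l x - 1) * 1 \<le> (ampl l x - 1) * (ampl l x + 1)" using a1 by (intro mult_left_mono) auto
  also have "\<dots> = l\<^sup>2 / 4 / (sin x)\<^sup>2" using a2 by (simp add: power2_eq_square algebra_simps)
  also have "\<dots> \<le> l\<^sup>2 / 4 / q\<^sup>2" using sq q by (intro divide_left_mono) auto
  finally show "ampl l x - 1 \<le> l\<^sup>2 / 4 / q\<^sup>2" by simp
qed

text \<open>Both bounds come from the squares: amplitudes are at least \<open>1\<close>, so their difference is at most half
of the difference of their squares, which is a difference of multiples of \<open>1 / sin\<^sup>2\<close>.\<close>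

lemma ampl_lipschitz:
  assumes q: "0 < q" "q \<le> \<bar>sin x\<bar>" "q \<le> \<bar>sin y\<bar>"
  shows "\<bar>ampl l x - ampl l y\<bar> \<le> l\<^sup>2 / 4 / q ^ 4 * \<bar>x - y\<bar>"
    "\<bar>1 / ampl l x - 1 / ampl l y\<bar> \<le> l\<^sup>2 / 4 / q ^ 4 * \<bar>x - y\<bar>"
proof -
  note A = ampl_bounds[OF q(1,2), of l] and B = ampl_bounds[OF q(1,3), of l]
  have sx: "q\<^sup>2 \<le> (sin x)\<^sup>2" using power_mono[OF q(2), of 2] q(1) by simp
  have sy: "q\<^sup>2 \<le> (sin y)\<^sup>2" using power_mono[OF q(3), of 2] q(1) by simp
  have q2: "0 < q\<^sup>2" using q by simp
  define Z where "Z = l\<^sup>2 / 4 / q ^ 4 * \<bar>x - y\<bar>"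
  have "\<bar>sin x - sin y\<bar> \<le> 1 * \<bar>x - y\<bar>"
  proof -
    have "norm (sin x - sin y) \<le> 1 * norm (x - y)"
      by (rule field_differentiable_bound[where S = UNIV and f' = cos]) (auto intro: DERIV_sin)
    thus ?thesis by simp
  qed
  hence s1: "\<bar>sin y - sin x\<bar> \<le> \<bar>x - y\<bar>" by (simp add: abs_minus_commute)
  have s2: "\<bar>sin y + sin x\<bar> \<le> 2" using abs_sin_le_one[of x] abs_sin_le_one[of y] by linarith
  have "\<bar>sin y - sin x\<bar> * \<bar>sin y + sin x\<bar> \<le> \<bar>x - y\<bar> * 2"
    by (rule mult_mono[OF s1 s2]) auto
  moreover have "\<bar>sin y - sin x\<bar> * \<bar>sin y + sin x\<bar> = \<bar>(sin y)\<^sup>2 - (sin x)\<^sup>2\<bar>"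
    by (simp add: abs_mult[symmetric] power2_eq_square algebra_simps)
  ultimately have d: "\<bar>(sin y)\<^sup>2 - (sin x)\<^sup>2\<bar> \<le> 2 * \<bar>x - y\<bar>" by simp
  have "(ampl l x)\<^sup>2 - (ampl l y)\<^sup>2 = l\<^sup>2 / 4 * (((sin y)\<^sup>2 - (sin x)\<^sup>2) / ((sin x)\<^sup>2 * (sin y)\<^sup>2))"
  proof -
    have "sin x \<noteq> 0" "sin y \<noteq> 0" using q by auto
    thus ?thesis unfolding A(3) B(3) by (simp add: field_simps)
  qed
  moreover have "\<bar>(sin y)\<^sup>2 - (sin x)\<^sup>2\<bar> / ((sin x)\<^sup>2 * (sin y)\<^sup>2) \<le> (2 * \<bar>x - y\<bar>) / (q\<^sup>2 * q\<^sup>2)"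
    by (rule frac_le) (use d q2 mult_mono[OF sx sy] in auto)
  ultimately have "\<bar>(ampl l x)\<^sup>2 - (ampl l y)\<^sup>2\<bar> \<le> l\<^sup>2 / 4 * ((2 * \<bar>x - y\<bar>) / (q\<^sup>2 * q\<^sup>2))"
  proof -
    assume e: "(ampl l x)\<^sup>2 - (ampl l y)\<^sup>2 = l\<^sup>2 / 4 * (((sin y)\<^sup>2 - (sin x)\<^sup>2) / ((sin x)\<^sup>2 * (sin y)\<^sup>2))"
      and d': "\<bar>(sin y)\<^sup>2 - (sin x)\<^sup>2\<bar> / ((sin x)\<^sup>2 * (sin y)\<^sup>2) \<le> (2 * \<bar>x - y\<bar>) / (q\<^sup>2 * q\<^sup>2)"
    have "\<bar>(ampl l x)\<^sup>2 - (ampl l y)\<^sup>2\<bar> = l\<^sup>2 / 4 * (\<bar>(sin y)\<^sup>2 - (sin x)\<^sup>2\<bar> / ((sin x)\<^sup>2 * (sin y)\<^sup>2))"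
      unfolding e by (simp add: abs_mult)
    also have "\<dots> \<le> l\<^sup>2 / 4 * ((2 * \<bar>x - y\<bar>) / (q\<^sup>2 * q\<^sup>2))" by (rule mult_left_mono[OF d']) simp
    finally show ?thesis .
  qed
  also have "\<dots> = 2 * Z" unfolding Z_def by (simp add: power4_eq_xxxx power2_eq_square)
  finally have f1: "\<bar>(ampl l x)\<^sup>2 - (ampl l y)\<^sup>2\<bar> \<le> 2 * Z" .
  have f2: "\<bar>ampl l x - ampl l y\<bar> * 2 \<le> \<bar>ampl l x - ampl l y\<bar> * (ampl l x + ampl l y)"
    using A(1) B(1) by (intro mult_left_mono) auto
  have f3: "\<bar>ampl l x - ampl l y\<bar> * (ampl l x + ampl l y) = \<bar>(ampl l x)\<^sup>2 - (ampl l y)\<^sup>2\<bar>"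
  proof -
    have "\<bar>ampl l x - ampl l y\<bar> * (ampl l x + ampl l y) = \<bar>(ampl l x - ampl l y) * (ampl l x + ampl l y)\<bar>"
      using A(1) B(1) by (simp add: abs_mult)
    thus ?thesis by (simp add: power2_eq_square algebra_simps)
  qed
  have "\<bar>ampl l x - ampl l y\<bar> \<le> Z" using order_trans[OF f2[unfolded f3] f1] by simp
  thus AB: "\<bar>ampl l x - ampl l y\<bar> \<le> l\<^sup>2 / 4 / q ^ 4 * \<bar>x - y\<bar>" unfolding Z_def .
  have "1 / ampl l x - 1 / ampl l y = (ampl l y - ampl l x) / (ampl l x * ampl l y)"
    using A(1) B(1) by (simp add: field_simps)
  hence "\<bar>1 / ampl l x - 1 / ampl l y\<bar> = \<bar>ampl l x - ampl l y\<bar> / (ampl l x * ampl l y)"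
    using A(1) B(1) by (simp add: abs_minus_commute)
  also have "\<dots> \<le> \<bar>ampl l x - ampl l y\<bar> / 1"
    using A(1) B(1) mult_mono[OF A(1) B(1)] by (intro divide_left_mono) auto
  finally show "\<bar>1 / ampl l x - 1 / ampl l y\<bar> \<le> l\<^sup>2 / 4 / q ^ 4 * \<bar>x - y\<bar>" using AB by simp
qed

text \<open>The Chebyshev recursion \<open>cos (\<alpha> + \<theta>) + cos (\<alpha> - \<theta>) = 2 cos \<alpha> cos \<theta>\<close>.\<close>

lemma G_map_iterate:
  "(G_map ^^ k) (vector [A * cos (\<psi> + \<theta>), A * cos \<psi>, cos \<theta>])
     = vector [A * cos (\<psi> + real (Suc k) * \<theta>), A * cos (\<psi> + real k * \<theta>), cos \<theta>]"
proof (induction k)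
  case (Suc k)
  have "2 * (A * cos (\<psi> + real (Suc k) * \<theta>)) * cos \<theta> - A * cos (\<psi> + real k * \<theta>)
    = A * cos (\<psi> + real (Suc (Suc k)) * \<theta>)"
  proof -
    define \<alpha> where "\<alpha> = \<psi> + real (Suc k) * \<theta>"
    have e: "\<psi> + real k * \<theta> = \<alpha> - \<theta>" "\<psi> + real (Suc (Suc k)) * \<theta> = \<alpha> + \<theta>"
      by (simp_all add: \<alpha>_def algebra_simps)
    have "2 * (A * cos \<alpha>) * cos \<theta> - A * cos (\<alpha> - \<theta>) = A * cos (\<alpha> + \<theta>)"
      by (simp add: cos_add cos_diff algebra_simps)
    thus ?thesis unfolding e[symmetric] unfolding \<alpha>_def .
  qed
  thus ?case using Suc by (simp add: G_map_def)
qed simp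

text \<open>The phase after the map is applied, before the return to the normal form; it is the new angle of
the linear map.\<close>

definition chi :: "nat \<Rightarrow> real \<times> real \<Rightarrow> real" where "chi a z = real a * fst z + snd z"

text \<open>The coupling is so small, depending on \<open>\<kappa>\<close> and \<open>\<delta>\<close>, that one step of the angle
dynamics differs from the linear map by at most \<open>\<delta>\<close>, in value and relatively in increments.\<close>

locale angle_chart =
  fixes l \<kappa> \<delta> :: real
  assumes \<kappa>: "0 < \<kappa>" "\<kappa> \<le> pi / 2" and \<delta>: "0 < \<delta>"
    and l_small: "l\<^sup>2 / 4 \<le> (sin \<kappa>) ^ 5 * min \<delta> 1 / 14"
begin

lemma sin_kappa: "0 < sin \<kappa>" "sin \<kappa> \<le> 1"
  using \<kappa> by (auto intro!: sin_gt_zero)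

text \<open>The four forms in which the smallness of the coupling is used: the amplitudes are admissible scale factors,
and \<open>bend\<close> moves values, increments in the angle, and increments in the scale by at most \<open>\<delta>\<close>.\<close>

lemma coupling_bounds:
  "l\<^sup>2 / 4 / (sin \<kappa>)\<^sup>2 \<le> (sin \<kappa>)\<^sup>2 / 6" "2 / sin \<kappa> * (l\<^sup>2 / 4 / (sin \<kappa>)\<^sup>2) \<le> \<delta>"
  "12 * (l\<^sup>2 / 4 / (sin \<kappa>)\<^sup>2) / (sin \<kappa>)\<^sup>2 \<le> \<delta>" "2 / sin \<kappa> * (l\<^sup>2 / 4 / (sin \<kappa>) ^ 4) \<le> \<delta>"
proof -
  define s where "s = sin \<kappa>"
  define m where "m = min \<delta> 1"
  have s: "0 < s" "s \<le> 1" using sin_kappa by (auto simp: s_def)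
  have m: "0 < m" "m \<le> \<delta>" "m \<le> 1" using \<delta> by (auto simp: m_def)
  define H where "H = l\<^sup>2 / 4"
  have H: "H \<le> s ^ 5 * m / 14" "0 \<le> H" using l_small by (auto simp: s_def m_def H_def)
  have pw: "s ^ k \<le> 1" for k using s by (intro power_le_one) auto
  have "H / s\<^sup>2 \<le> s ^ 3 * m / 14" using H s by (simp add: field_simps eval_nat_numeral)
  also have "\<dots> \<le> s\<^sup>2 * 1 / 14" using s m by (intro divide_right_mono mult_mono power_decreasing) auto
  also have "\<dots> \<le> s\<^sup>2 / 6" using s by simp
  finally show "l\<^sup>2 / 4 / (sin \<kappa>)\<^sup>2 \<le> (sin \<kappa>)\<^sup>2 / 6" by (simp add: H_def s_def)
  have "2 / s * (H / s\<^sup>2) \<le> s ^ 2 * m / 7" using H s by (simp add: field_simps eval_nat_numeral)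
  also have "\<dots> \<le> 1 * m / 1" using s m pw[of 2] by (intro frac_le mult_mono) auto
  finally show "2 / sin \<kappa> * (l\<^sup>2 / 4 / (sin \<kappa>)\<^sup>2) \<le> \<delta>" using m by (simp add: H_def s_def)
  have "12 * (H / s\<^sup>2) / s\<^sup>2 \<le> 12 * s * m / 14" using H s by (simp add: field_simps eval_nat_numeral)
  also have "\<dots> \<le> 1 * m" using s m by (simp add: field_simps)
  finally show "12 * (l\<^sup>2 / 4 / (sin \<kappa>)\<^sup>2) / (sin \<kappa>)\<^sup>2 \<le> \<delta>" using m by (simp add: H_def s_def)
  have "2 / s * (H / s ^ 4) \<le> m / 7" using H s by (simp add: field_simps eval_nat_numeral)
  also have "\<dots> \<le> m" using m by simp
  finally show "2 / sin \<kappa> * (l\<^sup>2 / 4 / (sin \<kappa>) ^ 4) \<le> \<delta>" using m by (simp add: H_def s_def)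
qed

lemma ampl_near:
  assumes "away \<kappa> \<theta>"
  shows "\<bar>ampl l \<theta> - 1\<bar> \<le> l\<^sup>2 / 4 / (sin \<kappa>)\<^sup>2" "\<bar>1 / ampl l \<theta> - 1\<bar> \<le> l\<^sup>2 / 4 / (sin \<kappa>)\<^sup>2" "1 \<le> ampl l \<theta>"
    "(ampl l \<theta>)\<^sup>2 * (sin \<theta>)\<^sup>2 = (sin \<theta>)\<^sup>2 + l\<^sup>2 / 4"
proof -
  have sq: "sin \<kappa> \<le> \<bar>sin \<theta>\<bar>" using away_abs_sin(1)[OF assms \<kappa>] .
  note A = ampl_bounds[OF sin_kappa(1) sq, of l]
  show "1 \<le> ampl l \<theta>" "\<bar>ampl l \<theta> - 1\<bar> \<le> l\<^sup>2 / 4 / (sin \<kappa>)\<^sup>2" using A(1,2) by auto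
  have "\<bar>1 / ampl l \<theta> - 1\<bar> = (ampl l \<theta> - 1) / ampl l \<theta>" using A(1) by (simp add: field_simps)
  also have "\<dots> \<le> (ampl l \<theta> - 1) / 1" using A(1) by (intro divide_left_mono) auto
  finally show "\<bar>1 / ampl l \<theta> - 1\<bar> \<le> l\<^sup>2 / 4 / (sin \<kappa>)\<^sup>2" using A(2) by simp
  have "sin \<theta> \<noteq> 0" using sq sin_kappa(1) by auto
  thus "(ampl l \<theta>)\<^sup>2 * (sin \<theta>)\<^sup>2 = (sin \<theta>)\<^sup>2 + l\<^sup>2 / 4" unfolding A(3) by (simp add: field_simps)
qed

lemma bend_value:
  assumes x: "away \<kappa> x" and s: "\<bar>s - 1\<bar> \<le> l\<^sup>2 / 4 / (sin \<kappa>)\<^sup>2"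
  shows "cos (bend s x) = s * cos x" "cell (bend s x) = cell x" "\<bar>bend s x - x\<bar> \<le> \<delta>" "0 < sin (bend s x) * sin x"
proof -
  have s6: "\<bar>s - 1\<bar> \<le> (sin \<kappa>)\<^sup>2 / 6" using s coupling_bounds(1) by linarith
  note b = bend_props[OF \<kappa> x s6]
  show "cos (bend s x) = s * cos x" "cell (bend s x) = cell x" "0 < sin (bend s x) * sin x" using b by auto
  have "2 / sin \<kappa> * \<bar>s - 1\<bar> \<le> 2 / sin \<kappa> * (l\<^sup>2 / 4 / (sin \<kappa>)\<^sup>2)"
    using s sin_kappa by (intro mult_left_mono) auto
  thus "\<bar>bend s x - x\<bar> \<le> \<delta>" using b(3) coupling_bounds(2) by linarith
qed

lemma bend_increment:
  assumes x: "away \<kappa> x" "away \<kappa> y" "cell x = cell y"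
    and s: "\<bar>s - 1\<bar> \<le> l\<^sup>2 / 4 / (sin \<kappa>)\<^sup>2" "\<bar>s' - 1\<bar> \<le> l\<^sup>2 / 4 / (sin \<kappa>)\<^sup>2"
    and ss: "\<bar>s - s'\<bar> \<le> l\<^sup>2 / 4 / (sin \<kappa>) ^ 4 * d"
    and d: "0 \<le> d"
  shows "\<bar>bend s x - bend s' y - (x - y)\<bar> \<le> \<delta> * (\<bar>x - y\<bar> + d)"
proof -
  have s6: "\<bar>s - 1\<bar> \<le> (sin \<kappa>)\<^sup>2 / 6" "\<bar>s' - 1\<bar> \<le> (sin \<kappa>)\<^sup>2 / 6" using s coupling_bounds(1) by linarith+
  have "12 * \<bar>s - 1\<bar> / (sin \<kappa>)\<^sup>2 \<le> 12 * (l\<^sup>2 / 4 / (sin \<kappa>)\<^sup>2) / (sin \<kappa>)\<^sup>2"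
    using s by (intro divide_right_mono mult_left_mono) auto
  hence a: "12 * \<bar>s - 1\<bar> / (sin \<kappa>)\<^sup>2 * \<bar>x - y\<bar> \<le> \<delta> * \<bar>x - y\<bar>"
    using coupling_bounds(3) by (intro mult_right_mono) auto
  have "2 / sin \<kappa> * \<bar>s - s'\<bar> \<le> 2 / sin \<kappa> * (l\<^sup>2 / 4 / (sin \<kappa>) ^ 4 * d)"
    using ss sin_kappa by (intro mult_left_mono) auto
  also have "\<dots> = 2 / sin \<kappa> * (l\<^sup>2 / 4 / (sin \<kappa>) ^ 4) * d" by simp
  also have "\<dots> \<le> \<delta> * d" using coupling_bounds(4) d by (intro mult_right_mono) auto
  finally show ?thesis using a bend_diff[OF \<kappa> x s6] unfolding distrib_left by linarith
qed

lemma angle_step_value: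
  assumes z: "away \<kappa> (fst z)" "away \<kappa> (chi a z)"
  shows "\<bar>fst (angle_step l a z) - chi a z\<bar> \<le> \<delta>" "cell (fst (angle_step l a z)) = cell (chi a z)"
    "away \<kappa> (fst (angle_step l a z)) \<Longrightarrow> \<bar>snd (angle_step l a z) - fst z\<bar> \<le> \<delta>"
  using bend_value[OF z(2) ampl_near(1)[OF z(1)]] bend_value(3)[OF z(1) ampl_near(2)]
  by (auto simp: angle_step_def Let_def chi_def)

lemma angle_step_increment:
  assumes z: "away \<kappa> (fst z)" "away \<kappa> (chi a z)" "away \<kappa> (fst (angle_step l a z))"
    and w: "away \<kappa> (fst w)" "away \<kappa> (chi a w)" "away \<kappa> (fst (angle_step l a w))"
    and zw: "cell (fst z) = cell (fst w)" "cell (chi a z) = cell (chi a w)"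
  shows "\<bar>fst (angle_step l a z) - fst (angle_step l a w) - (chi a z - chi a w)\<bar>
      \<le> \<delta> * (\<bar>chi a z - chi a w\<bar> + \<bar>fst z - fst w\<bar>)"
    "\<bar>snd (angle_step l a z) - snd (angle_step l a w) - (fst z - fst w)\<bar>
      \<le> \<delta> * (\<bar>fst z - fst w\<bar> + \<bar>fst (angle_step l a z) - fst (angle_step l a w)\<bar>)"
proof -
  note s = away_abs_sin(1)[OF _ \<kappa>]
  have f: "fst (angle_step l a z) = bend (ampl l (fst z)) (chi a z)"
    and g: "snd (angle_step l a z) = bend (1 / ampl l (fst (angle_step l a z))) (fst z)" for z
    by (auto simp: angle_step_def Let_def chi_def)
  show "\<bar>fst (angle_step l a z) - fst (angle_step l a w) - (chi a z - chi a w)\<bar>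
      \<le> \<delta> * (\<bar>chi a z - chi a w\<bar> + \<bar>fst z - fst w\<bar>)"
    unfolding f
    by (rule bend_increment[OF z(2) w(2) zw(2) ampl_near(1)[OF z(1)] ampl_near(1)[OF w(1)]
          ampl_lipschitz(1)[OF sin_kappa(1) s[OF z(1)] s[OF w(1)]]]) simp
  show "\<bar>snd (angle_step l a z) - snd (angle_step l a w) - (fst z - fst w)\<bar>
      \<le> \<delta> * (\<bar>fst z - fst w\<bar> + \<bar>fst (angle_step l a z) - fst (angle_step l a w)\<bar>)"
    unfolding g
    by (rule bend_increment[OF z(1) w(1) zw(1) ampl_near(2)[OF z(3)] ampl_near(2)[OF w(3)]
          ampl_lipschitz(2)[OF sin_kappa(1) s[OF z(3)] s[OF w(3)]]]) simp
qed

text \<open>The normal form of a point of the surface. The third coordinate determines the phase \<open>\<psi>\<close> up to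
sign, and the choice of the sign is the choice between the two points over the same second and third
coordinates.\<close>

definition polar :: "real \<times> real \<Rightarrow> real^3" where
  "polar z = vector [ampl l (fst z) * cos (snd z + fst z), cos (fst z), ampl l (fst z) * cos (snd z)]"

text \<open>After the map the coordinates are \<open>(A cos (\<omega> + \<theta>), A cos \<omega>, cos \<theta>)\<close> with \<open>\<omega> = chi a z\<close>. The last
two agree with those of the new normal form by the choice of the new angles. The first ones agree once
\<open>A sin \<omega> sin \<theta> = A' sin \<psi>' sin \<theta>'\<close>: the squares of both sides are
\<open>sin\<^sup>2 \<theta> sin\<^sup>2 \<theta>' + l\<^sup>2 / 4\<close>, and the signs agree because bending keeps the cell.\<close>

lemma trace_map_polar:
  assumes z: "away \<kappa> (fst z)" "away \<kappa> (chi a z)" "away \<kappa> (fst (angle_step l a z))"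
  shows "trace_map a (polar z) = polar (angle_step l a z)"
proof -
  define \<theta> \<psi> \<omega> where "\<theta> = fst z" and "\<psi> = snd z" and "\<omega> = chi a z"
  define \<theta>' \<psi>' where "\<theta>' = fst (angle_step l a z)" and "\<psi>' = snd (angle_step l a z)"
  define A A' where "A = ampl l \<theta>" and "A' = ampl l \<theta>'"
  note d = \<theta>_def \<psi>_def \<omega>_def \<theta>'_def \<psi>'_def A_def A'_def
  have \<omega>: "\<omega> = \<psi> + real a * \<theta>" by (simp add: d chi_def)
  have \<theta>': "\<theta>' = bend A \<omega>" and \<psi>': "\<psi>' = bend (1 / A') \<theta>"
    by (auto simp: d chi_def angle_step_def Let_def)
  have aw: "away \<kappa> \<theta>" "away \<kappa> \<omega>" "away \<kappa> \<theta>'" using z by (auto simp: d)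
  note An = ampl_near[OF aw(1), folded A_def] and An' = ampl_near[OF aw(3), folded A'_def]
  note b = bend_value[OF aw(2) An(1), folded \<theta>'] and b' = bend_value[OF aw(1) An'(2), folded \<psi>']
  have c: "A * cos \<omega> = cos \<theta>'" using b(1) by simp
  have c': "A' * cos \<psi>' = cos \<theta>" using b'(1) An'(3) by simp
  have "(A * sin \<omega> * sin \<theta>)\<^sup>2 = (A' * sin \<psi>' * sin \<theta>')\<^sup>2"
  proof -
    have "(A * sin \<omega> * sin \<theta>)\<^sup>2 = A\<^sup>2 * (sin \<theta>)\<^sup>2 - (A * cos \<omega>)\<^sup>2 * (sin \<theta>)\<^sup>2"
      by (simp add: power_mult_distrib sin_squared_eq algebra_simps)
    also have "\<dots> = (sin \<theta>)\<^sup>2 + l\<^sup>2 / 4 - (1 - (sin \<theta>')\<^sup>2) * (sin \<theta>)\<^sup>2"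
      unfolding c An(4) cos_squared_eq[of \<theta>'] ..
    also have "\<dots> = (sin \<theta>')\<^sup>2 + l\<^sup>2 / 4 - (1 - (sin \<theta>)\<^sup>2) * (sin \<theta>')\<^sup>2"
      by (simp add: algebra_simps)
    also have "\<dots> = A'\<^sup>2 * (sin \<theta>')\<^sup>2 - (A' * cos \<psi>')\<^sup>2 * (sin \<theta>')\<^sup>2"
      unfolding c' An'(4) cos_squared_eq[of \<theta>] ..
    also have "\<dots> = (A' * sin \<psi>' * sin \<theta>')\<^sup>2"
      by (simp add: power_mult_distrib sin_squared_eq algebra_simps)
    finally show ?thesis .
  qed
  moreover have "0 < (A * sin \<omega> * sin \<theta>) * (A' * sin \<psi>' * sin \<theta>')"
  proof -
    have "0 < (A * A') * ((sin \<theta>' * sin \<omega>) * (sin \<psi>' * sin \<theta>))"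
      using An(3) An'(3) mult_pos_pos[OF b(4) b'(4)] mult_pos_pos[of A A'] by (intro mult_pos_pos[of "A * A'"]) auto
    thus ?thesis by (simp add: mult_ac)
  qed
  ultimately have "A * sin \<omega> * sin \<theta> = A' * sin \<psi>' * sin \<theta>'"
    unfolding power2_eq_iff by auto
  hence e: "A * cos (\<omega> + \<theta>) = A' * cos (\<psi>' + \<theta>')"
  proof -
    assume s: "A * sin \<omega> * sin \<theta> = A' * sin \<psi>' * sin \<theta>'"
    have "A * cos (\<omega> + \<theta>) = (A * cos \<omega>) * cos \<theta> - A * sin \<omega> * sin \<theta>" by (simp add: cos_add algebra_simps)
    also have "\<dots> = (A' * cos \<psi>') * cos \<theta>' - A' * sin \<psi>' * sin \<theta>'" unfolding c c' s by simp
    also have "\<dots> = A' * cos (\<psi>' + \<theta>')" by (simp add: cos_add algebra_simps)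
    finally show ?thesis .
  qed
  have "trace_map a (polar z) = (G_map ^^ a) (vector [A * cos (\<psi> + \<theta>), A * cos \<psi>, cos \<theta>])"
    by (simp add: trace_map_def H_map_def polar_def d)
  also have "\<dots> = vector [A * cos (\<omega> + \<theta>), A * cos \<omega>, cos \<theta>]"
    unfolding G_map_iterate \<omega> by (simp add: algebra_simps)
  also have "\<dots> = vector [A' * cos (\<psi>' + \<theta>'), cos \<theta>', A' * cos \<psi>']"
    unfolding e c c' ..
  also have "\<dots> = polar (angle_step l a z)" by (simp add: polar_def d)
  finally show ?thesis .
qed

end

section \<open>The linear model and its growth\<close>

text \<open>The angle dynamics at \<open>l = 0\<close>. Index \<open>Suc j\<close> of the sequence drives step number
\<open>Suc j\<close>, as for \<open>trace_iter\<close>.\<close>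

fun lin :: "(nat \<Rightarrow> nat) \<Rightarrow> nat \<Rightarrow> real \<times> real \<Rightarrow> real \<times> real" where
  "lin b 0 z = z"
| "lin b (Suc j) z = (real (b (Suc j)) * fst (lin b j z) + snd (lin b j z), fst (lin b j z))"

text \<open>The denominators of the convergents of the continued fraction with partial quotients \<open>b 1, b 2, \<dots>\<close>.\<close>

definition growth :: "(nat \<Rightarrow> nat) \<Rightarrow> nat \<Rightarrow> real" where
  "growth b j = fst (lin b j (1, 0))"

lemma lin_expand:
  "fst (lin b j z) = fst z * fst (lin b j (1, 0)) + snd z * fst (lin b j (0, 1))"
  "snd (lin b j z) = fst z * snd (lin b j (1, 0)) + snd z * snd (lin b j (0, 1))"
  by (induction j) (auto simp: algebra_simps)

lemma lin_diff: "lin b j (z - w) = lin b j z - lin b j w"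
  by (simp add: prod_eq_iff lin_expand[of b j "z - w"] lin_expand[of b j z] lin_expand[of b j w] algebra_simps)

lemma lin_basis_order:
  assumes b: "\<And>i. 1 \<le> i \<Longrightarrow> 1 \<le> b i"
  shows "0 \<le> fst (lin b j (0, 1)) \<and> fst (lin b j (0, 1)) \<le> fst (lin b j (1, 0)) \<and> 1 \<le> fst (lin b j (1, 0)) \<and>
    0 \<le> snd (lin b j (1, 0)) \<and> snd (lin b j (1, 0)) \<le> fst (lin b j (1, 0)) \<and>
    (1 \<le> j \<longrightarrow> 0 \<le> snd (lin b j (0, 1)) \<and> snd (lin b j (0, 1)) \<le> snd (lin b j (1, 0)))"
proof (induction j)
  case (Suc j)
  have b1: "1 \<le> real (b (Suc j))" using b[of "Suc j"] by simp
  show ?case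
  proof (cases "j = 0")
    case True
    thus ?thesis using b1 by auto
  next
    case False
    hence j: "1 \<le> j" by simp
    let ?b = "real (b (Suc j))" let ?Q = "fst (lin b j (1, 0))" let ?R = "fst (lin b j (0, 1))"
    have IH: "0 \<le> ?R" "?R \<le> ?Q" "1 \<le> ?Q" "0 \<le> snd (lin b j (1, 0))" "0 \<le> snd (lin b j (0, 1))"
      "snd (lin b j (0, 1)) \<le> snd (lin b j (1, 0))" using Suc j by auto
    have "?b * ?R \<le> ?b * ?Q" "1 * ?Q \<le> ?b * ?Q" "0 \<le> ?b * ?R"
      using IH b1 by (intro mult_left_mono mult_right_mono mult_nonneg_nonneg; linarith)+
    thus ?thesis using IH unfolding lin.simps fst_conv snd_conv by linarith
  qed
qed simp

text \<open>The starting vectors allowed here form a cone around the unstable direction. The lower slope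
\<open>- 1/2\<close> leaves room for the slightly negative increments of the phase caused by \<open>l > 0\<close>.\<close>

lemma lin_increment_bounds:
  assumes b: "\<And>i. 1 \<le> i \<Longrightarrow> 1 \<le> b i" and p: "0 < fst z" "- fst z / 2 \<le> snd z" "snd z \<le> 2 * fst z"
  shows "growth b j * fst z / 2 \<le> fst (lin b j z)" "fst (lin b j z) \<le> 3 * growth b j * fst z"
proof -
  define Q R where "Q = fst (lin b j (1, 0))" and "R = fst (lin b j (0, 1))"
  have QR: "0 \<le> R" "R \<le> Q" using lin_basis_order[where b = b and j = j, OF b] by (auto simp: Q_def R_def)
  have e: "fst (lin b j z) = fst z * Q + snd z * R" unfolding Q_def R_def by (rule lin_expand)
  have "(- fst z / 2) * R \<le> snd z * R" using p QR by (intro mult_right_mono) auto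
  moreover have "fst z * R \<le> fst z * Q" using p QR by (intro mult_left_mono) auto
  ultimately show "growth b j * fst z / 2 \<le> fst (lin b j z)"
    unfolding e growth_def Q_def[symmetric] by (simp add: field_simps)
  have "snd z * R \<le> (2 * fst z) * R" using p QR by (intro mult_right_mono) auto
  moreover have "(2 * fst z) * R \<le> (2 * fst z) * Q" using p QR by (intro mult_left_mono) auto
  ultimately show "fst (lin b j z) \<le> 3 * growth b j * fst z"
    unfolding e growth_def Q_def[symmetric] by (simp add: algebra_simps)
qed

lemma growth_props:
  assumes b: "\<And>i. 1 \<le> i \<Longrightarrow> 1 \<le> b i" and B: "\<And>i. 1 \<le> i \<Longrightarrow> b i \<le> B"
  shows "1 \<le> growth b j" "growth b j \<le> growth b (Suc j)" "growth b (Suc j) \<le> (real B + 1) * growth b j"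
    "2 * growth b j \<le> growth b (Suc (Suc j))" "2 ^ k \<le> growth b (2 * k)"
proof -
  note o = lin_basis_order[where b = b, OF b]
  show g1: "1 \<le> growth b j" for j using o[of j] by (simp add: growth_def)
  have b1: "1 \<le> real (b (Suc j))" "real (b (Suc j)) \<le> real B" for j using b[of "Suc j"] B[of "Suc j"] by auto
  show mono: "growth b j \<le> growth b (Suc j)" for j
  proof -
    have "1 * growth b j \<le> real (b (Suc j)) * growth b j" using b1 g1[of j] by (intro mult_right_mono) auto
    thus ?thesis using o[of j] unfolding growth_def lin.simps fst_conv by linarith
  qed
  show "growth b (Suc j) \<le> (real B + 1) * growth b j"
  proof -
    have "real (b (Suc j)) * growth b j \<le> real B * growth b j" using b1 g1[of j] by (intro mult_right_mono) auto
    thus ?thesis using o[of j] unfolding growth_def lin.simps fst_conv distrib_right by linarith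
  qed
  show two: "2 * growth b j \<le> growth b (Suc (Suc j))" for j
  proof -
    have "1 * growth b (Suc j) \<le> real (b (Suc (Suc j))) * growth b (Suc j)" using b1 g1[of "Suc j"] by (intro mult_right_mono) auto
    moreover have "growth b (Suc (Suc j)) = real (b (Suc (Suc j))) * growth b (Suc j) + growth b j" by (simp add: growth_def)
    ultimately show ?thesis using mono[of j] by linarith
  qed
  show "2 ^ k \<le> growth b (2 * k)"
  proof (induction k)
    case (Suc k)
    have "2 * growth b (2 * k) \<le> growth b (2 * Suc k)" using two[of "2 * k"] by simp
    moreover have "(2::real) ^ Suc k = 2 * 2 ^ k" by simp
    ultimately show ?case using Suc by linarith
  qed (use g1 in simp)
qed

text \<open>The first time at which the growth reaches \<open>2^k\<close>. It comes after at most \<open>2 k\<close> steps, as the growth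
doubles in two steps, and overshoots by at most the factor \<open>B + 1\<close>. Stopping by growth instead of after a fixed
number of steps makes the size of a stage independent of the partial quotients.\<close>

lemma lin_stopping_time:
  assumes b: "\<And>i. 1 \<le> i \<Longrightarrow> 1 \<le> b i" and B: "\<And>i. 1 \<le> i \<Longrightarrow> b i \<le> B" and k: "B < 2 ^ k"
  shows "\<exists>N. 2 \<le> N \<and> N \<le> 2 * k \<and> 2 ^ k \<le> growth b N \<and> (\<forall>j\<le>N. growth b j \<le> (real B + 1) * 2 ^ k)"
proof -
  note g = growth_props[where b = b and B = B, OF b B]
  define N where "N = (LEAST j. 2 ^ k \<le> growth b j)"
  have ex: "2 ^ k \<le> growth b (2 * k)" by (rule g(5))
  have N: "2 ^ k \<le> growth b N" unfolding N_def by (rule LeastI[where P = "\<lambda>j. 2 ^ k \<le> growth b j", OF ex])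
  have N2: "N \<le> 2 * k" unfolding N_def by (rule Least_le[where P = "\<lambda>j. 2 ^ k \<le> growth b j", OF ex])
  have Bk: "real B < 2 ^ k" using k by (metis of_nat_less_iff of_nat_numeral of_nat_power)
  have B1: "1 \<le> real B" using b[of 1] B[of 1] by simp
  have "growth b 0 = 1" "growth b (Suc 0) = real (b (Suc 0))" by (auto simp: growth_def)
  moreover have "real (b (Suc 0)) \<le> real B" using B[of 1] by simp
  ultimately have "growth b 0 < 2 ^ k" "growth b (Suc 0) < 2 ^ k" using Bk B1 by linarith+
  hence "N \<noteq> 0" "N \<noteq> Suc 0" using N by (metis not_le)+
  hence N3: "2 \<le> N" by linarith
  then obtain N' where N': "N = Suc N'" by (cases N) auto
  have "growth b N' < 2 ^ k" using not_less_Least[of N' "\<lambda>j. 2 ^ k \<le> growth b j"] N' N_def by auto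
  hence "(real B + 1) * growth b N' \<le> (real B + 1) * 2 ^ k" by (intro mult_left_mono) auto
  hence NB: "growth b N \<le> (real B + 1) * 2 ^ k" using g(3)[of N'] unfolding N' by linarith
  have "growth b j \<le> growth b N" if "j \<le> N" for j
  proof -
    have "incseq (growth b)" by (rule incseq_SucI) (rule g(2))
    thus ?thesis using that by (simp add: incseq_def)
  qed
  thus ?thesis using N N2 N3 NB by (intro exI[of _ N]) force
qed

text \<open>Errors are amplified by at most \<open>B + 1\<close> in each step, so over boundedly many steps they remain proportional
to the error of a single step.\<close>

lemma lin_error:
  fixes z :: "nat \<Rightarrow> real \<times> real"
  assumes B: "\<And>i. 1 \<le> i \<Longrightarrow> b i \<le> B" and \<eta>: "0 \<le> \<eta>"
    and f: "\<And>j. j < N \<Longrightarrow> \<bar>fst (z (Suc j)) - (real (b (Suc j)) * fst (z j) + snd (z j))\<bar> \<le> \<eta>"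
    and s: "\<And>j. j < N \<Longrightarrow> \<bar>snd (z (Suc j)) - fst (z j)\<bar> \<le> \<eta>"
  shows "j \<le> N \<Longrightarrow> \<bar>fst (z j) - fst (lin b j (z 0))\<bar> \<le> \<eta> * (real B + 2) ^ j \<and>
    \<bar>snd (z j) - snd (lin b j (z 0))\<bar> \<le> \<eta> * (real B + 2) ^ j"
proof (induction j)
  case (Suc j)
  define E where "E = \<eta> * (real B + 2) ^ j"
  have E: "\<bar>fst (z j) - fst (lin b j (z 0))\<bar> \<le> E" "\<bar>snd (z j) - snd (lin b j (z 0))\<bar> \<le> E"
    using Suc by (auto simp: E_def)
  have "\<eta> * 1 \<le> \<eta> * (real B + 2) ^ j" using \<eta> by (intro mult_left_mono one_le_power) auto
  hence \<eta>E: "\<eta> \<le> E" "0 \<le> E" using \<eta> by (auto simp: E_def)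
  have next_E: "\<eta> * (real B + 2) ^ Suc j = (real B + 2) * E" by (simp add: E_def)
  let ?b = "real (b (Suc j))"
  have "?b \<le> real B" using B[of "Suc j"] by simp
  hence "\<bar>?b * (fst (z j) - fst (lin b j (z 0)))\<bar> \<le> real B * E"
    unfolding abs_mult using E by (intro mult_mono) auto
  moreover have "fst (z (Suc j)) - fst (lin b (Suc j) (z 0)) =
    (fst (z (Suc j)) - (?b * fst (z j) + snd (z j))) + ?b * (fst (z j) - fst (lin b j (z 0)))
      + (snd (z j) - snd (lin b j (z 0)))" by (simp add: algebra_simps)
  ultimately have "\<bar>fst (z (Suc j)) - fst (lin b (Suc j) (z 0))\<bar> \<le> \<eta> + real B * E + E"
    using f[of j] E Suc.prems by linarith
  moreover have "\<bar>snd (z (Suc j)) - snd (lin b (Suc j) (z 0))\<bar> \<le> \<eta> + E"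
    using s[of j] E Suc.prems by auto
  moreover have "0 \<le> real B * E" using \<eta>E by simp
  ultimately show ?case unfolding next_E distrib_right using \<eta>E by linarith
qed (use \<eta> in simp)

text \<open>The version for increments, where the error of a step is relative. A crude a priori bound for the growth of
the increments turns it into an absolute error to which \<open>lin_error\<close> applies.\<close>

lemma pair_growth:
  fixes d :: "nat \<Rightarrow> real \<times> real"
  assumes B: "\<And>i. 1 \<le> i \<Longrightarrow> b i \<le> B" and \<delta>: "0 \<le> \<delta>" "\<delta> \<le> 1"
    and f: "\<And>j. j < N \<Longrightarrow> \<bar>fst (d (Suc j)) - (real (b (Suc j)) * fst (d j) + snd (d j))\<bar>
        \<le> \<delta> * (\<bar>real (b (Suc j)) * fst (d j) + snd (d j)\<bar> + \<bar>fst (d j)\<bar>)"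
    and s: "\<And>j. j < N \<Longrightarrow> \<bar>snd (d (Suc j)) - fst (d j)\<bar> \<le> \<delta> * (\<bar>fst (d j)\<bar> + \<bar>fst (d (Suc j))\<bar>)"
    and S: "\<bar>fst (d 0)\<bar> \<le> S" "\<bar>snd (d 0)\<bar> \<le> S"
    and j: "j \<le> N"
  shows "\<bar>fst (d j) - fst (lin b j (d 0))\<bar> \<le> \<delta> * (2 * real B + 5) ^ (2 * N + 1) * S"
    "\<bar>snd (d j) - snd (lin b j (d 0))\<bar> \<le> \<delta> * (2 * real B + 5) ^ (2 * N + 1) * S"
proof -
  define C where "C = 2 * real B + 5"
  have S0: "0 \<le> S" using S by linarith
  have C: "1 \<le> C" by (simp add: C_def)
  have step: "\<bar>fst (d (Suc j))\<bar> \<le> C * T \<and> \<bar>snd (d (Suc j))\<bar> \<le> C * T \<and>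
      \<bar>fst (d (Suc j)) - (real (b (Suc j)) * fst (d j) + snd (d j))\<bar> \<le> \<delta> * (C * T) \<and>
      \<bar>snd (d (Suc j)) - fst (d j)\<bar> \<le> \<delta> * (C * T)"
    if j: "j < N" and T: "\<bar>fst (d j)\<bar> \<le> T" "\<bar>snd (d j)\<bar> \<le> T" for j T
  proof -
    have T0: "0 \<le> T" using T by linarith
    have CT: "C * T = 2 * (real B * T) + 5 * T" by (simp add: C_def algebra_simps)
    have BT: "0 \<le> real B * T" using T0 by simp
    let ?c = "real (b (Suc j)) * fst (d j) + snd (d j)"
    have "\<bar>real (b (Suc j)) * fst (d j)\<bar> \<le> real B * T"
      unfolding abs_mult using T B[of "Suc j"] by (intro mult_mono) auto
    hence c: "\<bar>?c\<bar> \<le> real B * T + T" using T by linarith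
    have le1: "\<delta> * x \<le> x" if "0 \<le> x" for x using \<delta> that by (simp add: mult_left_le_one_le)
    have e1: "\<bar>fst (d (Suc j)) - ?c\<bar> \<le> \<delta> * (real B * T + 2 * T)"
    proof -
      have "\<bar>?c\<bar> + \<bar>fst (d j)\<bar> \<le> real B * T + 2 * T" using c T by linarith
      hence "\<delta> * (\<bar>?c\<bar> + \<bar>fst (d j)\<bar>) \<le> \<delta> * (real B * T + 2 * T)" using \<delta> by (intro mult_left_mono) auto
      thus ?thesis using f[OF j] by linarith
    qed
    hence e1': "\<bar>fst (d (Suc j)) - ?c\<bar> \<le> real B * T + 2 * T"
      using le1[of "real B * T + 2 * T"] BT T0 by linarith
    hence f1: "\<bar>fst (d (Suc j))\<bar> \<le> 2 * (real B * T) + 3 * T" using c by linarith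
    have e2: "\<bar>snd (d (Suc j)) - fst (d j)\<bar> \<le> \<delta> * (2 * (real B * T) + 4 * T)"
    proof -
      have "\<bar>fst (d j)\<bar> + \<bar>fst (d (Suc j))\<bar> \<le> 2 * (real B * T) + 4 * T" using f1 T by linarith
      hence "\<delta> * (\<bar>fst (d j)\<bar> + \<bar>fst (d (Suc j))\<bar>) \<le> \<delta> * (2 * (real B * T) + 4 * T)"
        using \<delta> by (intro mult_left_mono) auto
      thus ?thesis using s[OF j] by linarith
    qed
    hence e2': "\<bar>snd (d (Suc j)) - fst (d j)\<bar> \<le> 2 * (real B * T) + 4 * T"
      using le1[of "2 * (real B * T) + 4 * T"] BT T0 by linarith
    have "\<delta> * (real B * T + 2 * T) \<le> \<delta> * (C * T)" "\<delta> * (2 * (real B * T) + 4 * T) \<le> \<delta> * (C * T)"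
      unfolding CT using \<delta> BT T0 by (intro mult_left_mono; linarith)+
    thus ?thesis using e1 e2 f1 e2' T BT T0 unfolding CT by linarith
  qed
  have size: "\<bar>fst (d j)\<bar> \<le> C ^ j * S \<and> \<bar>snd (d j)\<bar> \<le> C ^ j * S" if "j \<le> N" for j
    using that
  proof (induction j)
    case (Suc j)
    thus ?case using step[of j "C ^ j * S"] by (simp add: mult.assoc)
  qed (use S in simp)
  define \<eta> where "\<eta> = \<delta> * (C * (C ^ N * S))"
  have \<eta>: "0 \<le> \<eta>" using \<delta> C S0 by (simp add: \<eta>_def)
  have up: "\<delta> * (C * (C ^ j * S)) \<le> \<eta>" if "j < N" for j
    unfolding \<eta>_def using that C S0 \<delta> by (intro mult_left_mono mult_right_mono power_increasing) auto
  have f': "\<bar>fst (d (Suc j)) - (real (b (Suc j)) * fst (d j) + snd (d j))\<bar> \<le> \<eta>"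
    and s': "\<bar>snd (d (Suc j)) - fst (d j)\<bar> \<le> \<eta>" if "j < N" for j
    using step[of j "C ^ j * S"] size[of j] up[OF that] that by auto
  note e = lin_error[of b B \<eta> N d j, OF B \<eta> f' s' j]
  have "(real B + 2) ^ j \<le> C ^ N"
  proof -
    have "(real B + 2) ^ j \<le> C ^ j" by (intro power_mono) (auto simp: C_def)
    also have "\<dots> \<le> C ^ N" using C j by (intro power_increasing) auto
    finally show ?thesis .
  qed
  hence "\<eta> * (real B + 2) ^ j \<le> \<eta> * C ^ N" using \<eta> by (intro mult_left_mono) auto
  also have "\<dots> = \<delta> * C ^ (2 * N + 1) * S" by (simp add: \<eta>_def power_add mult_2)
  finally show "\<bar>fst (d j) - fst (lin b j (d 0))\<bar> \<le> \<delta> * (2 * real B + 5) ^ (2 * N + 1) * S"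
    "\<bar>snd (d j) - snd (lin b j (d 0))\<bar> \<le> \<delta> * (2 * real B + 5) ^ (2 * N + 1) * S"
    using e by (auto simp: C_def)
qed

lemma away_perturb:
  assumes "away (\<kappa> + e) x" "\<bar>y - x\<bar> \<le> e" "0 < \<kappa>" "0 \<le> e"
  shows "away \<kappa> y" "cell y = cell x"
proof -
  show c: "cell y = cell x" by (rule cell_unique) (use assms in \<open>auto simp: away_def\<close>)
  show "away \<kappa> y" unfolding away_def c using assms by (auto simp: away_def)
qed

lemma away_iff:
  assumes "0 < \<kappa>"
  shows "away \<kappa> x \<longleftrightarrow> (\<forall>k::int. \<kappa> \<le> \<bar>x - pi * k\<bar>)"
proof
  assume a: "away \<kappa> x"
  show "\<forall>k::int. \<kappa> \<le> \<bar>x - pi * k\<bar>"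
  proof
    fix k :: int
    show "\<kappa> \<le> \<bar>x - pi * k\<bar>"
    proof (cases "k \<le> cell x")
      case True
      hence "pi * k \<le> pi * cell x" by (intro mult_left_mono) auto
      hence "\<kappa> \<le> x - pi * k" using a unfolding away_def by linarith
      thus ?thesis by linarith
    next
      case False
      hence "pi * (cell x + 1) \<le> pi * k" by (intro mult_left_mono) auto
      hence "pi * cell x + pi \<le> pi * k" by (simp only: distrib_left of_int_add of_int_1 mult_1_right)
      hence "\<kappa> \<le> pi * k - x" using a unfolding away_def by linarith
      thus ?thesis by linarith
    qed
  qed
next
  assume a: "\<forall>k::int. \<kappa> \<le> \<bar>x - pi * k\<bar>"
  show "away \<kappa> x" using cell_bounds[of x] a[rule_format, of "cell x"] a[rule_format, of "cell x + 1"]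
    by (auto simp: away_def algebra_simps)
qed

lemma cell_constant:
  fixes f :: "real \<Rightarrow> real"
  assumes c: "continuous_on {s..w} f" and ne: "\<And>t k. t \<in> {s..w} \<Longrightarrow> f t \<noteq> pi * of_int k"
    and t: "t \<in> {s..w}" "t' \<in> {s..w}"
  shows "cell (f t) = cell (f t')"
proof -
  have no: False if lt: "cell (f t) < cell (f t')" and t: "t \<in> {s..w}" "t' \<in> {s..w}" for t t'
  proof -
    have "connected (f ` {s..w})" using c by (intro connected_continuous_image) auto
    moreover have "f t \<le> pi * cell (f t')"
    proof -
      have "f t / pi < real_of_int (cell (f t'))" using lt by linarith
      thus ?thesis by (simp add: field_simps)
    qed
    moreover have "pi * cell (f t') \<le> f t'" by (rule cell_bounds)
    ultimately have "pi * cell (f t') \<in> f ` {s..w}"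
      using connectedD_interval[of "f ` {s..w}" "f t" "f t'" "pi * cell (f t')"] t by blast
    then obtain \<tau> where "\<tau> \<in> {s..w}" "pi * cell (f t') = f \<tau>" by blast
    thus False using ne[of \<tau> "cell (f t')"] by simp
  qed
  show ?thesis using no[of t t'] no[of t' t] t by (cases "cell (f t)" "cell (f t')" rule: linorder_cases) auto
qed

lemma continuous_on_dominated:
  fixes f g :: "real \<Rightarrow> real"
  assumes f: "continuous_on S f" and K: "0 < K"
    and d: "\<And>x y. x \<in> S \<Longrightarrow> y \<in> S \<Longrightarrow> \<bar>g x - g y\<bar> \<le> K * \<bar>f x - f y\<bar>"
  shows "continuous_on S g"
  unfolding continuous_on_iff
proof (intro ballI allI impI)
  fix x e :: real assume x: "x \<in> S" and e: "0 < e"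
  hence "0 < e / K" using K by simp
  then obtain r where r: "0 < r" "\<And>y. y \<in> S \<Longrightarrow> dist y x < r \<Longrightarrow> dist (f y) (f x) < e / K"
    using f x unfolding continuous_on_iff by metis
  show "\<exists>r>0. \<forall>y\<in>S. dist y x < r \<longrightarrow> dist (g y) (g x) < e"
  proof (intro exI[of _ r] conjI ballI impI)
    fix y assume y: "y \<in> S" "dist y x < r"
    have "K * \<bar>f y - f x\<bar> < e" using r(2)[OF y] K by (simp add: dist_real_def field_simps)
    thus "dist (g y) (g x) < e" using d[OF y(1) x] by (simp add: dist_real_def)
  qed (use r in simp)
qed

lemma increasing_enumeration:
  fixes A :: "nat set"
  assumes "finite A" "m \<le> card A"
  shows "\<exists>e. (\<forall>i<m. e i \<in> A) \<and> (\<forall>i j. i < j \<longrightarrow> j < m \<longrightarrow> e i < (e j :: nat))"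
proof (intro exI[of _ "\<lambda>i. sorted_list_of_set A ! i"] conjI allI impI)
  have len: "length (sorted_list_of_set A) = card A" by simp
  show "sorted_list_of_set A ! i \<in> A" if "i < m" for i
  proof -
    have "sorted_list_of_set A ! i \<in> set (sorted_list_of_set A)"
      by (rule nth_mem) (use that assms in simp)
    thus ?thesis using assms by simp
  qed
  show "sorted_list_of_set A ! i < sorted_list_of_set A ! j" if "i < j" "j < m" for i j
    using sorted_wrt_nth_less[OF strict_sorted_list_of_set that(1), of A] that(2) assms by simp
qed

section \<open>Orbits in angle coordinates and the branching of surviving intervals\<close>

text \<open>The starting point with angle \<open>t\<close> has third coordinate \<open>1\<close>, which fixes the initial phase: \<open>A cos \<psi> = 1\<close> and
\<open>A sin \<psi> = l / (2 sin t)\<close>.\<close>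

fun orbit :: "real \<Rightarrow> (nat \<Rightarrow> nat) \<Rightarrow> nat \<Rightarrow> real \<Rightarrow> real \<times> real" where
  "orbit l a 0 t = (t, arctan (l / (2 * sin t)))"
| "orbit l a (Suc n) t = angle_step l (a (Suc n)) (orbit l a n t)"

lemma card_le_2_if_adjacent:
  fixes A :: "nat set"
  assumes "finite A" "\<And>i j. i \<in> A \<Longrightarrow> j \<in> A \<Longrightarrow> i < j \<Longrightarrow> j \<le> Suc i"
  shows "card A \<le> 2"
proof (cases "A = {}")
  case False
  have "A \<subseteq> {Min A, Suc (Min A)}"
  proof
    fix j assume j: "j \<in> A"
    have "Min A \<le> j" "Min A \<in> A" using assms j False by auto
    thus "j \<in> {Min A, Suc (Min A)}" using assms(2)[of "Min A" j] j by (cases "j = Min A") auto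
  qed
  hence "card A \<le> card {Min A, Suc (Min A)}" by (intro card_mono) auto
  thus ?thesis by simp
qed simp

text \<open>The parameters of a stage. The exponent \<open>e\<close> measures its length; \<open>\<kappa>\<close> is the length
of a piece divided by \<open>8\<close>, so that the neighbourhood of a point of \<open>\<pi> \<int>\<close> is narrower than a piece; \<open>\<delta>\<close> is
so small that the errors accumulated during the at most \<open>2 e\<close> steps of a stage stay below \<open>\<kappa> / 16\<close> in value and below
\<open>1/8\<close> relatively in increments.\<close>

locale orbit_chart = angle_chart l \<kappa> \<delta> for l \<kappa> \<delta> :: real +
  fixes a :: "nat \<Rightarrow> nat" and B e :: nat
  assumes a1: "\<And>k. 1 \<le> k \<Longrightarrow> 1 \<le> a k" and aB: "\<And>k. 1 \<le> k \<Longrightarrow> a k \<le> B"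
    and e: "3 \<le> e" "B < 2 ^ e" "4 * e \<le> 2 ^ (e - 3)"
    and \<kappa>_eq: "\<kappa> = 1 / (3 * (real B + 1) * 2 ^ e) / (8 * 2 ^ (e - 2))"
    and \<delta>_small: "16 * \<delta> * (2 * real B + 5) ^ (4 * e + 1) \<le> \<kappa>"
begin

definition "ell = 1 / (3 * (real B + 1) * 2 ^ e)"
definition "parts = (2::nat) ^ (e - 2)"
definition "kids = (2::nat) ^ (e - 3)"
definition "stretch = 4 * (real B + 1) * 2 ^ e"

abbreviation "th n t \<equiv> fst (orbit l a n t)"
abbreviation "ps n t \<equiv> snd (orbit l a n t)"
abbreviation "shift n \<equiv> (\<lambda>i. a (n + i))"
abbreviation "model n j t \<equiv> fst (lin (shift n) j (orbit l a n t))"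

lemma constants: "0 < ell" "ell \<le> 1" "0 < real parts" "parts = 2 * kids" "0 < kids" "(2::real) ^ e = 4 * real parts"
  "\<kappa> = ell / (8 * real parts)" "\<kappa> \<le> 1" "0 < stretch"
proof -
  show "0 < ell" "0 < real parts" "0 < kids" "0 < stretch" by (auto simp: ell_def parts_def kids_def stretch_def)
  have "1 * 1 \<le> 3 * (real B + 1) * 2 ^ e" by (intro mult_mono one_le_power) auto
  thus l1: "ell \<le> 1" by (simp add: ell_def)
  have "e - 2 = Suc (e - 3)" using e by simp
  thus "parts = 2 * kids" by (simp add: parts_def kids_def)
  have "e = Suc (Suc (e - 2))" using e by simp
  thus "(2::real) ^ e = 4 * real parts" unfolding parts_def by (metis (no_types, opaque_lifting) mult.assoc numeral_Bit0_eq_double of_nat_numeral of_nat_power power_Suc mult_2 numeral_Bit0 one_add_one)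
  show k: "\<kappa> = ell / (8 * real parts)" unfolding \<kappa>_eq by (simp add: ell_def parts_def)
  have "1 \<le> real parts" by (simp add: parts_def)
  hence "ell / (8 * real parts) \<le> 1 / 1" using l1 \<open>0 < ell\<close> by (intro frac_le) auto
  thus "\<kappa> \<le> 1" using k by simp
qed

lemma shift_bounds: "1 \<le> i \<Longrightarrow> 1 \<le> shift n i" "1 \<le> i \<Longrightarrow> shift n i \<le> B"
  using a1 aB by auto

lemma \<delta>_bounds:
  assumes "j \<le> 2 * e"
  shows "\<delta> * (real B + 2) ^ j \<le> \<kappa> / 16" "\<delta> * (2 * real B + 5) ^ (2 * j + 1) \<le> 1 / 16" "\<delta> \<le> 1"
proof -
  have "(real B + 2) ^ j \<le> (2 * real B + 5) ^ j" by (intro power_mono) auto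
  also have "\<dots> \<le> (2 * real B + 5) ^ (4 * e + 1)" using assms by (intro power_increasing) auto
  finally have "\<delta> * (real B + 2) ^ j \<le> \<delta> * (2 * real B + 5) ^ (4 * e + 1)"
    using \<delta> by (intro mult_left_mono) auto
  thus "\<delta> * (real B + 2) ^ j \<le> \<kappa> / 16" using \<delta>_small by simp
  have "(2 * real B + 5) ^ (2 * j + 1) \<le> (2 * real B + 5) ^ (4 * e + 1)" using assms by (intro power_increasing) auto
  hence "\<delta> * (2 * real B + 5) ^ (2 * j + 1) \<le> \<delta> * (2 * real B + 5) ^ (4 * e + 1)"
    using \<delta> by (intro mult_left_mono) auto
  thus "\<delta> * (2 * real B + 5) ^ (2 * j + 1) \<le> 1 / 16" using \<delta>_small constants(8) by simp
  have "\<delta> * 1 \<le> \<delta> * (2 * real B + 5) ^ (4 * e + 1)" using \<delta> by (intro mult_left_mono one_le_power) auto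
  thus "\<delta> \<le> 1" using \<delta>_small constants(8) \<delta> unfolding mult.assoc by linarith
qed

text \<open>By induction over the steps, the true angle stays within a fraction of \<open>\<kappa>\<close> of the model angle, hence
keeps distance \<open>\<kappa>\<close> from \<open>\<pi> \<int>\<close> if the model keeps distance \<open>2 \<kappa>\<close>. This justifies the next step.\<close>

lemma point_survives:
  assumes start: "away \<kappa> (th n t)" and N: "N \<le> 2 * e"
    and far: "\<And>j. 1 \<le> j \<Longrightarrow> j \<le> N \<Longrightarrow> away (2 * \<kappa>) (model n j t)"
  shows "j \<le> N \<Longrightarrow> (\<forall>i\<le>j. away \<kappa> (th (n + i) t) \<and> (1 \<le> i \<longrightarrow> cell (th (n + i) t) = cell (model n i t))) \<and>
    (\<forall>i<j. away \<kappa> (chi (shift n (Suc i)) (orbit l a (n + i) t)) \<and>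
       cell (chi (shift n (Suc i)) (orbit l a (n + i) t)) = cell (model n (Suc i) t))"
proof (induction j)
  case 0
  thus ?case using start by simp
next
  case (Suc j)
  hence j: "j < N" and IH1: "\<And>i. i \<le> j \<Longrightarrow> away \<kappa> (th (n + i) t)"
    and IH2: "\<And>i. i < j \<Longrightarrow> away \<kappa> (chi (shift n (Suc i)) (orbit l a (n + i) t))"
    and IH: "\<And>i. i \<le> j \<Longrightarrow> 1 \<le> i \<longrightarrow> cell (th (n + i) t) = cell (model n i t)"
      "\<And>i. i < j \<Longrightarrow> cell (chi (shift n (Suc i)) (orbit l a (n + i) t)) = cell (model n (Suc i) t)" by auto
  have nxt: "orbit l a (n + Suc i) t = angle_step l (shift n (Suc i)) (orbit l a (n + i) t)" for i by simp
  have err: "\<bar>fst (orbit l a (n + j) t) - fst (lin (shift n) j (orbit l a (n + 0) t))\<bar> \<le> \<delta> * (real B + 2) ^ j \<and>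
    \<bar>snd (orbit l a (n + j) t) - snd (lin (shift n) j (orbit l a (n + 0) t))\<bar> \<le> \<delta> * (real B + 2) ^ j"
  proof (rule lin_error[where z = "\<lambda>i. orbit l a (n + i) t" and N = j and b = "shift n"])
    fix i assume i: "i < j"
    have aw: "away \<kappa> (th (n + i) t)" "away \<kappa> (th (n + Suc i) t)" using IH1[of i] IH1[of "Suc i"] i by auto
    note v = angle_step_value[OF aw(1) IH2[OF i]]
    show "\<bar>fst (orbit l a (n + Suc i) t) - (real (shift n (Suc i)) * fst (orbit l a (n + i) t) + snd (orbit l a (n + i) t))\<bar> \<le> \<delta>"
      using v(1) unfolding chi_def by simp
    show "\<bar>snd (orbit l a (n + Suc i) t) - fst (orbit l a (n + i) t)\<bar> \<le> \<delta>"
      using v(3) aw(2) by simp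
  qed (use shift_bounds \<delta> in auto)
  define E where "E = \<delta> * (real B + 2) ^ j"
  define \<omega> where "\<omega> = chi (shift n (Suc j)) (orbit l a (n + j) t)"
  let ?b = "real (shift n (Suc j))"
  have E: "0 \<le> E" using \<delta> by (simp add: E_def)
  have x: "\<omega> - model n (Suc j) t = ?b * (th (n + j) t - model n j t) + (ps (n + j) t - snd (lin (shift n) j (orbit l a n t)))"
    by (simp add: \<omega>_def chi_def algebra_simps)
  have "\<bar>?b * (th (n + j) t - model n j t)\<bar> \<le> real B * E"
    unfolding abs_mult using err shift_bounds(2)[of "Suc j" n] by (intro mult_mono) (auto simp: E_def)
  hence "\<bar>\<omega> - model n (Suc j) t\<bar> \<le> real B * E + E"
    unfolding x using err by (intro order_trans[OF abs_triangle_ineq add_mono]) (auto simp: E_def)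
  also have "\<dots> \<le> \<delta> * (real B + 2) ^ Suc j" using E by (simp add: E_def algebra_simps)
  also have "\<dots> \<le> \<kappa> / 16" by (rule \<delta>_bounds) (use j N in simp)
  finally have \<omega>err: "\<bar>\<omega> - model n (Suc j) t\<bar> \<le> \<kappa> / 16" .
  have aw2: "away (\<kappa> + \<kappa>) (model n (Suc j) t)" using far[of "Suc j"] j by simp
  have \<omega>: "away \<kappa> \<omega>" "cell \<omega> = cell (model n (Suc j) t)"
    using away_perturb[OF aw2, of \<omega>] \<omega>err \<kappa> by auto
  have v: "\<bar>th (n + Suc j) t - \<omega>\<bar> \<le> \<delta>"
    unfolding nxt \<omega>_def by (rule angle_step_value) (use IH1[of j] \<omega> in \<open>auto simp: \<omega>_def\<close>)
  have "\<delta> \<le> \<kappa> / 16" using \<delta>_bounds(1)[of 0] by simp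
  hence "\<bar>th (n + Suc j) t - model n (Suc j) t\<bar> \<le> \<kappa>" using v \<omega>err \<kappa> by linarith
  hence th: "away \<kappa> (th (n + Suc j) t)" "cell (th (n + Suc j) t) = cell (model n (Suc j) t)"
    using away_perturb[OF aw2, of "th (n + Suc j) t"] \<kappa> by auto
  show ?case
    using IH1 IH2 IH th \<omega> unfolding \<omega>_def less_Suc_eq le_Suc_eq by blast
qed

text \<open>Two surviving points that are never separated by a point of \<open>\<pi> \<int>\<close> have increments that follow the
linear model up to a small fraction of the initial increment.\<close>

lemma pair_survives:
  assumes N: "N \<le> 2 * e" and start: "away \<kappa> (th n t)" "away \<kappa> (th n t')"
    and far: "\<And>j. 1 \<le> j \<Longrightarrow> j \<le> N \<Longrightarrow> away (2 * \<kappa>) (model n j t)" "\<And>j. 1 \<le> j \<Longrightarrow> j \<le> N \<Longrightarrow> away (2 * \<kappa>) (model n j t')"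
    and cell0: "cell (th n t) = cell (th n t')"
    and cell: "\<And>j. 1 \<le> j \<Longrightarrow> j \<le> N \<Longrightarrow> cell (model n j t) = cell (model n j t')"
    and p: "0 < th n t' - th n t" "\<bar>ps n t' - ps n t\<bar> \<le> 2 * (th n t' - th n t)"
    and j: "j \<le> N"
  shows "\<bar>(th (n + j) t' - th (n + j) t) - (model n j t' - model n j t)\<bar> \<le> (th n t' - th n t) / 8"
    "\<bar>(ps (n + j) t' - ps (n + j) t) - (snd (lin (shift n) j (orbit l a n t')) - snd (lin (shift n) j (orbit l a n t)))\<bar>
      \<le> (th n t' - th n t) / 8"
proof -
  define d where "d i = orbit l a (n + i) t' - orbit l a (n + i) t" for i
  define S where "S = 2 * (th n t' - th n t)"
  note A = point_survives[OF start(1) N far(1), of N, simplified] and A' = point_survives[OF start(2) N far(2), of N, simplified]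
  have th: "away \<kappa> (th (n + i) t)" "away \<kappa> (th (n + i) t')" if "i \<le> N" for i using A A' that by auto
  have ch: "away \<kappa> (chi (shift n (Suc i)) (orbit l a (n + i) t))" "away \<kappa> (chi (shift n (Suc i)) (orbit l a (n + i) t'))"
    "cell (chi (shift n (Suc i)) (orbit l a (n + i) t')) = cell (chi (shift n (Suc i)) (orbit l a (n + i) t))" if "i < N" for i
    using A A' that cell[of "Suc i"] by auto
  have cl: "cell (th (n + i) t') = cell (th (n + i) t)" if "i \<le> N" for i
  proof (cases "i = 0")
    case False
    thus ?thesis using A A' that cell[of i] by (auto simp: Suc_le_eq)
  qed (use cell0 in simp)
  have nxt: "orbit l a (n + Suc i) t = angle_step l (shift n (Suc i)) (orbit l a (n + i) t)" for i t by simp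
  have inc1: "\<bar>fst (d (Suc i)) - (real (shift n (Suc i)) * fst (d i) + snd (d i))\<bar>
      \<le> \<delta> * (\<bar>real (shift n (Suc i)) * fst (d i) + snd (d i)\<bar> + \<bar>fst (d i)\<bar>)"
    and inc2: "\<bar>snd (d (Suc i)) - fst (d i)\<bar> \<le> \<delta> * (\<bar>fst (d i)\<bar> + \<bar>fst (d (Suc i))\<bar>)" if i: "i < N" for i
  proof -
    have n1: "away \<kappa> (fst (angle_step l (shift n (Suc i)) (orbit l a (n + i) t)))"
      "away \<kappa> (fst (angle_step l (shift n (Suc i)) (orbit l a (n + i) t')))"
      using th[of "Suc i"] i by auto
    have le: "i \<le> N" using i by simp
    note v = angle_step_increment[OF th(2)[OF le] ch(2)[OF i] n1(2) th(1)[OF le] ch(1)[OF i] n1(1) cl[OF le] ch(3)[OF i], folded nxt]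
    have c: "chi (shift n (Suc i)) (orbit l a (n + i) t') - chi (shift n (Suc i)) (orbit l a (n + i) t)
       = real (shift n (Suc i)) * fst (d i) + snd (d i)" by (simp add: chi_def d_def algebra_simps)
    show "\<bar>fst (d (Suc i)) - (real (shift n (Suc i)) * fst (d i) + snd (d i))\<bar>
      \<le> \<delta> * (\<bar>real (shift n (Suc i)) * fst (d i) + snd (d i)\<bar> + \<bar>fst (d i)\<bar>)"
      using v(1) unfolding c by (simp only: d_def fst_diff)
    show "\<bar>snd (d (Suc i)) - fst (d i)\<bar> \<le> \<delta> * (\<bar>fst (d i)\<bar> + \<bar>fst (d (Suc i))\<bar>)"
      using v(2) by (simp only: d_def fst_diff snd_diff)
  qed
  have S: "\<bar>fst (d 0)\<bar> \<le> S" "\<bar>snd (d 0)\<bar> \<le> S" using p by (auto simp: S_def d_def)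
  have \<delta>': "0 \<le> \<delta>" "\<delta> \<le> 1" using \<delta> \<delta>_bounds(3)[of 0] by auto
  note g = pair_growth[where b = "shift n" and B = B and d = d, OF shift_bounds(2) \<delta>' inc1 inc2 S j]
  have "\<delta> * (2 * real B + 5) ^ (2 * N + 1) * S \<le> 1 / 16 * S"
    using \<delta>_bounds(2)[OF N] S by (intro mult_right_mono) auto
  hence up: "\<delta> * (2 * real B + 5) ^ (2 * N + 1) * S \<le> (th n t' - th n t) / 8" by (simp add: S_def)
  have l0: "lin (shift n) j (d 0) = lin (shift n) j (orbit l a n t') - lin (shift n) j (orbit l a n t)"
    by (simp add: d_def lin_diff)
  show "\<bar>(th (n + j) t' - th (n + j) t) - (model n j t' - model n j t)\<bar> \<le> (th n t' - th n t) / 8"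
    using order_trans[OF g(1) up] unfolding l0 by (simp only: d_def fst_diff)
  show "\<bar>(ps (n + j) t' - ps (n + j) t) - (snd (lin (shift n) j (orbit l a n t')) - snd (lin (shift n) j (orbit l a n t)))\<bar>
      \<le> (th n t' - th n t) / 8"
    using order_trans[OF g(2) up] unfolding l0 by (simp only: d_def snd_diff)
qed

end

context orbit_chart begin

text \<open>The intervals of the tree: the orbit is controlled up to time \<open>n\<close>, the angle at time \<open>n\<close>
increases by exactly \<open>ell\<close> within one cell, and increments lie in the cone of \<open>lin_increment_bounds\<close>.\<close>

definition stage :: "nat \<Rightarrow> real \<Rightarrow> real \<Rightarrow> bool" where
  "stage n u v \<longleftrightarrow> u < v \<and> (\<forall>t\<in>{u..v}. \<forall>j\<le>n. away \<kappa> (th j t)) \<and>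
     (\<forall>t\<in>{u..v}. \<forall>j<n. away \<kappa> (chi (a (Suc j)) (orbit l a j t))) \<and>
     (\<forall>t\<in>{u..v}. \<forall>t'\<in>{u..v}. cell (th n t) = cell (th n t')) \<and>
     (\<forall>t\<in>{u..v}. \<forall>t'\<in>{u..v}. t < t' \<longrightarrow> 0 < th n t' - th n t \<and>
        - (th n t' - th n t) / 2 \<le> ps n t' - ps n t \<and> ps n t' - ps n t \<le> 2 * (th n t' - th n t)) \<and>
     continuous_on {u..v} (th n) \<and> th n v - th n u = ell"

lemma stageD:
  assumes "stage n u v"
  shows "u < v" "\<And>t j. t \<in> {u..v} \<Longrightarrow> j \<le> n \<Longrightarrow> away \<kappa> (th j t)"
    "\<And>t t'. t \<in> {u..v} \<Longrightarrow> t' \<in> {u..v} \<Longrightarrow> cell (th n t) = cell (th n t')"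
    "\<And>t t'. t \<in> {u..v} \<Longrightarrow> t' \<in> {u..v} \<Longrightarrow> t < t' \<Longrightarrow> 0 < th n t' - th n t"
    "\<And>t t'. t \<in> {u..v} \<Longrightarrow> t' \<in> {u..v} \<Longrightarrow> t < t' \<Longrightarrow> - (th n t' - th n t) / 2 \<le> ps n t' - ps n t"
    "\<And>t t'. t \<in> {u..v} \<Longrightarrow> t' \<in> {u..v} \<Longrightarrow> t < t' \<Longrightarrow> ps n t' - ps n t \<le> 2 * (th n t' - th n t)"
    "continuous_on {u..v} (th n)" "th n v - th n u = ell"
    "\<And>t j. t \<in> {u..v} \<Longrightarrow> j < n \<Longrightarrow> away \<kappa> (chi (a (Suc j)) (orbit l a j t))"
  using assms unfolding stage_def by blast+

lemma model_increment:
  assumes st: "stage n u v" and t: "t \<in> {u..v}" "t' \<in> {u..v}" "t < t'"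
  shows "growth (shift n) j * (th n t' - th n t) / 2 \<le> model n j t' - model n j t"
    "model n j t' - model n j t \<le> 3 * growth (shift n) j * (th n t' - th n t)"
proof -
  define z where "z = orbit l a n t' - orbit l a n t"
  have z: "0 < fst z" "- fst z / 2 \<le> snd z" "snd z \<le> 2 * fst z"
    using stageD(4,5,6)[OF st t] by (auto simp: z_def)
  have m: "fst (lin (shift n) j z) = model n j t' - model n j t" by (simp add: z_def lin_diff)
  show "growth (shift n) j * (th n t' - th n t) / 2 \<le> model n j t' - model n j t"
    "model n j t' - model n j t \<le> 3 * growth (shift n) j * (th n t' - th n t)"
    using lin_increment_bounds[of "shift n" z j, OF shift_bounds(1) z] unfolding m by (simp_all add: z_def)
qed

lemma model_continuous:
  assumes st: "stage n u v"
  shows "continuous_on {u..v} (\<lambda>t. model n j t)"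
proof -
  have ps: "continuous_on {u..v} (ps n)"
  proof (rule continuous_on_dominated[OF stageD(7)[OF st], of 2])
    fix x y assume xy: "x \<in> {u..v}" "y \<in> {u..v}"
    have le: "\<bar>ps n x - ps n y\<bar> \<le> 2 * \<bar>th n x - th n y\<bar>" if "x \<in> {u..v}" "y \<in> {u..v}" "x < y" for x y
    proof -
      note d = stageD(4,5,6)[OF st that]
      have "ps n x - ps n y \<le> 2 * (th n y - th n x)" "ps n y - ps n x \<le> 2 * (th n y - th n x)" using d by argo+
      moreover have "\<bar>th n x - th n y\<bar> = th n y - th n x" using d by simp
      ultimately show ?thesis by simp
    qed
    show "\<bar>ps n x - ps n y\<bar> \<le> 2 * \<bar>th n x - th n y\<bar>"
      using le[OF xy] le[OF xy(2,1)] by (cases x y rule: linorder_cases) (auto simp: abs_minus_commute)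
  qed simp
  have e: "(\<lambda>t. model n j t) = (\<lambda>t. th n t * fst (lin (shift n) j (1, 0)) + ps n t * fst (lin (shift n) j (0, 1)))"
    by (rule ext) (rule lin_expand)
  show ?thesis unfolding e by (intro continuous_intros ps stageD(7)[OF st])
qed

text \<open>A piece that avoids the neighbourhoods of \<open>\<pi> \<int>\<close> in the model is expanded by at least
\<open>2^e / 2 - 1/8\<close>, and since it has length \<open>ell / parts\<close> with \<open>2^e = 4 parts\<close>, its image has length at least
\<open>ell\<close>. Cutting it down to length exactly \<open>ell\<close> gives an interval of the next stage. The cone condition
holds again because increments of the model angle do not decrease from one step to the next, so the phase
increment, which is close to the previous angle increment, is at most the angle increment up to small errors.\<close>

lemma piece_survives:
  assumes st: "stage n u v" and sw: "u \<le> s" "s < w" "w \<le> v"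
    and N: "2 \<le> N" "N \<le> 2 * e" "2 ^ e \<le> growth (shift n) N" "growth (shift n) N \<le> (real B + 1) * 2 ^ e"
    and far: "\<And>t j k. t \<in> {s..w} \<Longrightarrow> 1 \<le> j \<Longrightarrow> j \<le> N \<Longrightarrow> 2 * \<kappa> \<le> \<bar>model n j t - pi * of_int k\<bar>"
    and len: "th n w - th n s = ell / real parts"
  shows "\<exists>v'. s < v' \<and> v' \<le> w \<and> stage (n + N) s v' \<and>
    (\<forall>t\<in>{s..v'}. \<forall>t'\<in>{s..v'}. t < t' \<longrightarrow> th (n + N) t' - th (n + N) t \<le> stretch * (th n t' - th n t))"
proof -
  have sub: "t \<in> {u..v}" if "t \<in> {s..w}" for t using that sw by auto
  have k2: "0 < 2 * \<kappa>" using \<kappa> by simp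
  have aw2: "away (2 * \<kappa>) (model n j t)" if "t \<in> {s..w}" "1 \<le> j" "j \<le> N" for t j
    using far[OF that] away_iff[OF k2] by blast
  have cellm: "cell (model n j t) = cell (model n j t')" if t: "t \<in> {s..w}" "t' \<in> {s..w}" and j: "1 \<le> j" "j \<le> N" for t t' j
  proof (rule cell_constant[OF _ _ t])
    show "continuous_on {s..w} (model n j)"
      by (rule continuous_on_subset[OF model_continuous[OF st]]) (use sub in auto)
    show "model n j t \<noteq> pi * of_int k" if "t \<in> {s..w}" for t k
      using far[OF that j, of k] k2 by auto
  qed
  have surv: "away \<kappa> (th i t)" if t: "t \<in> {s..w}" and i: "i \<le> n + N" for t i
  proof (cases "i \<le> n")
    case True
    thus ?thesis using stageD(2)[OF st sub[OF t]] by blast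
  next
    case False
    then obtain i' where i': "i = n + i'" "i' \<le> N" using i by (metis add_le_cancel_left le_add_diff_inverse nat_le_linear)
    show ?thesis
      using point_survives[OF stageD(2)[OF st sub[OF t] order_refl] N(2) aw2[OF t], of N] i' by simp
  qed
  have surv_chi: "away \<kappa> (chi (a (Suc i)) (orbit l a i t))" if t: "t \<in> {s..w}" and i: "i < n + N" for t i
  proof (cases "i < n")
    case True
    thus ?thesis using stageD(9)[OF st sub[OF t]] by blast
  next
    case False
    then obtain i' where i': "i = n + i'" "i' < N" using i by (metis add_less_cancel_left le_add_diff_inverse not_less)
    show ?thesis
      using point_survives[OF stageD(2)[OF st sub[OF t] order_refl] N(2) aw2[OF t], of N] i' by simp
  qed
  have cells: "cell (th (n + N) t) = cell (th (n + N) t')" if t: "t \<in> {s..w}" "t' \<in> {s..w}" for t t'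
  proof -
    have "cell (th (n + N) t) = cell (model n N t)" if t: "t \<in> {s..w}" for t
      using point_survives[OF stageD(2)[OF st sub[OF t] order_refl] N(2) aw2[OF t], of N] N(1) by auto
    thus ?thesis using cellm[OF t, of N] N(1) t by auto
  qed
  have pow: "4 \<le> (2::real) ^ e"
  proof -
    have "(2::real) ^ 2 \<le> 2 ^ e" using e by (intro power_increasing) auto
    thus ?thesis by simp
  qed
  have inc: "(2 ^ e / 2 - 1 / 8) * (th n t' - th n t) \<le> th (n + N) t' - th (n + N) t"
      "th (n + N) t' - th (n + N) t \<le> stretch * (th n t' - th n t)"
      "0 < th (n + N) t' - th (n + N) t"
      "- (th (n + N) t' - th (n + N) t) / 2 \<le> ps (n + N) t' - ps (n + N) t"
      "ps (n + N) t' - ps (n + N) t \<le> 2 * (th (n + N) t' - th (n + N) t)"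
      "0 < th n t' - th n t"
    if t: "t \<in> {s..w}" "t' \<in> {s..w}" and tt: "t < t'" for t t'
  proof -
    note T = sub[OF t(1)] sub[OF t(2)]
    define p where "p = th n t' - th n t"
    define P where "P = model n N t' - model n N t"
    define r where "r = model n (N - 1) t' - model n (N - 1) t"
    define p' where "p' = th (n + N) t' - th (n + N) t"
    define r' where "r' = ps (n + N) t' - ps (n + N) t"
    note d = stageD(4,5,6)[OF st T tt, folded p_def]
    have p0: "0 < p" by (rule d)
    have abs: "\<bar>ps n t' - ps n t\<bar> \<le> 2 * (th n t' - th n t)" using d unfolding p_def by argo
    \<comment> \<open>Two steps are needed: the cone condition compares the last increment of the model with the one before.\<close>
    obtain N' where N': "N = Suc (Suc N')" using N(1) by (metis add_2_eq_Suc le_Suc_ex)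
    note ps = pair_survives[OF N(2) stageD(2)[OF st T(1) order_refl] stageD(2)[OF st T(2) order_refl] aw2[OF t(1)] aw2[OF t(2)]
        stageD(3)[OF st T] cellm[OF t] stageD(4)[OF st T tt] abs order_refl, folded p_def p'_def P_def r'_def]
    have e1: "\<bar>p' - P\<bar> \<le> p / 8" by (rule ps(1))
    have e2: "\<bar>r' - r\<bar> \<le> p / 8" using ps(2) by (simp add: r_def N')
    have g: "1 \<le> growth (shift n) j" for j by (rule growth_props(1)[OF shift_bounds(1) shift_bounds(2)])
    have mono: "0 \<le> model n j t' - model n j t" for j
    proof -
      have "0 \<le> growth (shift n) j * (th n t' - th n t) / 2" using g[of j] p0 by (simp add: p_def)
      thus ?thesis using model_increment(1)[OF st T tt, of j] by linarith
    qed
    have r0: "0 \<le> r" unfolding r_def by (rule mono)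
    have Pr: "r \<le> P"
    proof -
      have b: "1 \<le> real (shift n N)" using shift_bounds(1)[of N n] N(1) by simp
      have "P = real (shift n N) * r + (model n N' t' - model n N' t)"
        by (simp add: P_def r_def N' algebra_simps)
      moreover have "1 * r \<le> real (shift n N) * r" using b r0 by (intro mult_right_mono) auto
      ultimately show ?thesis using mono[of N'] by linarith
    qed
    have low: "2 ^ e * p / 2 \<le> P"
    proof -
      have "2 ^ e * p \<le> growth (shift n) N * p" using N(3) p0 by (intro mult_right_mono) auto
      thus ?thesis using model_increment(1)[OF st T tt, of N] unfolding P_def[symmetric] p_def[symmetric] by linarith
    qed
    have "4 * p \<le> 2 ^ e * p" using pow p0 by (intro mult_right_mono) auto
    hence P2: "2 * p \<le> P" using low by linarith
    have up: "P \<le> 3 * ((real B + 1) * 2 ^ e * p)"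
    proof -
      have "growth (shift n) N * p \<le> (real B + 1) * 2 ^ e * p" using N(4) p0 by (intro mult_right_mono) auto
      thus ?thesis using model_increment(2)[OF st T tt, of N] unfolding P_def[symmetric] p_def[symmetric] mult.assoc by linarith
    qed
    define X where "X = (real B + 1) * 2 ^ e * p"
    have "1 * p \<le> (real B + 1) * 2 ^ e * p" using p0 by (intro mult_right_mono) (auto intro: mult_ge1_I)
    hence "p \<le> X" by (simp only: X_def mult_1)
    moreover have "P \<le> 3 * X" using up by (simp only: X_def)
    ultimately have "P + p / 8 \<le> 4 * X" using p0 by linarith
    hence "P + p / 8 \<le> stretch * p" by (simp only: stretch_def X_def mult.assoc)
    moreover have pP: "p' \<le> P + p / 8" "P - p / 8 \<le> p'" using e1 by linarith+
    ultimately show "th (n + N) t' - th (n + N) t \<le> stretch * (th n t' - th n t)"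
      unfolding p_def[symmetric] p'_def[symmetric] by linarith
    show "(2 ^ e / 2 - 1 / 8) * (th n t' - th n t) \<le> th (n + N) t' - th (n + N) t"
      unfolding p_def[symmetric] p'_def[symmetric] using pP low by (simp add: left_diff_distrib)
    show "0 < th (n + N) t' - th (n + N) t" unfolding p'_def[symmetric] using pP P2 p0 by linarith
    have r': "r' \<le> r + p / 8" "r - p / 8 \<le> r'" using e2 by linarith+
    show "- (th (n + N) t' - th (n + N) t) / 2 \<le> ps (n + N) t' - ps (n + N) t"
      unfolding p'_def[symmetric] r'_def[symmetric] using r' pP P2 p0 r0 by argo
    show "ps (n + N) t' - ps (n + N) t \<le> 2 * (th (n + N) t' - th (n + N) t)"
      unfolding p'_def[symmetric] r'_def[symmetric] using r' pP P2 p0 Pr by argo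
    show "0 < th n t' - th n t" using p0 by (simp add: p_def)
  qed
  have contn: "continuous_on {s..w} (th n)"
    by (rule continuous_on_subset[OF stageD(7)[OF st]]) (use sub in auto)
  have cont: "continuous_on {s..w} (th (n + N))"
  proof (rule continuous_on_dominated[OF contn constants(9)])
    fix x y assume xy: "x \<in> {s..w}" "y \<in> {s..w}"
    have le: "\<bar>th (n + N) x - th (n + N) y\<bar> \<le> stretch * \<bar>th n x - th n y\<bar>" if "x \<in> {s..w}" "y \<in> {s..w}" "x < y" for x y
    proof -
      have "\<bar>th (n + N) x - th (n + N) y\<bar> = th (n + N) y - th (n + N) x" "\<bar>th n x - th n y\<bar> = th n y - th n x"
        using inc(3,6)[OF that] by simp_all
      thus ?thesis using inc(2)[OF that] by simp
    qed
    show "\<bar>th (n + N) x - th (n + N) y\<bar> \<le> stretch * \<bar>th n x - th n y\<bar>"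
      using le[OF xy] le[OF xy(2,1)] by (cases x y rule: linorder_cases) (auto simp: abs_minus_commute)
  qed
  have swm: "s \<in> {s..w}" "w \<in> {s..w}" using sw by auto
  have "ell \<le> (2 ^ e / 2 - 1 / 8) * (ell / real parts)"
  proof -
    have "(2 ^ e / 2 - 1 / 8) * (ell / real parts) = 2 * ell - ell / (8 * real parts)"
      unfolding constants(6) using constants(3) by (simp add: field_simps)
    moreover have "ell / (8 * real parts) \<le> ell / 1"
    proof -
      have "1 \<le> real parts" by (simp add: parts_def)
      thus ?thesis using constants(1) by (intro divide_left_mono) auto
    qed
    ultimately show ?thesis by simp
  qed
  hence reach: "th (n + N) s + ell \<le> th (n + N) w"
    using inc(1)[OF swm sw(2)] len by simp
  obtain v' where v': "s \<le> v'" "v' \<le> w" "th (n + N) v' = th (n + N) s + ell"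
    using IVT'[of "th (n + N)" s "th (n + N) s + ell" w] reach cont sw constants(1) by auto
  have sv': "s < v'"
  proof (rule ccontr)
    assume "\<not> s < v'"
    hence "v' = s" using v' by simp
    thus False using v' constants(1) by simp
  qed
  have sub': "t \<in> {s..w}" if "t \<in> {s..v'}" for t using that v' by auto
  have "stage (n + N) s v'"
    unfolding stage_def
  proof (intro conjI ballI allI impI)
    show "continuous_on {s..v'} (th (n + N))" by (rule continuous_on_subset[OF cont]) (use sub' in auto)
  qed (use sv' surv surv_chi cells inc sub' v' in auto)
  thus ?thesis using sv' v'(2) inc(2) sub' by blast
qed

text \<open>Two pieces spoiled at the same time \<open>j\<close> are spoiled by the same point of \<open>\<pi> \<int>\<close>, since the
model image of the whole interval has length at most \<open>1\<close>. Model increments are at least half of the initial ones, so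
the spoiling points of the two pieces have initial angles less than \<open>8 \<kappa>\<close>, the length of one piece, apart. Hence
the pieces are adjacent, and each time spoils at most two.\<close>

lemma stage_children:
  assumes st: "stage n u v"
  shows "\<exists>N f g. 1 \<le> N \<and> (\<forall>i<kids. stage (n + N) (f i) (g i) \<and> u \<le> f i \<and> g i \<le> v \<and>
      (\<forall>t\<in>{f i..g i}. \<forall>t'\<in>{f i..g i}. t < t' \<longrightarrow> th (n + N) t' - th (n + N) t \<le> stretch * (th n t' - th n t)))
    \<and> (\<forall>i j. i < j \<longrightarrow> j < kids \<longrightarrow> g i \<le> f j)"
proof -
  obtain N where N: "2 \<le> N" "N \<le> 2 * e" "2 ^ e \<le> growth (shift n) N"
    and Nall: "\<And>j. j \<le> N \<Longrightarrow> growth (shift n) j \<le> (real B + 1) * 2 ^ e"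
    using lin_stopping_time[of "shift n" B e, OF shift_bounds(1) shift_bounds(2) e(2)] by blast
  have g1: "1 \<le> growth (shift n) j" for j by (rule growth_props(1)[OF shift_bounds(1) shift_bounds(2)])
  note uv = stageD(1)[OF st]
  have "\<exists>t. t \<in> {u..v} \<and> th n t = th n u + real i * (ell / real parts)" if "i \<le> parts" for i
  proof -
    have "real i * (ell / real parts) \<le> real parts * (ell / real parts)"
      using that constants(1,3) by (intro mult_right_mono) auto
    hence "th n u + real i * (ell / real parts) \<le> th n v"
      using stageD(8)[OF st] constants(3) by simp
    moreover have "0 \<le> real i * (ell / real parts)" using constants(1,3) by simp
    ultimately show ?thesis
      using IVT'[of "th n" u "th n u + real i * (ell / real parts)" v] stageD(7)[OF st] uv by auto
  qed
  then obtain \<tau> where \<tau>: "\<And>i. i \<le> parts \<Longrightarrow> \<tau> i \<in> {u..v}"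
    "\<And>i. i \<le> parts \<Longrightarrow> th n (\<tau> i) = th n u + real i * (ell / real parts)" by metis
  have th_mono: "th n t \<le> th n t'" if "t \<in> {u..v}" "t' \<in> {u..v}" "t \<le> t'" for t t'
    using stageD(4)[OF st that(1,2)] that(3) by (cases "t = t'") auto
  have \<tau>_less: "\<tau> i < \<tau> j" if "i < j" "j \<le> parts" for i j
  proof (rule ccontr)
    assume "\<not> \<tau> i < \<tau> j"
    hence "th n (\<tau> j) \<le> th n (\<tau> i)" using th_mono[OF \<tau>(1) \<tau>(1)] that by simp
    hence "real j * (ell / real parts) \<le> real i * (ell / real parts)" using \<tau>(2) that by simp
    moreover have "0 < ell / real parts" using constants(1,3) by simp
    ultimately have "real j \<le> real i" using mult_le_cancel_right_pos by blast
    thus False using that by simp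
  qed
  have \<tau>_le: "\<tau> i \<le> \<tau> j" if "i \<le> j" "j \<le> parts" for i j
    using \<tau>_less[of i j] that by (cases "i = j") auto
  \<comment> \<open>A piece is spoiled at time \<open>j\<close> if its model image comes within \<open>2 \<kappa>\<close> of \<open>\<pi> \<int>\<close>.\<close>
  define bad where "bad j = {i. i < parts \<and> (\<exists>t\<in>{\<tau> i..\<tau> (Suc i)}. \<exists>k::int. \<bar>model n j t - pi * of_int k\<bar> < 2 * \<kappa>)}" for j
  have bad_fin: "finite (bad j)" for j by (rule finite_subset[of _ "{..<parts}"]) (auto simp: bad_def)
  have bad_card: "card (bad j) \<le> 2" if j: "j \<le> N" for j
  proof (rule card_le_2_if_adjacent[OF bad_fin])
    fix i i' assume i: "i \<in> bad j" and i': "i' \<in> bad j" and ii: "i < i'"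
    obtain t k where t: "t \<in> {\<tau> i..\<tau> (Suc i)}" "\<bar>model n j t - pi * of_int k\<bar> < 2 * \<kappa>" and ip: "i < parts"
      using i by (auto simp: bad_def)
    obtain t' k' where t': "t' \<in> {\<tau> i'..\<tau> (Suc i')}" "\<bar>model n j t' - pi * of_int k'\<bar> < 2 * \<kappa>" and ip': "i' < parts"
      using i' by (auto simp: bad_def)
    have T: "t \<in> {u..v}" "t' \<in> {u..v}" using t(1) t'(1) \<tau>(1)[of i] \<tau>(1)[of "Suc i"] \<tau>(1)[of i'] \<tau>(1)[of "Suc i'"] ip ip' by auto
    show "i' \<le> Suc i"
    proof (cases "t < t'")
      case False
      hence "\<tau> i' \<le> \<tau> (Suc i)" using t t' by auto
      thus ?thesis using \<tau>_less[of "Suc i" i'] ip' by (meson not_le_imp_less not_less order_less_imp_le)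
    next
      case True
      note m = model_increment[OF st T True, of j]
      have p: "0 < th n t' - th n t" by (rule stageD(4)[OF st T True])
      have pe: "th n t' - th n t \<le> ell"
        using th_mono[of t' v] th_mono[of u t] T uv stageD(8)[OF st] by auto
      have "growth (shift n) j * (th n t' - th n t) \<le> (real B + 1) * 2 ^ e * ell"
        using Nall[OF j] g1[of j] p pe by (intro mult_mono) auto
      also have "\<dots> = 1 / 3"
      proof -
        have "0 < (real B + 1) * 2 ^ e" by simp
        thus ?thesis unfolding ell_def mult.assoc by simp
      qed
      finally have "model n j t' - model n j t \<le> 1" using m(2) unfolding mult.assoc by linarith
      moreover have "0 \<le> model n j t' - model n j t"
      proof -
        have "0 \<le> growth (shift n) j * (th n t' - th n t) / 2" using g1[of j] p by simp
        thus ?thesis using m(1) by linarith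
      qed
      ultimately have kk: "\<bar>pi * of_int k' - pi * of_int k\<bar> < 1 + 4 * \<kappa>" using t(2) t'(2) by linarith
      have "\<kappa> \<le> 1 / 4"
      proof -
        have "1 \<le> real parts" by (simp add: parts_def)
        hence "ell / (8 * real parts) \<le> 1 / 8" using constants(1,2) by (intro frac_le) auto
        thus ?thesis using constants(7) by simp
      qed
      hence "\<bar>pi * (of_int k' - of_int k)\<bar> < pi" using kk pi_gt3 by (simp add: right_diff_distrib)
      hence "\<bar>real_of_int k' - real_of_int k\<bar> < 1" by (simp add: abs_mult)
      hence "k' = k" by linarith
      hence "model n j t' - model n j t < 4 * \<kappa>" using t(2) t'(2)[unfolded \<open>k' = k\<close>] by linarith
      moreover define D where "D = th n t' - th n t"
      moreover have "1 * D \<le> growth (shift n) j * D"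
        using g1[of j] p unfolding D_def by (intro mult_right_mono) auto
      ultimately have "D < 8 * \<kappa>" using m(1)[folded D_def] by linarith
      hence lt: "th n t' - th n t < 8 * \<kappa>" by (simp only: D_def)
      have "th n (\<tau> i') \<le> th n t'" "th n t \<le> th n (\<tau> (Suc i))"
        using th_mono \<tau>(1)[of i'] \<tau>(1)[of "Suc i"] T t(1) t'(1) ip ip' by auto
      hence "th n (\<tau> i') - th n (\<tau> (Suc i)) < 8 * \<kappa>" using lt by linarith
      hence "real i' * (ell / real parts) - real (Suc i) * (ell / real parts) < ell / real parts"
        using \<tau>(2)[of i'] \<tau>(2)[of "Suc i"] ip ip' constants(7) by simp
      hence "real i' * (ell / real parts) < (real (Suc i) + 1) * (ell / real parts)"
        unfolding distrib_right[of "real (Suc i)"] mult_1 by linarith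
      moreover have "0 < ell / real parts" using constants(1,3) by simp
      ultimately have "real i' < real (Suc i) + 1" using mult_less_cancel_right_pos by blast
      thus ?thesis by linarith
    qed
  qed
  define good where "good = {..<parts} - (\<Union>j\<in>{1..N}. bad j)"
  have "card (\<Union>j\<in>{1..N}. bad j) \<le> (\<Sum>j\<in>{1..N}. card (bad j))" by (rule card_UN_le) simp
  also have "\<dots> \<le> (\<Sum>j\<in>{1..N}. 2)" using bad_card by (intro sum_mono) auto
  also have "\<dots> = 2 * N" by simp
  finally have "card (\<Union>j\<in>{1..N}. bad j) \<le> 2 * N" .
  moreover have "card {..<parts} - card (\<Union>j\<in>{1..N}. bad j) \<le> card good"
    unfolding good_def by (rule diff_card_le_card_Diff) (use bad_fin in auto)
  moreover have "2 * N \<le> kids" using N(2) e(3) by (simp add: kids_def)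
  ultimately have gc: "kids \<le> card good" using constants(4) by simp
  have gf: "finite good" by (simp add: good_def)
  obtain s where s: "\<And>i. i < kids \<Longrightarrow> s i \<in> good" "\<And>i j. i < j \<Longrightarrow> j < kids \<Longrightarrow> s i < s j"
    using increasing_enumeration[OF gf gc] by blast
  have "\<exists>v'. \<tau> (s i) < v' \<and> v' \<le> \<tau> (Suc (s i)) \<and> stage (n + N) (\<tau> (s i)) v' \<and>
    (\<forall>t\<in>{\<tau> (s i)..v'}. \<forall>t'\<in>{\<tau> (s i)..v'}. t < t' \<longrightarrow> th (n + N) t' - th (n + N) t \<le> stretch * (th n t' - th n t))"
    if i: "i < kids" for i
  proof (rule piece_survives[OF st])
    have sp: "s i < parts" "\<And>j. j \<in> {1..N} \<Longrightarrow> s i \<notin> bad j" using s(1)[OF i] by (auto simp: good_def)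
    show "u \<le> \<tau> (s i)" "\<tau> (Suc (s i)) \<le> v" "\<tau> (s i) < \<tau> (Suc (s i))"
      using \<tau>(1)[of "s i"] \<tau>(1)[of "Suc (s i)"] \<tau>_less[of "s i" "Suc (s i)"] sp by auto
    show "2 * \<kappa> \<le> \<bar>model n j t - pi * of_int k\<bar>" if "t \<in> {\<tau> (s i)..\<tau> (Suc (s i))}" "1 \<le> j" "j \<le> N" for t j k
    proof (rule ccontr)
      assume "\<not> ?thesis"
      hence "s i \<in> bad j" unfolding bad_def using sp(1) that(1) by (auto simp: not_le)
      thus False using sp(2)[of j] that by simp
    qed
    show "th n (\<tau> (Suc (s i))) - th n (\<tau> (s i)) = ell / real parts"
      using \<tau>(2)[of "s i"] \<tau>(2)[of "Suc (s i)"] sp(1) by (simp add: algebra_simps add_divide_distrib)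
  qed (use N Nall[of N] in auto)
  then obtain v' where v': "\<And>i. i < kids \<Longrightarrow> v' i \<le> \<tau> (Suc (s i)) \<and> stage (n + N) (\<tau> (s i)) (v' i) \<and>
    (\<forall>t\<in>{\<tau> (s i)..v' i}. \<forall>t'\<in>{\<tau> (s i)..v' i}. t < t' \<longrightarrow> th (n + N) t' - th (n + N) t \<le> stretch * (th n t' - th n t))"
    by metis
  have sp: "Suc (s i) \<le> parts" if "i < kids" for i using s(1)[OF that] by (auto simp: good_def)
  show ?thesis
  proof (rule exI[of _ N], rule exI[of _ "\<lambda>i. \<tau> (s i)"], rule exI[of _ v'], intro conjI allI impI)
    fix i assume i: "i < kids"
    show "stage (n + N) (\<tau> (s i)) (v' i)" using v'[OF i] by blast
    show "u \<le> \<tau> (s i)" using \<tau>(1)[of "s i"] sp[OF i] by simp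
    show "v' i \<le> v" using v'[OF i] \<tau>(1)[OF sp[OF i]] by simp
    show "\<forall>t\<in>{\<tau> (s i)..v' i}. \<forall>t'\<in>{\<tau> (s i)..v' i}. t < t' \<longrightarrow> th (n + N) t' - th (n + N) t \<le> stretch * (th n t' - th n t)"
      using v'[OF i] by blast
  next
    fix i j assume ij: "i < j" "j < kids"
    have "v' i \<le> \<tau> (Suc (s i))" using v'[of i] ij by simp
    also have "\<dots> \<le> \<tau> (s j)" using s(2)[OF ij] sp[OF ij(2)] by (intro \<tau>_le) auto
    finally show "v' i \<le> \<tau> (s j)" .
  qed (use N in simp)
qed

end

section \<open>The dimension of the surviving set\<close>

lemma arctan_lipschitz: "\<bar>arctan x - arctan y\<bar> \<le> \<bar>x - y\<bar>"
proof -
  have "norm (arctan x - arctan y) \<le> 1 * norm (x - y)"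
  proof (rule field_differentiable_bound[where S = UNIV and f' = "\<lambda>x. inverse (1 + x\<^sup>2)"])
    show "norm (inverse (1 + z\<^sup>2)) \<le> 1" for z :: real
    proof -
      have "1 \<le> 1 + z\<^sup>2" by simp
      hence "inverse (1 + z\<^sup>2) \<le> 1" by (rule inverse_le_1_iff[THEN iffD2, OF disjI2])
      thus ?thesis by simp
    qed
  qed (auto intro: DERIV_arctan)
  thus ?thesis by simp
qed

context orbit_chart begin

lemma l_le_quarter: "\<bar>l\<bar> \<le> 1 / 4"
proof -
  have "sin \<kappa> ^ 5 \<le> 1" using sin_kappa by (intro power_le_one) auto
  moreover have d16: "\<delta> \<le> 1 / 16" using \<delta>_bounds(1)[of 0] constants(8) by simp
  ultimately have "sin \<kappa> ^ 5 * min \<delta> 1 \<le> 1 * (1 / 16)" using sin_kappa \<delta> by (intro mult_mono) auto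
  hence "l\<^sup>2 \<le> (1 / 4)\<^sup>2" using l_small by (simp add: power2_eq_square)
  thus ?thesis using abs_le_square_iff[of l "1/4"] by simp
qed

lemma ell_le_third: "ell \<le> 1 / 3"
proof -
  have "1 * 1 \<le> (real B + 1) * 2 ^ e" by (intro mult_mono one_le_power) auto
  thus ?thesis unfolding ell_def mult.assoc by (intro divide_left_mono) auto
qed

lemma initial_away:
  assumes t: "t \<in> {pi / 3..pi / 3 + ell}"
  shows "away (pi / 6) t" "cell t = 0" "1 / 2 \<le> sin t"
proof -
  have t': "pi / 3 \<le> t" "t \<le> pi / 3 + 1 / 3" using t ell_le_third by auto
  show c: "cell t = 0" by (rule cell_unique) (use t' pi_gt3 in auto)
  show aw: "away (pi / 6) t" unfolding away_def c using t' pi_gt3 by auto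
  have "0 < sin t" using t' pi_gt3 by (intro sin_gt_zero) auto
  thus "1 / 2 \<le> sin t" using away_abs_sin(1)[OF aw] by (simp add: sin_30)
qed

text \<open>The root lies where \<open>sin t \<ge> 1/2\<close>, because there the initial phase depends on \<open>t\<close> only weakly.\<close>

lemma stage_0: "stage 0 (pi / 3) (pi / 3 + ell)"
proof -
  have inc: "\<bar>arctan (l / (2 * sin t')) - arctan (l / (2 * sin t))\<bar> \<le> (t' - t) / 2"
    if t: "t \<in> {pi / 3..pi / 3 + ell}" "t' \<in> {pi / 3..pi / 3 + ell}" and tt: "t < t'" for t t'
  proof -
    have s: "1 / 2 \<le> sin t" "1 / 2 \<le> sin t'" using initial_away(3) t by auto
    have "1 / 2 * (1 / 2) \<le> sin t * sin t'" using s by (intro mult_mono) auto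
    hence ss: "1 / 4 \<le> sin t * sin t'" by simp
    have "\<bar>sin t - sin t'\<bar> \<le> t' - t"
    proof -
      have "norm (sin t - sin t') \<le> 1 * norm (t - t')"
        by (rule field_differentiable_bound[where S = UNIV and f' = cos]) (auto intro: DERIV_sin)
      thus ?thesis using tt by simp
    qed
    hence "\<bar>l\<bar> * \<bar>sin t - sin t'\<bar> \<le> 1 / 4 * (t' - t)" using l_le_quarter by (intro mult_mono) auto
    moreover have "l / (2 * sin t') - l / (2 * sin t) = l * (sin t - sin t') / (2 * (sin t * sin t'))"
      using s by (simp add: field_simps)
    ultimately have "\<bar>l / (2 * sin t') - l / (2 * sin t)\<bar> \<le> (1 / 4 * (t' - t)) / (2 * (1 / 4))"
    proof -
      have "\<bar>2 * (sin t * sin t')\<bar> = 2 * (sin t * sin t')" using ss by simp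
      thus ?thesis using ss tt \<open>\<bar>l\<bar> * \<bar>sin t - sin t'\<bar> \<le> 1 / 4 * (t' - t)\<close>
        \<open>l / (2 * sin t') - l / (2 * sin t) = l * (sin t - sin t') / (2 * (sin t * sin t'))\<close>
        by (simp only: abs_divide abs_mult[of l]) (intro frac_le; simp)
    qed
    thus ?thesis using arctan_lipschitz[of "l / (2 * sin t')" "l / (2 * sin t)"] by simp
  qed
  have aw: "away \<kappa> t" if "t \<in> {pi / 3..pi / 3 + ell}" for t
  proof -
    have "1 \<le> real parts" by (simp add: parts_def)
    hence "ell / (8 * real parts) \<le> ell / 8" using constants(1) by (intro divide_left_mono) auto
    hence "\<kappa> \<le> pi / 6" using constants(7) ell_le_third pi_gt3 by linarith
    thus ?thesis using initial_away(1)[OF that] by (simp add: away_def)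
  qed
  have psi: "- (t' - t) / 2 \<le> arctan (l / (2 * sin t')) - arctan (l / (2 * sin t))"
    "arctan (l / (2 * sin t')) - arctan (l / (2 * sin t)) \<le> 2 * (t' - t)"
    if "t \<in> {pi / 3..pi / 3 + ell}" "t' \<in> {pi / 3..pi / 3 + ell}" "t < t'" for t t'
    using inc[OF that] that(3) unfolding abs_le_iff by argo+
  show ?thesis
    unfolding stage_def
  proof (intro conjI ballI allI impI)
    show "continuous_on {pi / 3..pi / 3 + ell} (th 0)" by simp
  qed (use constants(1) initial_away(2) aw psi in \<open>simp_all\<close>)
qed

definition start_point :: "real \<Rightarrow> real^3" where
  "start_point t = vector [cos t - l / 2, cos t, 1]"

lemma start_point_line: "start_point t \<in> L_line l"
proof -
  have "start_point t = vector [(2 * cos t - l) / 2, 2 * cos t / 2, 1]"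
    by (simp add: start_point_def diff_divide_distrib)
  thus ?thesis unfolding L_line_def by blast
qed

text \<open>The sine and cosine of the initial phase multiplied by the amplitude are
\<open>l / (2 sin t)\<close> and \<open>1\<close>.\<close>

lemma polar_start:
  assumes "0 < sin t"
  shows "polar (orbit l a 0 t) = start_point t"
proof -
  define x where "x = l / (2 * sin t)"
  have A: "ampl l t = sqrt (1 + x\<^sup>2)" by (simp add: ampl_def x_def power_divide power_mult_distrib)
  have p: "0 < sqrt (1 + x\<^sup>2)" by (simp add: add_pos_nonneg)
  have c: "ampl l t * cos (arctan x) = 1" using p by (simp add: A cos_arctan)
  have s: "ampl l t * sin (arctan x) = x" using p by (simp add: A sin_arctan)
  have "ampl l t * cos (arctan x + t) = (ampl l t * cos (arctan x)) * cos t - (ampl l t * sin (arctan x)) * sin t"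
    by (simp add: cos_add algebra_simps)
  also have "\<dots> = cos t - l / 2" unfolding c s using assms by (simp add: x_def)
  finally show ?thesis using c by (simp add: polar_def start_point_def x_def)
qed

lemma trace_iter_polar:
  assumes t: "0 < sin t" and th: "\<And>j. away \<kappa> (th j t)" and ch: "\<And>j. away \<kappa> (chi (a (Suc j)) (orbit l a j t))"
  shows "trace_iter a n (start_point t) = polar (orbit l a n t)"
proof (induction n)
  case 0
  thus ?case using polar_start[OF t] by simp
next
  case (Suc n)
  have "away \<kappa> (fst (angle_step l (a (Suc n)) (orbit l a n t)))" using th[of "Suc n"] by simp
  from trace_map_polar[OF th ch this] show ?case using Suc by simp
qed

lemma trace_iter_surf: "x \<in> S_surf l \<Longrightarrow> trace_iter a n x \<in> S_surf l"
  by (induction n) (auto intro: trace_map_S_surf)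

end

text \<open>The distance to the punctures is at least \<open>1 - \<bar>x\<^sub>2\<bar>\<close>. For fixed \<open>x\<^sub>2\<close> the other coordinates lie on an ellipse on which
\<open>x\<^sub>1\<^sup>2 + x\<^sub>3\<^sup>2 < 2\<close>, so the product of the coordinates is below \<open>1\<close>.\<close>

lemma S_bdd_if_second_coordinate_small:
  assumes sh: "small_hole l \<rho>" and x: "x \<in> S_surf l" and c: "\<bar>x$2\<bar> \<le> c" "\<rho> \<le> 1 - c"
  shows "x \<in> S_bdd \<rho> l"
proof -
  interpret small_hole l \<rho> by (rule sh)
  have S: "(x$1)\<^sup>2 + (x$2)\<^sup>2 + (x$3)\<^sup>2 - 2 * x$1 * x$2 * x$3 = 1 + h"
    using x by (simp add: S_surf_def h_def)
  define d where "d = \<bar>x$2\<bar>"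
  have d: "0 \<le> d" "\<rho> \<le> 1 - d" "d < 1" using c \<rho> by (auto simp: d_def)
  have "\<rho>\<^sup>2 \<le> (x$2 - 1)\<^sup>2"
    by (subst abs_le_square_iff[symmetric]) (use d \<rho> in \<open>auto simp: d_def\<close>)
  moreover have "\<rho>\<^sup>2 \<le> (x$2 + 1)\<^sup>2"
    by (subst abs_le_square_iff[symmetric]) (use d \<rho> in \<open>auto simp: d_def\<close>)
  ultimately have R: "x \<in> R"
    unfolding mem_R[of x] mem_punctured using S
      zero_le_power2[of "x$1 - 1"] zero_le_power2[of "x$1 + 1"] zero_le_power2[of "x$3 - 1"] zero_le_power2[of "x$3 + 1"]
    by linarith
  define T where "T = (x$1)\<^sup>2 + (x$3)\<^sup>2"
  have T0: "0 \<le> T" by (simp add: T_def)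
  have "2 * \<bar>x$1 * x$3\<bar> \<le> T"
    using zero_le_power2[of "x$1 - x$3"] zero_le_power2[of "x$1 + x$3"]
    by (auto simp: T_def power2_eq_square algebra_simps abs_if)
  hence "d * (2 * \<bar>x$1 * x$3\<bar>) \<le> d * T" using d by (intro mult_left_mono) auto
  moreover have "x$1 * x$2 * x$3 \<le> d * \<bar>x$1 * x$3\<bar>"
    unfolding d_def abs_mult[symmetric] using abs_ge_self[of "x$1 * x$2 * x$3"] by (simp add: mult_ac)
  ultimately have p: "2 * (x$1 * x$2 * x$3) \<le> d * T" by linarith
  have hd: "h < (1 - d)\<^sup>2"
  proof -
    have "h \<le> r" by (rule hole_bounds)
    also have "r < \<rho>\<^sup>2" using hole_bounds(2,6) by linarith
    also have "\<rho>\<^sup>2 \<le> (1 - d)\<^sup>2" using d \<rho> by (intro power_mono) auto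
    finally show ?thesis .
  qed
  have "T - d * T \<le> 1 - d\<^sup>2 + h"
    using S p by (simp add: T_def d_def)
  hence "(1 - d) * T < (1 - d) * 2" using hd by (simp add: power2_eq_square algebra_simps)
  hence T2: "T < 2" using d mult_less_cancel_left_pos[of "1 - d" T 2] by linarith
  have "d * T \<le> 1 * T" using d T0 by (intro mult_right_mono) auto
  hence "x$1 * x$2 * x$3 < 1" using p T2 by linarith
  thus ?thesis using R S_bdd_small_hole by simp
qed

context orbit_chart begin

text \<open>The orbit of a limit point of the tree is controlled up to every time because the time of an interval
of level \<open>k\<close> is at least \<open>k\<close>. On the root interval the map from the angle to the line is bi-Lipschitz.\<close>

lemma dimension_bound:
  assumes s: "0 < s" "stretch powr s \<le> real kids" and k2: "2 \<le> kids"
    and hole: "small_hole l \<rho>" and \<rho>: "\<rho> \<le> 1 - cos \<kappa>"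
  shows "ereal s \<le> hausdorff_dim (L_line l \<inter> surv a \<rho> l)"
proof -
  define P where "P k u v \<longleftrightarrow> (\<exists>n\<ge>k. stage n u v \<and>
      (\<forall>t\<in>{u..v}. \<forall>t'\<in>{u..v}. t < t' \<longrightarrow> th n t' - th n t \<le> stretch ^ k * (t' - t)))" for k u v
  have stretch1: "1 \<le> stretch"
  proof -
    have "1 * 1 \<le> (4 * (real B + 1)) * 2 ^ e" by (intro mult_mono one_le_power) auto
    thus ?thesis by (simp only: stretch_def mult_1)
  qed
  have root: "P 0 (pi / 3) (pi / 3 + ell)"
    unfolding P_def using stage_0 by (intro exI[of _ 0]) auto
  have len: "ell / stretch ^ k \<le> v - u" if Pk: "P k u v" for k u v
  proof -
    obtain n where st: "stage n u v" and b: "\<forall>t\<in>{u..v}. \<forall>t'\<in>{u..v}. t < t' \<longrightarrow> th n t' - th n t \<le> stretch ^ k * (t' - t)"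
      using Pk unfolding P_def by blast
    have "th n v - th n u \<le> stretch ^ k * (v - u)" using b stageD(1)[OF st] by simp
    hence "ell \<le> stretch ^ k * (v - u)" using stageD(8)[OF st] by simp
    thus ?thesis using constants(9) by (simp add: field_simps)
  qed
  have children: "\<exists>f g. (\<forall>i<kids. P (Suc k) (f i) (g i) \<and> u \<le> f i \<and> g i \<le> v) \<and> (\<forall>i j. i < j \<longrightarrow> j < kids \<longrightarrow> g i \<le> f j)"
    if Pk: "P k u v" for k u v
  proof -
    obtain n where n: "k \<le> n" and st: "stage n u v"
      and b: "\<And>t t'. t \<in> {u..v} \<Longrightarrow> t' \<in> {u..v} \<Longrightarrow> t < t' \<Longrightarrow> th n t' - th n t \<le> stretch ^ k * (t' - t)"
      using Pk unfolding P_def by blast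
    obtain N f g where Nfg: "1 \<le> N \<and> (\<forall>i<kids. stage (n + N) (f i) (g i) \<and> u \<le> f i \<and> g i \<le> v \<and>
        (\<forall>t\<in>{f i..g i}. \<forall>t'\<in>{f i..g i}. t < t' \<longrightarrow> th (n + N) t' - th (n + N) t \<le> stretch * (th n t' - th n t)))
      \<and> (\<forall>i j. i < j \<longrightarrow> j < kids \<longrightarrow> g i \<le> f j)"
      using stage_children[OF st] by (elim exE) (rule that)
    hence N: "1 \<le> N" and fg: "\<And>i. i < kids \<Longrightarrow> stage (n + N) (f i) (g i)"
      "\<And>i. i < kids \<Longrightarrow> u \<le> f i" "\<And>i. i < kids \<Longrightarrow> g i \<le> v"
      "\<And>i t t'. i < kids \<Longrightarrow> t \<in> {f i..g i} \<Longrightarrow> t' \<in> {f i..g i} \<Longrightarrow> t < t' \<Longrightarrow> th (n + N) t' - th (n + N) t \<le> stretch * (th n t' - th n t)"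
      and ord: "\<forall>i j. i < j \<longrightarrow> j < kids \<longrightarrow> g i \<le> f j"
      by auto
    have "P (Suc k) (f i) (g i)" if i: "i < kids" for i
      unfolding P_def
    proof (intro exI[of _ "n + N"] conjI ballI impI)
      show "Suc k \<le> n + N" using n N by simp
      show "stage (n + N) (f i) (g i)" by (rule fg(1)[OF i])
      fix t t' assume t: "t \<in> {f i..g i}" "t' \<in> {f i..g i}" "t < t'"
      have uv: "t \<in> {u..v}" "t' \<in> {u..v}" using t fg(2,3)[OF i] by auto
      have "stretch * (th n t' - th n t) \<le> stretch * (stretch ^ k * (t' - t))"
        using b[OF uv t(3)] constants(9) by (intro mult_left_mono) auto
      thus "th (n + N) t' - th (n + N) t \<le> stretch ^ Suc k * (t' - t)"
        using fg(4)[OF i t] by (simp only: power_Suc mult.assoc)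
    qed
    hence "(\<forall>i<kids. P (Suc k) (f i) (g i) \<and> u \<le> f i \<and> g i \<le> v) \<and> (\<forall>i j. i < j \<longrightarrow> j < kids \<longrightarrow> g i \<le> f j)"
      using fg(2,3) ord by simp
    thus ?thesis by - (rule exI, rule exI, assumption)
  qed
  have "\<exists>X C. 0 < C \<and> (\<forall>y\<in>{0..<1}. \<forall>k. \<exists>u v. P k u v \<and> X y \<in> {u..v}) \<and>
      (\<forall>y\<in>{0..<1}. X y \<in> {pi / 3..pi / 3 + ell}) \<and>
      (\<forall>y\<in>{0..<1}. \<forall>y'\<in>{0..<1}. \<bar>y - y'\<bar> \<le> C * \<bar>X y - X y'\<bar> powr s)"
  proof (rule interval_tree_holder)
    show "P 0 (pi / 3) (pi / 3 + ell)" by (rule root)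
    show "ell / stretch ^ k \<le> v - u" if "P k u v" for k u v by (rule len[OF that])
    show "\<exists>f g. (\<forall>i<kids. P (Suc k) (f i) (g i) \<and> u \<le> f i \<and> g i \<le> v) \<and> (\<forall>i j. i < j \<longrightarrow> j < kids \<longrightarrow> g i \<le> f j)"
      if "P k u v" for k u v by (rule children[OF that])
  qed (rule k2 stretch1 constants s)+
  then obtain X C where XC: "0 < C \<and> (\<forall>y\<in>{0..<1}. \<forall>k. \<exists>u v. P k u v \<and> X y \<in> {u..v}) \<and>
      (\<forall>y\<in>{0..<1}. X y \<in> {pi / 3..pi / 3 + ell}) \<and>
      (\<forall>y\<in>{0..<1}. \<forall>y'\<in>{0..<1}. \<bar>y - y'\<bar> \<le> C * \<bar>X y - X y'\<bar> powr s)"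
    by (elim exE) (rule that)
  have C: "0 < C" using XC by (rule conjunct1)
  have nest: "\<exists>u v. P k u v \<and> X y \<in> {u..v}" if "y \<in> {0..<1}" for y k
    using XC that by (elim conjE) (drule (1) bspec, erule spec)
  have X0: "X y \<in> {pi / 3..pi / 3 + ell}" if "y \<in> {0..<1}" for y
    using XC that by (elim conjE) (erule (1) bspec)
  have hol: "\<bar>y - y'\<bar> \<le> C * \<bar>X y - X y'\<bar> powr s" if "y \<in> {0..<1}" "y' \<in> {0..<1}" for y y'
    using XC that by simp
  have mem: "start_point (X y) \<in> L_line l \<inter> surv a \<rho> l" if y: "y \<in> {0..<1}" for y
  proof -
    define t where "t = X y"
    have st: "\<exists>n\<ge>k. \<exists>u v. stage n u v \<and> t \<in> {u..v}" for k
      using nest[OF y, of k] unfolding P_def t_def by blast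
    have th: "away \<kappa> (th j t)" for j using st[of j] stageD(2) by blast
    have ch: "away \<kappa> (chi (a (Suc j)) (orbit l a j t))" for j using st[of "Suc j"] stageD(9) by (meson Suc_le_lessD)
    have sin: "0 < sin t" using initial_away(3)[OF X0[OF y]] by (simp add: t_def)
    have "trace_iter a n (start_point t) \<in> S_bdd \<rho> l" for n
    proof (rule S_bdd_if_second_coordinate_small[OF hole _ _ \<rho>])
      show "trace_iter a n (start_point t) \<in> S_surf l"
        using trace_iter_surf start_point_line L_line_subset by blast
      show "\<bar>trace_iter a n (start_point t) $ 2\<bar> \<le> cos \<kappa>"
        unfolding trace_iter_polar[OF sin th ch] using away_abs_sin(2)[OF th \<kappa>] by (simp add: polar_def)
    qed
    from this[of 0] this show ?thesis unfolding surv_def t_def using start_point_line by simp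
  qed
  have lip: "\<bar>X y - X y'\<bar> \<le> 2 * dist (start_point (X y)) (start_point (X y'))"
    if y: "y \<in> {0..<1}" "y' \<in> {0..<1}" for y y'
  proof -
    have lt: "t' - t \<le> 2 * \<bar>cos t - cos t'\<bar>"
      if t: "t \<in> {pi / 3..pi / 3 + ell}" "t' \<in> {pi / 3..pi / 3 + ell}" and tt: "t < t'" for t t'
    proof -
      obtain z where z: "t < z" "z < t'" "cos t' - cos t = (t' - t) * (- sin z)"
        using MVT2[OF tt, of cos "\<lambda>x. - sin x"] DERIV_cos by blast
      have "1 / 2 \<le> sin z" using initial_away(3)[of z] z t by auto
      hence le: "(t' - t) * (1 / 2) \<le> (t' - t) * sin z" using tt by (intro mult_left_mono) auto
      have W: "(t' - t) * sin z = cos t - cos t'" using z(3) by simp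
      have "t' - t \<le> 2 * (cos t - cos t')" using le[unfolded W] by simp
      also have "\<dots> \<le> 2 * \<bar>cos t - cos t'\<bar>" by (rule mult_left_mono[OF abs_ge_self]) simp
      finally show ?thesis .
    qed
    have "\<bar>X y - X y'\<bar> \<le> 2 * \<bar>cos (X y) - cos (X y')\<bar>"
      using lt[OF X0 X0, OF y] lt[OF X0 X0, OF y(2,1)]
      by (cases "X y" "X y'" rule: linorder_cases) (auto simp: abs_minus_commute)
    also have "\<bar>cos (X y) - cos (X y')\<bar> \<le> dist (start_point (X y)) (start_point (X y'))"
      using dist_vec_nth_le[of "start_point (X y)" 2 "start_point (X y')"]
      by (simp add: start_point_def dist_real_def)
    finally show ?thesis by simp
  qed
  show ?thesis
  proof (rule hausdorff_dim_ge_if_holder_inverse[where X = "\<lambda>y. start_point (X y)" and C = "C * 2 powr s"])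
    fix y y' :: real assume y: "y \<in> {0..<1}" "y' \<in> {0..<1}"
    define D where "D = dist (start_point (X y)) (start_point (X y'))"
    have "\<bar>X y - X y'\<bar> powr s \<le> (2 * D) powr s" unfolding D_def
      using lip[OF y] s by (intro powr_mono2) auto
    also have "\<dots> = 2 powr s * D powr s" by (simp add: powr_mult D_def)
    finally have "C * \<bar>X y - X y'\<bar> powr s \<le> C * (2 powr s * D powr s)" using C by (intro mult_left_mono) auto
    thus "\<bar>y - y'\<bar> \<le> C * 2 powr s * dist (start_point (X y)) (start_point (X y')) powr s"
      using hol[OF y] by (simp add: D_def mult.assoc)
  qed (use s C mem in auto)
qed

end

text \<open>The factor \<open>2^(e (1 - \<epsilon>))\<close> on the left falls behind \<open>2^e\<close> on the right by \<open>2^(e \<epsilon>)\<close>, which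
absorbs all constants for large \<open>e\<close>.\<close>

lemma exponent_exists:
  fixes B :: nat and \<epsilon> :: real
  assumes \<epsilon>: "0 < \<epsilon>" "\<epsilon> < 1"
  shows "\<exists>e::nat. 9 \<le> e \<and> B < 2 ^ e \<and> 4 * e \<le> 2 ^ (e - 3) \<and>
    (4 * (real B + 1) * 2 ^ e) powr (1 - \<epsilon>) \<le> real (2 ^ (e - 3))"
proof -
  define c where "c = log 2 (4 * (real B + 1))"
  define e where "e = nat \<lceil>(3 + c) / \<epsilon>\<rceil> + 9 + B"
  have e9: "9 \<le> e" by (simp add: e_def)
  have "B < 2 ^ B" by (rule less_exp)
  also have "\<dots> \<le> 2 ^ e" by (intro power_increasing) (auto simp: e_def)
  finally have B: "B < 2 ^ e" .
  have four: "4 * (k + 9) \<le> 2 ^ (k + 6)" for k :: nat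
  proof (induction k)
    case (Suc k)
    have "4 * (Suc k + 9) \<le> 2 * (4 * (k + 9))" by simp
    also have "\<dots> \<le> 2 * 2 ^ (k + 6)" using Suc by (rule mult_le_mono2)
    also have "\<dots> = 2 ^ (Suc k + 6)" unfolding add_Suc power_Suc ..
    finally show ?case .
  qed simp
  have e4: "4 * e \<le> 2 ^ (e - 3)"
  proof -
    obtain k where k: "e = k + 9" using e9 by (metis le_add_diff_inverse2)
    show ?thesis using four[of k] by (simp add: k add.commute)
  qed
  have "(3 + c) / \<epsilon> \<le> real (nat \<lceil>(3 + c) / \<epsilon>\<rceil>)" by (rule real_nat_ceiling_ge)
  hence "(3 + c) / \<epsilon> \<le> real e" unfolding e_def of_nat_add by linarith
  hence ec: "3 + c \<le> real e * \<epsilon>" using \<epsilon> by (simp add: field_simps)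
  have "0 \<le> c" unfolding c_def by (rule zero_le_log_cancel_iff[THEN iffD2]) auto
  have K: "4 * (real B + 1) * 2 ^ e = 2 powr (c + real e)"
  proof -
    have "2 powr c = 4 * (real B + 1)" unfolding c_def by (rule powr_log_cancel) auto
    moreover have "2 powr real e = 2 ^ e" by (rule powr_realpow) simp
    ultimately show ?thesis by (simp only: powr_add)
  qed
  have "(c + real e) * (1 - \<epsilon>) \<le> real e - 3"
  proof -
    have "(c + real e) * (1 - \<epsilon>) = c + real e - c * \<epsilon> - real e * \<epsilon>" by (simp add: algebra_simps)
    moreover have "0 \<le> c * \<epsilon>" using \<open>0 \<le> c\<close> \<epsilon> by simp
    ultimately show ?thesis using ec by linarith
  qed
  hence "2 powr ((c + real e) * (1 - \<epsilon>)) \<le> 2 powr (real e - 3)" by (rule powr_mono) simp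
  hence up: "(4 * (real B + 1) * 2 ^ e) powr (1 - \<epsilon>) \<le> 2 powr (real e - 3)" unfolding K powr_powr .
  have "real e - 3 = real (e - 3)" using e9 by (simp add: of_nat_diff)
  hence "2 powr (real e - 3) = 2 powr real (e - 3)" by (rule arg_cong)
  also have "\<dots> = 2 ^ (e - 3)" by (rule powr_realpow) simp
  also have "\<dots> = real (2 ^ (e - 3))" by (simp only: of_nat_power of_nat_numeral)
  finally have "(4 * (real B + 1) * 2 ^ e) powr (1 - \<epsilon>) \<le> real (2 ^ (e - 3))" using up by (rule subst[where P = "\<lambda>x. _ \<le> x"])
  thus ?thesis using e9 B e4 by (intro exI[of _ e] conjI)
qed

theorem theorem3:
  fixes \<alpha> :: real and a :: "nat \<Rightarrow> nat" and \<epsilon> :: real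
  assumes "0 < \<alpha>" and "\<alpha> < 1" and "\<alpha> \<notin> \<rat>"
    and "has_cfrac \<alpha> a"
    and "bounded_type a"
    and "0 < \<epsilon>"
  shows "\<exists>\<rho>>0. \<exists>l0>0. \<forall>l\<in>{0..l0}.
           admissible \<rho> l \<and>
           hausdorff_dim (L_line l \<inter> surv a \<rho> l) \<ge> ereal (1 - \<epsilon>)"
proof -
  have a1: "1 \<le> a k" if "1 \<le> k" for k using assms(4) that by (simp add: has_cfrac_def)
  define B where "B = Max (a ` {1..})"
  have aB: "a k \<le> B" if "1 \<le> k" for k
    unfolding B_def using assms(5) that by (intro Max_ge) (auto simp: bounded_type_def)
  \<comment> \<open>For \<open>\<epsilon> \<ge> 1\<close> the exponent \<open>1 - \<epsilon>\<close> would not be positive.\<close>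
  define \<epsilon>' where "\<epsilon>' = min \<epsilon> (1 / 2)"
  have \<epsilon>': "0 < \<epsilon>'" "\<epsilon>' < 1" "\<epsilon>' \<le> \<epsilon>" using assms(6) by (auto simp: \<epsilon>'_def)
  obtain e where e: "9 \<le> e" "B < 2 ^ e" "4 * e \<le> 2 ^ (e - 3)"
    and Ke: "(4 * (real B + 1) * 2 ^ e) powr (1 - \<epsilon>') \<le> real (2 ^ (e - 3))"
    using exponent_exists[OF \<epsilon>'(1,2)] by blast
  have e1: "1 \<le> e - 3" using e(1) by simp
  define \<kappa> where "\<kappa> = 1 / (3 * (real B + 1) * 2 ^ e) / (8 * 2 ^ (e - 2))"
  have \<kappa>0: "0 < \<kappa>" by (simp add: \<kappa>_def)
  have \<kappa>1: "\<kappa> \<le> 1"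
  proof -
    have "1 * 1 \<le> 3 * (real B + 1) * 2 ^ e" by (intro mult_mono one_le_power) auto
    hence "1 / (3 * (real B + 1) * 2 ^ e) \<le> 1" by simp
    moreover have "1 * 1 \<le> 8 * (2::real) ^ (e - 2)" by (intro mult_mono one_le_power) auto
    ultimately have "\<kappa> \<le> 1 / 1" unfolding \<kappa>_def by (intro frac_le) auto
    thus ?thesis by simp
  qed
  hence \<kappa>: "0 < \<kappa>" "\<kappa> \<le> pi / 2" using \<kappa>0 pi_gt3 by auto
  define C where "C = (2 * real B + 5) ^ (4 * e + 1)"
  define \<delta> where "\<delta> = \<kappa> / (16 * C)"
  have C: "0 < C" by (simp add: C_def)
  have \<delta>: "0 < \<delta>" "16 * \<delta> * C \<le> \<kappa>" using \<kappa>0 C by (auto simp: \<delta>_def)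
  have sin0: "0 < sin \<kappa>" using \<kappa> by (intro sin_gt_zero) auto
  have cos1: "cos \<kappa> < 1" using cos_monotone_0_pi[of 0 \<kappa>] \<kappa> by simp
  define \<rho> where "\<rho> = min (1 / 2) (1 - cos \<kappa>)"
  have \<rho>: "0 < \<rho>" "\<rho> < 1" "\<rho> \<le> 1 - cos \<kappa>" using cos1 by (auto simp: \<rho>_def)
  define b1 where "b1 = sin \<kappa> ^ 5 * min \<delta> 1 / 14"
  define b2 where "b2 = (\<rho>\<^sup>2 / 28)\<^sup>2"
  \<comment> \<open>For \<open>l \<le> 1\<close> the quantity \<open>l\<^sup>2 / 4\<close> is at most \<open>l\<close>, so bounding \<open>l\<close> itself suffices.\<close>
  define l0 where "l0 = min 1 (min b1 b2)"
  have b: "0 < b1" "0 < b2" using sin0 \<delta> \<rho> by (auto simp: b1_def b2_def)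
  have l0: "0 < l0" using b by (simp add: l0_def)
  have "admissible \<rho> l \<and> hausdorff_dim (L_line l \<inter> surv a \<rho> l) \<ge> ereal (1 - \<epsilon>)" if l: "l \<in> {0..l0}" for l
  proof -
    have "l * l \<le> 1 * l" using l by (intro mult_right_mono) (auto simp: l0_def)
    hence "l\<^sup>2 / 4 \<le> l0" using l by (simp add: power2_eq_square)
    hence ll: "l\<^sup>2 / 4 \<le> b1" "l\<^sup>2 / 4 \<le> b2" by (auto simp: l0_def)
    have hole: "small_hole l \<rho>" using \<rho> ll(2) by unfold_locales (auto simp: b2_def)
    interpret orbit_chart l \<kappa> \<delta> a B e
      using \<kappa> \<delta> ll(1) a1 aB e by unfold_locales (auto simp: b1_def \<kappa>_def C_def)
    have "ereal (1 - \<epsilon>') \<le> hausdorff_dim (L_line l \<inter> surv a \<rho> l)"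
    proof (rule dimension_bound[OF _ _ _ hole \<rho>(3)])
      show "0 < 1 - \<epsilon>'" using \<epsilon>' by simp
      show "stretch powr (1 - \<epsilon>') \<le> real kids" using Ke by (simp add: stretch_def kids_def)
      have "(2::nat) ^ 1 \<le> 2 ^ (e - 3)" using e1 by (intro power_increasing) auto
      thus "2 \<le> kids" by (simp add: kids_def)
    qed
    moreover have "ereal (1 - \<epsilon>) \<le> ereal (1 - \<epsilon>')" using \<epsilon>' by simp
    ultimately have "ereal (1 - \<epsilon>) \<le> hausdorff_dim (L_line l \<inter> surv a \<rho> l)" by (rule order_trans[rotated])
    thus ?thesis using small_hole.admissible_small_hole[OF hole] by blast
  qed
  thus ?thesis using \<rho>(1) l0 by blast
qed

end
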